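(* Let $n\ge 3$ and $C(n)=\dfrac{(n+1)^2}{(n-2)(n+4)}$. For every $\psi\in L^2(S^{n-1})$, $$\|\Pi_{\ge4}\psi\|_{L^2}\le C(n)\,\|(L^2-\mathrm{Id})\psi\|_{L^2}.$$ The constant $C(n)$ is sharp for this inequality (it cannot be replaced by a smaller constant). Moreover, as an explicit function of $n$ (regarded as a real variable $n>2$), $C(n)$ decreases to $1$ as $n\to\infty$ and increases to $\infty$ as $n\to2^+$.
   Context: $\mathcal{H}_d$ is the space of spherical harmonics of degree $d$ on the unit sphere $S^{n-1}\subset\mathbb{R}^n$. The Funk transform $(\mathcal{R}f)(u)$ is the average of $f$ over the great subsphere $S^{n-1}\cap u^\perp$ (normalized so that $\mathcal{R}\mathbf 1=\mathbf 1$), extended to a bounded self-adjoint operator on $L^2(S^{n-1})$. $L:=(n-1)\mathcal{R}$ is the linearization at $\rho\equiv1$ of the intersection body shape map $T(\rho)=\mathcal{R}(\rho^{\,n-1})$, and $L^2=L\circ L$ is the composition of $L$ with itself, acting on $L^2(S^{n-1})$. $\Pi_{\ge4}$ is the orthogonal projection of $L^2(S^{n-1})$ onto the closed span of $\bigoplus_{d\ge4}\mathcal{H}_d$. *)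

theory Defs
  imports "HOL-Probability.Probability"
begin

section \<open>Uniform measures on the sphere and on its great subspheres\<close>

text \<open>
  Normalized surface measure on the unit sphere as cone measure: the mass of a Borel set \<open>A\<close> of
  unit vectors is the relative volume of the cone over \<open>A\<close> inside the unit ball.
\<close>

definition sphere_measure :: "(real^'n) measure" where
  "sphere_measure =
     restrict_space (distr (uniform_measure lborel (ball 0 1)) borel sgn) (sphere 0 1)"

text \<open>
  For a unit vector \<open>u\<close>, \<open>great_subsphere u\<close> is the intersection of the sphere with the hyperplane
  orthogonal to \<open>u\<close>.  Its normalized surface measure is again the cone measure, now taken
  in that hyperplane.  Lebesgue measure of the hyperplane is obtained from \<open>lborel\<close>
  as base times height: the cylinder below is the product of the unit ball
  of the hyperplane and the segment \<open>{t *\<^sub>R u |t. \<bar>t\<bar> \<le> 1}\<close>.  The lemmas on \<open>subsphere_measure\<close>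
  below show that it is a probability measure on the great subsphere
  and that it is invariant under all orthogonal transformations fixing \<open>u\<close>, which determines it.
\<close>

definition great_subsphere :: "real^'n \<Rightarrow> (real^'n) set" where
  "great_subsphere u = {x \<in> sphere 0 1. u \<bullet> x = 0}"

definition hyperplane_proj :: "real^'n \<Rightarrow> real^'n \<Rightarrow> real^'n" where
  "hyperplane_proj u x = x - (u \<bullet> x) *\<^sub>R u"

definition unit_cylinder :: "real^'n \<Rightarrow> (real^'n) set" where
  "unit_cylinder u = {x. \<bar>u \<bullet> x\<bar> \<le> 1 \<and> norm (hyperplane_proj u x) \<le> 1}"

definition subsphere_measure :: "real^'n \<Rightarrow> (real^'n) measure" where
  "subsphere_measure u =
     restrict_space
       (distr (uniform_measure lborel (unit_cylinder u)) borel (\<lambda>x. sgn (hyperplane_proj u x)))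
       (great_subsphere u)"

lemma space_sphere_measure [simp]: "space sphere_measure = sphere 0 1"
  by (simp add: sphere_measure_def space_restrict_space)

lemma sets_sphere_measure:
  "sets sphere_measure = sets (restrict_space borel (sphere 0 1))"
  by (simp add: sphere_measure_def sets_restrict_space)

lemma borel_hyperplane_proj [measurable]: "hyperplane_proj u \<in> borel_measurable borel"
  unfolding hyperplane_proj_def by measurable

lemma borel_sgn [measurable]: "(sgn :: real^'n \<Rightarrow> real^'n) \<in> borel_measurable borel"
  unfolding sgn_div_norm[abs_def] by measurable

lemma closed_great_subsphere: "closed (great_subsphere u)"
  unfolding great_subsphere_def
  by (auto simp: Collect_conj_eq intro!: closed_Int closed_Collect_eq continuous_intros)

lemma sets_great_subsphere [measurable]: "great_subsphere u \<in> sets borel"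
  by (intro borel_closed closed_great_subsphere)

lemma sets_unit_cylinder [measurable]: "unit_cylinder u \<in> sets borel"
  unfolding unit_cylinder_def by measurable

lemma borel_sgn_hyperplane_proj [measurable]:
  "(\<lambda>x. sgn (hyperplane_proj u x)) \<in> borel_measurable borel"
  by (rule measurable_compose[OF borel_hyperplane_proj borel_sgn])

lemma prob_space_sphere_measure: "prob_space (sphere_measure :: (real^'n) measure)"
proof -
  let ?U = "uniform_measure lborel (ball 0 1) :: (real^'n) measure"
  have fin: "emeasure lborel (ball (0::real^'n) 1) \<noteq> \<infinity>" "emeasure lborel (ball (0::real^'n) 1) \<noteq> 0"
    using emeasure_bounded_finite[of "ball (0::real^'n) 1"] content_ball_pos[of 1 "0::real^'n"]
    by (auto simp: measure_def)
  interpret U: prob_space ?U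
    by (rule prob_space_uniform_measure) (use fin in auto)
  have "AE x in lborel. x \<noteq> (0::real^'n)"
    by (rule AE_lborel_singleton)
  then have "AE x in lborel. x \<in> ball (0::real^'n) 1 \<longrightarrow> sgn x \<in> sphere (0::real^'n) 1"
    by eventually_elim (auto simp: norm_sgn)
  then have "AE x in ?U. sgn x \<in> sphere (0::real^'n) 1"
    by (intro AE_uniform_measureI) auto
  then have "emeasure (distr ?U borel sgn) (sphere (0::real^'n) 1) = 1"
    by (subst emeasure_distr) (auto intro!: U.emeasure_eq_1_AE simp: vimage_def
        simp del: emeasure_uniform_measure)
  then show ?thesis
    unfolding sphere_measure_def
    by (intro prob_space_restrict_space) auto
qed

lemma prob_space_subsphere_measure:
  fixes u :: "real^'n"
  assumes n: "2 \<le> CARD('n)" and u: "norm u = 1"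
  shows "prob_space (subsphere_measure u)"
proof -
  let ?U = "uniform_measure lborel (unit_cylinder u) :: (real^'n) measure"
  have uu: "u \<bullet> u = 1" using u by (simp add: norm_eq_1)
  have np: "norm (hyperplane_proj u x) \<le> norm x" for x
  proof -
    have "hyperplane_proj u x \<bullet> hyperplane_proj u x = x \<bullet> x - (u \<bullet> x) * (u \<bullet> x)"
      unfolding hyperplane_proj_def inner_diff_left inner_diff_right inner_scaleR_left
        inner_scaleR_right uu inner_commute[of x u] by simp
    then show ?thesis by (simp add: norm_le)
  qed
  have "ball 0 1 \<subseteq> unit_cylinder u"
  proof
    fix x :: "real^'n" assume "x \<in> ball 0 1"
    then have x: "norm x \<le> 1" by simp
    moreover have "\<bar>u \<bullet> x\<bar> \<le> norm x"
      using Cauchy_Schwarz_ineq2[of u x] u by simp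
    ultimately show "x \<in> unit_cylinder u"
      using np[of x] by (simp add: unit_cylinder_def)
  qed
  then have "emeasure lborel (ball (0::real^'n) 1) \<le> emeasure lborel (unit_cylinder u)"
    by (intro emeasure_mono) auto
  moreover have "emeasure lborel (ball (0::real^'n) 1) \<noteq> 0"
    using content_ball_pos[of 1 "0::real^'n"] by (auto simp: measure_def)
  ultimately have pos: "emeasure lborel (unit_cylinder u) \<noteq> 0" by auto
  have "unit_cylinder u \<subseteq> cball 0 2"
  proof
    fix x assume x: "x \<in> unit_cylinder u"
    have "x = hyperplane_proj u x + (u \<bullet> x) *\<^sub>R u" by (simp add: hyperplane_proj_def)
    then have "norm x \<le> norm (hyperplane_proj u x) + norm ((u \<bullet> x) *\<^sub>R u)"
      by (metis norm_triangle_ineq)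
    then show "x \<in> cball 0 2" using x u by (simp add: unit_cylinder_def)
  qed
  then have "bounded (unit_cylinder u)"
    using bounded_cball bounded_subset by blast
  then have fin: "emeasure lborel (unit_cylinder u) \<noteq> \<infinity>"
    using emeasure_bounded_finite by fastforce
  interpret U: prob_space ?U
    by (rule prob_space_uniform_measure) (use pos fin in auto)
  have "negligible (span {u})"
    by (rule negligible_lowdim)
      (use n dim_le_card[of "span {u}" "{u}"] in \<open>auto simp: dim_span\<close>)
  then have "span {u} \<in> null_sets lborel"
    by (auto simp: negligible_iff_null_sets null_sets_completion_iff closed_span
        intro!: borel_closed)
  then have "AE x in lborel. x \<notin> span {u}"
    by (rule AE_not_in)
  moreover have "sgn (hyperplane_proj u x) \<in> great_subsphere u" if "x \<notin> span {u}" for x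
  proof -
    have "hyperplane_proj u x \<noteq> 0"
      using that by (auto simp: hyperplane_proj_def span_singleton)
    moreover have "u \<bullet> hyperplane_proj u x = 0"
      by (simp add: hyperplane_proj_def inner_diff_right uu)
    ultimately show ?thesis
      by (simp add: great_subsphere_def norm_sgn) (simp add: sgn_div_norm)
  qed
  ultimately have "AE x in lborel. x \<in> unit_cylinder u \<longrightarrow>
      sgn (hyperplane_proj u x) \<in> great_subsphere u"
    by (auto elim: eventually_mono)
  then have "AE x in ?U. sgn (hyperplane_proj u x) \<in> great_subsphere u"
    by (intro AE_uniform_measureI) auto
  then have "emeasure (distr ?U borel (\<lambda>x. sgn (hyperplane_proj u x))) (great_subsphere u) = 1"
    by (subst emeasure_distr) (auto intro!: U.emeasure_eq_1_AE simp: vimage_def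
        simp del: emeasure_uniform_measure)
  then show ?thesis
    unfolding subsphere_measure_def
    by (intro prob_space_restrict_space) auto
qed

lemma orthogonal_transformation_borel:
  fixes T :: "real^'n \<Rightarrow> real^'n"
  assumes "orthogonal_transformation T"
  shows "T \<in> borel_measurable borel"
  using assms by (intro borel_measurable_continuous_onI linear_continuous_on)
    (simp add: linear_linear orthogonal_transformation_linear)

lemma distr_lborel_orthogonal:
  fixes T :: "real^'n \<Rightarrow> real^'n"
  assumes T: "orthogonal_transformation T"
  shows "distr lborel borel T = lborel"
proof (rule measure_eqI)
  note Tb [measurable] = orthogonal_transformation_borel[OF T]
  let ?L = "lborel :: (real^'n) measure"
  define B where "B = ball (0::real^'n) 1"
  have [measurable]: "B \<in> sets borel" by (simp add: B_def)
  let ?i = "\<lambda>A x. indicator A x :: ennreal"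
  have shift: "(\<integral>\<^sup>+x. f (c + x) \<partial>?L) = (\<integral>\<^sup>+x. f x \<partial>?L)" if [measurable]: "f \<in> borel_measurable borel" for f c
    by (subst (2) lborel_distr_plus[symmetric, of c]) (simp add: nn_integral_distr)
  have reflect: "(\<integral>\<^sup>+x. f (c - x) \<partial>?L) = (\<integral>\<^sup>+x. f x \<partial>?L)" if [measurable]: "f \<in> borel_measurable borel" for f c
    by (subst (2) lborel_affine[of "-1" c]) (simp_all add: nn_integral_distr nn_integral_density)
  fix A :: "(real^'n) set" assume "A \<in> sets (distr lborel borel T)"
  then have [measurable]: "A \<in> sets borel" by simp
  have M: "emeasure (distr lborel borel T) C = (\<integral>\<^sup>+x. ?i C (T x) \<partial>?L)" if [measurable]: "C \<in> sets borel" for C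
    by (subst nn_integral_distr[symmetric, of T _ borel]) auto
  have "emeasure (distr lborel borel T) A * emeasure ?L B = (\<integral>\<^sup>+x. ?i A (T x) * (\<integral>\<^sup>+y. ?i B (T x + y) \<partial>?L) \<partial>?L)"
    using shift[of "?i B", OF borel_measurable_indicator] by (simp add: M nn_integral_multc)
  also have "\<dots> = (\<integral>\<^sup>+x. (\<integral>\<^sup>+y. ?i A (T x) * ?i B (T x + y) \<partial>?L) \<partial>?L)"
    by (intro nn_integral_cong nn_integral_cmult[symmetric]) measurable
  also have "\<dots> = (\<integral>\<^sup>+y. (\<integral>\<^sup>+x. ?i A (T x) * ?i B (T x + y) \<partial>?L) \<partial>?L)"
    by (rule lborel_pair.Fubini'[symmetric]) measurable
  also have "\<dots> = (\<integral>\<^sup>+y. (\<integral>\<^sup>+x. ?i A (T x - y) * ?i B (T x) \<partial>?L) \<partial>?L)"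
  proof (rule nn_integral_cong)
    fix y
    have "T (- inv T y + x) = T x - y" for x
      using T by (simp add: linear_diff orthogonal_transformation_linear
          orthogonal_transformation_surj surj_f_inv_f)
    then show "(\<integral>\<^sup>+x. ?i A (T x) * ?i B (T x + y) \<partial>?L) = (\<integral>\<^sup>+x. ?i A (T x - y) * ?i B (T x) \<partial>?L)"
      by (subst shift[symmetric, of _ "- inv T y"]) simp_all
  qed
  also have "\<dots> = (\<integral>\<^sup>+x. (\<integral>\<^sup>+y. ?i A (T x - y) * ?i B (T x) \<partial>?L) \<partial>?L)"
    by (rule lborel_pair.Fubini') measurable
  also have "\<dots> = (\<integral>\<^sup>+x. emeasure ?L A * ?i B (T x) \<partial>?L)"
    using reflect[of "?i A", OF borel_measurable_indicator] by (simp add: nn_integral_multc)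
  also have "\<dots> = emeasure ?L A * emeasure ?L B"
    using T by (simp add: nn_integral_cmult indicator_def B_def orthogonal_transformation_norm
        flip: nn_integral_indicator)
  finally have "emeasure (distr lborel borel T) A * emeasure ?L B = emeasure ?L A * emeasure ?L B" .
  moreover have "emeasure ?L B \<noteq> 0"
    using content_ball_pos[of 1 "0::real^'n"] by (auto simp: B_def measure_def)
  moreover have "emeasure ?L B \<noteq> \<infinity>"
    using emeasure_bounded_finite[of B] by (auto simp: B_def)
  ultimately show "emeasure (distr lborel borel T) A = emeasure ?L A"
    by (metis mult_divide_eq_ennreal infinity_ennreal_def)
qed simp

lemma uniform_measure_orthogonal:
  fixes T :: "real^'n \<Rightarrow> real^'n"
  assumes T: "orthogonal_transformation T" and [measurable]: "A \<in> sets borel" "B \<in> sets borel"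
  shows "emeasure (uniform_measure lborel (T -` A)) (T -` B) = emeasure (uniform_measure lborel A) B"
proof -
  note [measurable] = orthogonal_transformation_borel[OF T]
  have vimage: "T -` S \<in> sets borel" if "S \<in> sets borel" for S
    using measurable_sets[OF orthogonal_transformation_borel[OF T] that] by simp
  have eq: "emeasure lborel (T -` S) = emeasure lborel S" if "S \<in> sets borel" for S
    using emeasure_distr[of T lborel borel S] distr_lborel_orthogonal[OF T] that by simp
  show ?thesis
    using eq[of A] eq[of "A \<inter> B"] vimage by (simp add: vimage_Int)
qed

lemma sgn_orthogonal_transformation:
  fixes T :: "real^'n \<Rightarrow> real^'n"
  assumes "orthogonal_transformation T"
  shows "sgn (T x) = T (sgn x)"
  using assms by (simp add: sgn_div_norm orthogonal_transformation_norm linear_scale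
      orthogonal_transformation_linear)

lemma distr_sphere_measure_orthogonal:
  fixes T :: "real^'n \<Rightarrow> real^'n"
  assumes T: "orthogonal_transformation T"
  shows "distr sphere_measure sphere_measure T = sphere_measure"
proof (rule measure_eqI)
  note Tb [measurable] = orthogonal_transformation_borel[OF T]
  have sph: "T x \<in> sphere 0 1 \<longleftrightarrow> x \<in> sphere 0 1" for x
    using T by (simp add: orthogonal_transformation_norm)
  have meas: "T \<in> measurable sphere_measure sphere_measure"
    unfolding sphere_measure_def
    by (intro measurable_restrict_space3) (use sph in auto)
  fix A assume "A \<in> sets (distr sphere_measure sphere_measure T)"
  then have A: "A \<in> sets borel" "A \<subseteq> sphere 0 1" and A': "A \<in> sets sphere_measure"
    by (auto simp: sets_sphere_measure sets_restrict_space)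
  have TA: "T -` A \<in> sets borel" "T -` A \<subseteq> sphere 0 1"
    using measurable_sets[OF Tb A(1)] A(2) sph by auto
  have sgnb: "sgn -` B \<in> sets borel" if "B \<in> sets borel" for B :: "(real^'n) set"
    using measurable_sets[OF borel_sgn that] by simp
  have "emeasure (distr sphere_measure sphere_measure T) A = emeasure sphere_measure (T -` A)"
    using TA(2) by (simp add: emeasure_distr[OF meas A'] Int_absorb2)
  also have "\<dots> = emeasure (uniform_measure lborel (ball 0 1)) (sgn -` T -` A)"
    unfolding sphere_measure_def using TA by (simp add: emeasure_restrict_space emeasure_distr)
  also have "sgn -` T -` A = T -` sgn -` A"
    by (auto simp: sgn_orthogonal_transformation[OF T])
  also have "ball 0 1 = T -` ball 0 1"
    using T by (auto simp: orthogonal_transformation_norm)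
  also have "emeasure (uniform_measure lborel (T -` ball 0 1)) (T -` sgn -` A) =
      emeasure (uniform_measure lborel (ball 0 1)) (sgn -` A)"
    using sgnb A by (intro uniform_measure_orthogonal T) auto
  also have "\<dots> = emeasure sphere_measure A"
    unfolding sphere_measure_def using A by (simp add: emeasure_restrict_space emeasure_distr)
  finally show "emeasure (distr sphere_measure sphere_measure T) A = emeasure sphere_measure A" .
qed simp

text \<open>For \<open>T u = u\<close> this is invariance under the stabilizer of \<open>u\<close>.\<close>

lemma distr_subsphere_measure_orthogonal:
  fixes T :: "real^'n \<Rightarrow> real^'n"
  assumes T: "orthogonal_transformation T"
  shows "distr (subsphere_measure u) (subsphere_measure (T u)) T = subsphere_measure (T u)"
proof (rule measure_eqI)
  note Tb [measurable] = orthogonal_transformation_borel[OF T]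
  have inn: "T u \<bullet> T x = u \<bullet> x" for x
    using T by (simp add: orthogonal_transformation_def)
  have sph: "T x \<in> great_subsphere (T u) \<longleftrightarrow> x \<in> great_subsphere u" for x
    using T by (simp add: great_subsphere_def inn orthogonal_transformation_norm)
  have proj: "hyperplane_proj (T u) (T x) = T (hyperplane_proj u x)" for x
    using orthogonal_transformation_linear[OF T]
    by (simp add: hyperplane_proj_def inn linear_diff linear_scale)
  have cyl: "unit_cylinder u = T -` unit_cylinder (T u)"
    using T by (auto simp: unit_cylinder_def inn proj orthogonal_transformation_norm)
  have meas: "T \<in> measurable (subsphere_measure u) (subsphere_measure (T u))"
    unfolding subsphere_measure_def
    by (intro measurable_restrict_space3) (use sph in auto)
  fix A assume A': "A \<in> sets (distr (subsphere_measure u) (subsphere_measure (T u)) T)"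
  then have A: "A \<in> sets borel" "A \<subseteq> great_subsphere (T u)"
    by (auto simp: subsphere_measure_def sets_restrict_space)
  let ?f = "\<lambda>u x. sgn (hyperplane_proj u x)"
  have TA: "T -` A \<in> sets borel" "T -` A \<subseteq> great_subsphere u"
    using measurable_sets[OF Tb A(1)] A(2) sph by auto
  have fb: "?f (T u) -` A \<in> sets borel"
    using measurable_sets[OF borel_sgn_hyperplane_proj A(1)] by simp
  have distr: "emeasure (subsphere_measure v) B =
      emeasure (uniform_measure lborel (unit_cylinder v)) (?f v -` B)"
    if "B \<in> sets borel" "B \<subseteq> great_subsphere v" for v and B :: "(real^'n) set"
    unfolding subsphere_measure_def using that
    by (simp add: emeasure_restrict_space emeasure_distr borel_sgn_hyperplane_proj
        del: emeasure_uniform_measure)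
  have "emeasure (distr (subsphere_measure u) (subsphere_measure (T u)) T) A =
      emeasure (subsphere_measure u) (T -` A)"
    using TA(2) A' by (subst emeasure_distr[OF meas])
      (auto simp: Int_absorb2 subsphere_measure_def space_restrict_space)
  also have "\<dots> = emeasure (uniform_measure lborel (unit_cylinder u)) (?f u -` T -` A)"
    using TA by (rule distr)
  also have "?f u -` T -` A = T -` ?f (T u) -` A"
    by (auto simp: sgn_orthogonal_transformation[OF T] proj)
  also have "emeasure (uniform_measure lborel (unit_cylinder u)) (T -` ?f (T u) -` A) =
      emeasure (uniform_measure lborel (unit_cylinder (T u))) (?f (T u) -` A)"
    unfolding cyl using fb by (intro uniform_measure_orthogonal T) auto
  also have "\<dots> = emeasure (subsphere_measure (T u)) A"
    using A by (rule distr[symmetric])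
  finally show "emeasure (distr (subsphere_measure u) (subsphere_measure (T u)) T) A =
      emeasure (subsphere_measure (T u)) A" .
qed simp

section \<open>The Hilbert space of square-integrable functions on the sphere\<close>

definition square_integrable :: "(real^'n \<Rightarrow> real) \<Rightarrow> bool" where
  "square_integrable f \<longleftrightarrow>
     f \<in> borel_measurable sphere_measure \<and> integrable sphere_measure (\<lambda>x. (f x)\<^sup>2)"

definition L2_eq :: "(real^'n \<Rightarrow> real) \<Rightarrow> (real^'n \<Rightarrow> real) \<Rightarrow> bool" where
  "L2_eq f g \<longleftrightarrow>
     square_integrable f \<and> square_integrable g \<and> (AE x in sphere_measure. f x = g x)"

lemma square_integrable_zero: "square_integrable (\<lambda>x. 0)"
  by (simp add: square_integrable_def)

lemma square_integrable_scale: "square_integrable f \<Longrightarrow> square_integrable (\<lambda>x. c * f x)"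
  by (auto simp: square_integrable_def power_mult_distrib)

lemma square_integrable_mult:
  assumes "square_integrable f" "square_integrable g"
  shows "integrable sphere_measure (\<lambda>x. f x * g x)"
proof (rule Bochner_Integration.integrable_bound)
  show "integrable sphere_measure (\<lambda>x. (f x)\<^sup>2 + (g x)\<^sup>2)"
    using assms by (auto simp: square_integrable_def)
  show "(\<lambda>x. f x * g x) \<in> borel_measurable sphere_measure"
    using assms by (auto simp: square_integrable_def)
  have "\<bar>a * b\<bar> \<le> a\<^sup>2 + b\<^sup>2" for a b :: real
  proof -
    have "2 * \<bar>a * b\<bar> \<le> a\<^sup>2 + b\<^sup>2"
      using sum_squares_bound[of "\<bar>a\<bar>" "\<bar>b\<bar>"] by (simp add: abs_mult)
    then show ?thesis by linarith
  qed
  then show "AE x in sphere_measure. norm (f x * g x) \<le> norm ((f x)\<^sup>2 + (g x)\<^sup>2)"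
    by auto
qed

lemma square_integrable_add:
  assumes "square_integrable f" "square_integrable g"
  shows "square_integrable (\<lambda>x. f x + g x)"
proof -
  have "integrable sphere_measure (\<lambda>x. (f x)\<^sup>2 + (g x)\<^sup>2 + 2 * (f x * g x))"
    using assms square_integrable_mult[OF assms] by (auto simp: square_integrable_def)
  then show ?thesis
    using assms by (auto simp: square_integrable_def power2_sum algebra_simps)
qed

quotient_type (overloaded) 'n L2_sphere = "real^'n \<Rightarrow> real" / partial: L2_eq
proof (rule part_equivpI)
  show "\<exists>f :: real^'n \<Rightarrow> real. L2_eq f f"
    using square_integrable_zero by (auto simp: L2_eq_def)
  show "symp L2_eq"
  proof (rule sympI)
    fix f g
    assume fg: "L2_eq f g"
    then have "AE x in sphere_measure. f x = g x" by (simp add: L2_eq_def)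
    then have "AE x in sphere_measure. g x = f x" by eventually_elim simp
    with fg show "L2_eq g f" by (simp add: L2_eq_def)
  qed
  show "transp L2_eq" by (auto intro!: transpI simp: L2_eq_def)
qed

instantiation L2_sphere :: (finite) real_vector
begin

lift_definition zero_L2_sphere :: "'a L2_sphere" is "\<lambda>x. 0"
  by (simp add: L2_eq_def square_integrable_zero)

lift_definition plus_L2_sphere :: "'a L2_sphere \<Rightarrow> 'a L2_sphere \<Rightarrow> 'a L2_sphere"
  is "\<lambda>f g x. f x + g x"
  by (auto simp: L2_eq_def square_integrable_add)

lift_definition scaleR_L2_sphere :: "real \<Rightarrow> 'a L2_sphere \<Rightarrow> 'a L2_sphere"
  is "\<lambda>c f x. c * f x"
  by (auto simp: L2_eq_def square_integrable_scale)

lift_definition uminus_L2_sphere :: "'a L2_sphere \<Rightarrow> 'a L2_sphere"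
  is "\<lambda>f x. - f x"
  by (auto simp: L2_eq_def square_integrable_def)

definition minus_L2_sphere :: "'a L2_sphere \<Rightarrow> 'a L2_sphere \<Rightarrow> 'a L2_sphere"
  where "minus_L2_sphere \<phi> \<psi> = \<phi> + - \<psi>"

instance
proof
  fix \<phi> \<psi> \<eta> :: "'a L2_sphere" and a b :: real
  show "\<phi> + \<psi> + \<eta> = \<phi> + (\<psi> + \<eta>)"
    by transfer (auto simp: L2_eq_def square_integrable_add add.assoc)
  show "\<phi> + \<psi> = \<psi> + \<phi>"
    by transfer (auto simp: L2_eq_def square_integrable_add add.commute)
  show "0 + \<phi> = \<phi>"
    by transfer (auto simp: L2_eq_def)
  show "- \<phi> + \<phi> = 0"
    by transfer (auto simp: L2_eq_def square_integrable_zero)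
  show "\<phi> - \<psi> = \<phi> + - \<psi>"
    by (simp add: minus_L2_sphere_def)
  show "a *\<^sub>R (\<phi> + \<psi>) = a *\<^sub>R \<phi> + a *\<^sub>R \<psi>"
    by transfer
      (auto simp: L2_eq_def square_integrable_add square_integrable_scale distrib_left)
  show "(a + b) *\<^sub>R \<phi> = a *\<^sub>R \<phi> + b *\<^sub>R \<phi>"
    by transfer
      (auto simp: L2_eq_def square_integrable_add square_integrable_scale distrib_right)
  show "a *\<^sub>R b *\<^sub>R \<phi> = (a * b) *\<^sub>R \<phi>"
    by transfer
      (auto simp: L2_eq_def mult.assoc square_integrable_scale)
  show "1 *\<^sub>R \<phi> = \<phi>"
    by transfer (auto simp: L2_eq_def)
qed

end

instantiation L2_sphere :: (finite) real_inner
begin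

lift_definition inner_L2_sphere :: "'a L2_sphere \<Rightarrow> 'a L2_sphere \<Rightarrow> real"
  is "\<lambda>f g. LINT x|sphere_measure. f x * g x"
  by (rule integral_cong_AE) (auto simp: L2_eq_def square_integrable_def)

definition norm_L2_sphere :: "'a L2_sphere \<Rightarrow> real"
  where "norm_L2_sphere \<psi> = sqrt (inner \<psi> \<psi>)"

definition sgn_L2_sphere :: "'a L2_sphere \<Rightarrow> 'a L2_sphere"
  where "sgn_L2_sphere \<psi> = \<psi> /\<^sub>R norm \<psi>"

definition dist_L2_sphere :: "'a L2_sphere \<Rightarrow> 'a L2_sphere \<Rightarrow> real"
  where "dist_L2_sphere \<phi> \<psi> = norm (\<phi> - \<psi>)"

definition uniformity_L2_sphere :: "('a L2_sphere \<times> 'a L2_sphere) filter"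
  where "uniformity_L2_sphere = (INF e\<in>{0 <..}. principal {(\<phi>, \<psi>). dist \<phi> \<psi> < e})"

definition open_L2_sphere :: "'a L2_sphere set \<Rightarrow> bool"
  where "open_L2_sphere U \<longleftrightarrow>
    (\<forall>\<phi>\<in>U. eventually (\<lambda>(\<phi>', \<psi>). \<phi>' = \<phi> \<longrightarrow> \<psi> \<in> U) uniformity)"

instance
proof
  fix \<phi> \<psi> \<eta> :: "'a L2_sphere" and a :: real
  show "inner \<phi> \<psi> = inner \<psi> \<phi>"
    by transfer (simp add: mult.commute)
  show "inner (\<phi> + \<psi>) \<eta> = inner \<phi> \<eta> + inner \<psi> \<eta>"
    by transfer (auto simp: L2_eq_def distrib_right square_integrable_mult
        intro!: Bochner_Integration.integral_add)
  show "inner (a *\<^sub>R \<phi>) \<psi> = a * inner \<phi> \<psi>"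
    by transfer (simp add: mult.assoc)
  show "0 \<le> inner \<phi> \<phi>"
    by transfer simp
  show "inner \<phi> \<phi> = 0 \<longleftrightarrow> \<phi> = 0"
  proof transfer
    fix f :: "real^'a \<Rightarrow> real" assume "L2_eq f f"
    then have f: "square_integrable f" by (simp add: L2_eq_def)
    have "(LINT x|sphere_measure. f x * f x) = 0 \<longleftrightarrow>
        (AE x in sphere_measure. f x * f x = 0)"
      using square_integrable_mult[OF f f] by (intro integral_nonneg_eq_0_iff_AE) auto
    then show "(LINT x|sphere_measure. f x * f x) = 0 \<longleftrightarrow> L2_eq f (\<lambda>x. 0)"
      using f by (simp add: L2_eq_def square_integrable_zero)
  qed
  show "norm \<phi> = sqrt (inner \<phi> \<phi>)"
    by (simp add: norm_L2_sphere_def)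
qed (simp_all add: sgn_L2_sphere_def dist_L2_sphere_def uniformity_L2_sphere_def
      open_L2_sphere_def)

end

section \<open>Spherical harmonics, the Funk transform and the projection\<close>

definition laplacian :: "(real^'n \<Rightarrow> real) \<Rightarrow> real^'n \<Rightarrow> real" where
  "laplacian p x = (\<Sum>b\<in>Basis. (deriv ^^ 2) (\<lambda>t. p (x + t *\<^sub>R b)) 0)"

definition harmonic_polynomial :: "nat \<Rightarrow> (real^'n \<Rightarrow> real) \<Rightarrow> bool" where
  "harmonic_polynomial d p \<longleftrightarrow>
     real_polynomial_function p \<and> (\<forall>t x. p (t *\<^sub>R x) = t ^ d * p x) \<and> (\<forall>x. laplacian p x = 0)"

text \<open>
  \<open>abs_L2_sphere f\<close> is the class of \<open>f\<close>; it only depends on the values of \<open>f\<close> on the sphere.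
\<close>

definition spherical_harmonics :: "nat \<Rightarrow> 'n::finite L2_sphere set" where
  "spherical_harmonics d = {abs_L2_sphere p |p. harmonic_polynomial d p}"

definition subsphere_average :: "(real^'n \<Rightarrow> real) \<Rightarrow> real^'n \<Rightarrow> real" where
  "subsphere_average f u = (LINT x|subsphere_measure u. f x)"

text \<open>
  The unique bounded operator extending the averaging map on continuous functions, which are dense.
  (Self-adjointness is a consequence and is not part of the definition.)
\<close>

definition funk :: "'n::finite L2_sphere \<Rightarrow> 'n L2_sphere" where
  "funk = (THE R. bounded_linear R \<and>
     (\<forall>f. continuous_on (sphere 0 1) f \<longrightarrow>
        R (abs_L2_sphere f) = abs_L2_sphere (subsphere_average f)))"

text \<open>
  \<open>(n - 1) R\<close>, the linearization at \<open>\<rho> = 1\<close> of the intersection body shape map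
  \<open>\<rho> \<mapsto> R (\<rho> ^ (n - 1))\<close>.
\<close>

definition lin_op :: "'n::finite L2_sphere \<Rightarrow> 'n L2_sphere" where
  "lin_op \<psi> = (real CARD('n) - 1) *\<^sub>R funk \<psi>"

text \<open>Meant for complete subspaces \<open>W\<close>, where the orthogonal projection exists and is unique.\<close>

definition orthogonal_projection :: "'a::real_inner set \<Rightarrow> 'a \<Rightarrow> 'a" where
  "orthogonal_projection W x = (THE y. y \<in> W \<and> (\<forall>w\<in>W. orthogonal (x - y) w))"

definition proj_ge4 :: "'n::finite L2_sphere \<Rightarrow> 'n L2_sphere" where
  "proj_ge4 = orthogonal_projection (closure (span (\<Union>d\<in>{4..}. spherical_harmonics d)))"

definition gap_const :: "real \<Rightarrow> real" where
  "gap_const n = (n + 1)\<^sup>2 / ((n - 2) * (n + 4))"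

end

theory Submission
  imports Defs "HOL-Real_Asymp.Real_Asymp"
begin

text \<open>
  The operators \<open>funk\<close>, \<open>lin_op\<close> and \<open>proj_ge4\<close> are simultaneously diagonal: each space
  \<open>spherical_harmonics d\<close> is an eigenspace of all three, these spaces are mutually orthogonal,
  and their span is dense in \<open>L\<^sup>2\<close>.  The estimate is therefore a statement about one sequence of
  numbers.  With \<open>n\<close> the dimension, the eigenvalue of \<open>lin_op\<close> in degree \<open>d\<close> is
  \<open>\<mu> d = (n - 1) * funk_multiplier n d\<close>.  It vanishes in odd degrees, \<open>\<mu> 4 = 3 / (n + 1)\<close>, and
  \<open>\<bar>\<mu> (d + 2)\<bar> \<le> \<bar>\<mu> d\<bar>\<close>; hence \<open>1 - (\<mu> d)\<^sup>2 \<ge> 1 - 9 / (n + 1)\<^sup>2 = 1 / gap_const n\<close> whenever \<open>d \<ge> 4\<close>.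
  So \<open>proj_ge4\<close> is the composition of \<open>lin_op \<circ> lin_op - id\<close> with the operator that multiplies degree
  \<open>d \<ge> 4\<close> by \<open>1 / ((\<mu> d)\<^sup>2 - 1)\<close> and kills the degrees below 4, and that operator has norm at most
  \<open>gap_const n\<close>.  Any nonzero harmonic of degree 4 attains equality, which gives sharpness.

  Orthogonality and the eigenvalues both come from one integral identity, \<open>integral_green\<close>.
  It needs only that the measure is invariant under rotations: the derivative of a polynomial along
  a plane rotation then integrates to zero, and summing this over all coordinate planes expresses the
  integral of \<open>p \<Delta> q + \<nabla> p \<cdot> \<nabla> q\<close> by that of \<open>p q\<close> when \<open>p\<close> and \<open>q\<close> are homogeneous.  On the whole sphere
  the left-hand side for harmonic \<open>p\<close> and \<open>q\<close> is symmetric while the factor on the right is not, so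
  different degrees are orthogonal (\<open>harmonic_polynomials_orthogonal\<close>).  On the great subsphere
  orthogonal to \<open>u\<close> the Laplacian of the hyperplane applied to a harmonic \<open>q\<close> is minus the second
  derivative of \<open>q\<close> in direction \<open>u\<close>, again a harmonic polynomial, of degree two less; this gives the
  recursion for the averages (\<open>subsphere_average_harmonic\<close>).

  Density combines three steps: on the sphere every polynomial is a sum of harmonic ones
  (\<open>polynomial_on_sphere_induct\<close>), polynomials approximate continuous functions uniformly, and
  continuous functions are dense in \<open>L\<^sup>2\<close> (\<open>in_closed_subspace_if_contains_continuous\<close>).
  Completeness of \<open>L\<^sup>2\<close> turns every bounded sequence of
  multipliers into a bounded operator (\<open>multiplier_exists\<close>).  This produces both the projection and
  the Funk transform; for the latter, boundedness of the averaging map on continuous functions is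
  read off from \<open>\<bar>funk_multiplier n d\<bar> \<le> 1\<close>.
\<close>

section \<open>Directional derivatives of polynomials\<close>

definition dir_deriv :: "'a::real_normed_vector \<Rightarrow> ('a \<Rightarrow> real) \<Rightarrow> 'a \<Rightarrow> real" where
  "dir_deriv v p x = frechet_derivative p (at x) v"

lemma real_polynomial_function_differentiable:
  assumes "real_polynomial_function p"
  shows "p differentiable (at x)"
  using assms by induction (auto intro: bounded_linear_imp_differentiable)

lemma continuous_on_real_polynomial_function:
  "real_polynomial_function p \<Longrightarrow> continuous_on S p"
  by (simp add: continuous_on_polymonial_function real_polynomial_function_eq)

lemma has_derivative_dir_deriv:
  assumes "real_polynomial_function p"
  shows "(p has_derivative (\<lambda>v. dir_deriv v p x)) (at x)"
  unfolding dir_deriv_def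
  using real_polynomial_function_differentiable[OF assms]
  by (simp add: frechet_derivative_works eta_contract_eq)

lemma bounded_linear_dir_deriv:
  assumes "real_polynomial_function p"
  shows "bounded_linear (\<lambda>v. dir_deriv v p x)"
  using has_derivative_dir_deriv[OF assms] by (rule has_derivative_bounded_linear)

lemma linear_dir_deriv:
  assumes "real_polynomial_function p"
  shows "linear (\<lambda>v. dir_deriv v p x)"
  using bounded_linear_dir_deriv[OF assms] by (rule bounded_linear.linear)

lemma dir_deriv_eqI:
  assumes "(p has_derivative D) (at x)"
  shows "dir_deriv v p x = D v"
  unfolding dir_deriv_def using frechet_derivative_at[OF assms] by simp

lemma dir_deriv_const [simp]: "dir_deriv v (\<lambda>x. c) = (\<lambda>x. 0)"
  by (intro ext dir_deriv_eqI[OF has_derivative_const])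

lemma dir_deriv_linear: "bounded_linear f \<Longrightarrow> dir_deriv v f = (\<lambda>x. f v)"
  by (intro ext dir_deriv_eqI bounded_linear_imp_has_derivative)

lemma dir_deriv_add:
  assumes "real_polynomial_function p" "real_polynomial_function q"
  shows "dir_deriv v (\<lambda>x. p x + q x) = (\<lambda>x. dir_deriv v p x + dir_deriv v q x)"
  by (intro ext dir_deriv_eqI has_derivative_add has_derivative_dir_deriv assms)

lemma dir_deriv_diff:
  assumes "real_polynomial_function p" "real_polynomial_function q"
  shows "dir_deriv v (\<lambda>x. p x - q x) = (\<lambda>x. dir_deriv v p x - dir_deriv v q x)"
  by (intro ext dir_deriv_eqI has_derivative_diff has_derivative_dir_deriv assms)

lemma dir_deriv_mult:
  assumes "real_polynomial_function p" "real_polynomial_function q"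
  shows "dir_deriv v (\<lambda>x. p x * q x) = (\<lambda>x. p x * dir_deriv v q x + dir_deriv v p x * q x)"
  by (intro ext dir_deriv_eqI has_derivative_mult has_derivative_dir_deriv assms)

lemma dir_deriv_cmult:
  assumes "real_polynomial_function p"
  shows "dir_deriv v (\<lambda>x. c * p x) = (\<lambda>x. c * dir_deriv v p x)"
  using dir_deriv_mult[OF real_polynomial_function.intros(2) assms, of v c] by simp

lemma real_polynomial_function_dir_deriv [intro]:
  assumes "real_polynomial_function p"
  shows "real_polynomial_function (dir_deriv v p)"
  using assms
  by induction (auto simp: dir_deriv_linear dir_deriv_add dir_deriv_mult
      real_polynomial_function.intros(2))

text \<open>
  Induction over the construction of the polynomial: the product rule makes the statement for a
  product symmetric in the two directions once it holds for the factors.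
\<close>

lemma dir_deriv_commute:
  assumes "real_polynomial_function p"
  shows "dir_deriv v (dir_deriv w p) = dir_deriv w (dir_deriv v p)"
  using assms
proof induction
  case (linear f) then show ?case by (simp add: dir_deriv_linear)
next
  case (const c) show ?case by simp
next
  case (add f g)
  then show ?case
    by (simp add: dir_deriv_add real_polynomial_function_dir_deriv)
next
  case (mult f g)
  then show ?case
    by (simp add: dir_deriv_mult dir_deriv_add real_polynomial_function_dir_deriv
        real_polynomial_function.intros(4) algebra_simps)
qed

lemma dir_deriv_along_line:
  assumes "real_polynomial_function p"
  shows "((\<lambda>t. p (x + t *\<^sub>R v)) has_real_derivative dir_deriv v p (x + s *\<^sub>R v)) (at s)"
proof -
  have "((\<lambda>t. p (x + t *\<^sub>R v)) has_derivative (\<lambda>h. dir_deriv (0 + h *\<^sub>R v) p (x + s *\<^sub>R v))) (at s)"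
    by (rule has_derivative_compose[OF _ has_derivative_dir_deriv[OF assms]])
      (auto intro!: derivative_eq_intros)
  moreover have "(\<lambda>h. dir_deriv (0 + h *\<^sub>R v) p (x + s *\<^sub>R v)) = (\<lambda>h. dir_deriv v p (x + s *\<^sub>R v) * h)"
    using linear_scale[OF linear_dir_deriv[OF assms]] by (auto simp: mult.commute)
  ultimately show ?thesis by (simp add: has_field_derivative_def)
qed

text \<open>
  This identifies the second derivatives in the definition of \<open>laplacian\<close> with iterated directional
  derivatives.
\<close>

lemma deriv_twice_along_line:
  assumes "real_polynomial_function p"
  shows "(deriv ^^ 2) (\<lambda>t. p (x + t *\<^sub>R v)) 0 = dir_deriv v (dir_deriv v p) x"
proof -
  have "deriv (\<lambda>t. p (x + t *\<^sub>R v)) = (\<lambda>t. dir_deriv v p (x + t *\<^sub>R v))"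
    by (intro ext DERIV_imp_deriv dir_deriv_along_line assms)
  moreover have "deriv (\<lambda>t. dir_deriv v p (x + t *\<^sub>R v)) 0 = dir_deriv v (dir_deriv v p) x"
    using dir_deriv_along_line[OF real_polynomial_function_dir_deriv[OF assms], of v x v 0]
    by (simp add: DERIV_imp_deriv)
  ultimately show ?thesis by (simp add: numeral_2_eq_2)
qed

definition homogeneous :: "nat \<Rightarrow> ('a::real_vector \<Rightarrow> real) \<Rightarrow> bool" where
  "homogeneous d p \<longleftrightarrow> (\<forall>t x. p (t *\<^sub>R x) = t ^ d * p x)"

lemma homogeneousD: "homogeneous d p \<Longrightarrow> p (t *\<^sub>R x) = t ^ d * p x"
  by (simp add: homogeneous_def)

lemma homogeneous_mult:
  "homogeneous d p \<Longrightarrow> homogeneous e q \<Longrightarrow> homogeneous (d + e) (\<lambda>x. p x * q x)"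
  by (simp add: homogeneous_def power_add)

lemma homogeneous_cmult: "homogeneous d p \<Longrightarrow> homogeneous d (\<lambda>x. c * p x)"
  by (simp add: homogeneous_def)

lemma homogeneous_add:
  "homogeneous d p \<Longrightarrow> homogeneous d q \<Longrightarrow> homogeneous d (\<lambda>x. p x + q x)"
  by (simp add: homogeneous_def algebra_simps)

lemma homogeneous_diff:
  "homogeneous d p \<Longrightarrow> homogeneous d q \<Longrightarrow> homogeneous d (\<lambda>x. p x - q x)"
  by (simp add: homogeneous_def algebra_simps)

lemma homogeneous_0_const: "homogeneous 0 p \<Longrightarrow> p x = p y"
  by (metis homogeneous_def mult_1 power_0 scale_zero_left)

lemma euler_homogeneous:
  assumes p: "real_polynomial_function p" and h: "homogeneous d p"
  shows "dir_deriv x p x = d * p x"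
proof -
  have "((\<lambda>t. p (0 + t *\<^sub>R x)) has_real_derivative dir_deriv x p (0 + 1 *\<^sub>R x)) (at 1)"
    by (rule dir_deriv_along_line[OF p])
  moreover have "((\<lambda>t. p (0 + t *\<^sub>R x)) has_real_derivative d * p x) (at 1)"
    by (auto simp: homogeneousD[OF h] intro!: derivative_eq_intros)
  ultimately show ?thesis using DERIV_unique by fastforce
qed

text \<open>
  Differentiating \<open>p (t *\<^sub>R y) = t ^ d * p y\<close> in \<open>y\<close> gives the scaling law up to a factor \<open>t\<close>, which
  can be cancelled for \<open>t \<noteq> 0\<close>; continuity covers \<open>t = 0\<close>.  In degree 0 the derivative vanishes, so
  that the truncated difference \<open>d - 1\<close> is harmless.
\<close>

lemma homogeneous_dir_deriv:
  assumes p: "real_polynomial_function p" and h: "homogeneous d p"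
  shows "homogeneous (d - 1) (dir_deriv v p)"
proof -
  have pos: "dir_deriv v p (t *\<^sub>R x) = t ^ (d - 1) * dir_deriv v p x" if "t \<noteq> 0" for t x
  proof -
    have "((\<lambda>y. p (t *\<^sub>R y)) has_derivative (\<lambda>v. dir_deriv (t *\<^sub>R v) p (t *\<^sub>R x))) (at x)"
      by (rule has_derivative_compose[OF _ has_derivative_dir_deriv[OF p]])
        (auto intro!: derivative_eq_intros)
    moreover have "((\<lambda>y. p (t *\<^sub>R y)) has_derivative (\<lambda>v. t ^ d * dir_deriv v p x)) (at x)"
      unfolding homogeneousD[OF h]
      by (intro has_derivative_mult_right has_derivative_dir_deriv p)
    ultimately have "dir_deriv (t *\<^sub>R v) p (t *\<^sub>R x) = t ^ d * dir_deriv v p x"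
      using has_derivative_unique by metis
    then have eq: "t * dir_deriv v p (t *\<^sub>R x) = t ^ d * dir_deriv v p x"
      using linear_scale[OF linear_dir_deriv[OF p]] by simp
    show ?thesis
    proof (cases d)
      case 0
      have "p = (\<lambda>x. p 0)" using homogeneous_0_const h 0 by metis
      then have "dir_deriv v p = (\<lambda>x. 0)" using dir_deriv_const by metis
      then show ?thesis by simp
    next
      case (Suc k) with eq that show ?thesis by simp
    qed
  qed
  moreover have "dir_deriv v p (0 *\<^sub>R x) = 0 ^ (d - 1) * dir_deriv v p x" for x
  proof -
    have lim: "((\<lambda>t. dir_deriv v p (t *\<^sub>R x)) \<longlongrightarrow> dir_deriv v p (0 *\<^sub>R x)) (at 0)"
      by (rule isCont_tendsto_compose[where g = "dir_deriv v p"])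
        (auto intro!: tendsto_eq_intros differentiable_imp_continuous_within
          real_polynomial_function_differentiable real_polynomial_function_dir_deriv p)
    have "((\<lambda>t. t ^ (d - 1) * dir_deriv v p x) \<longlongrightarrow> 0 ^ (d - 1) * dir_deriv v p x) (at 0)"
      by (auto intro!: tendsto_eq_intros)
    then have "((\<lambda>t. dir_deriv v p (t *\<^sub>R x)) \<longlongrightarrow> 0 ^ (d - 1) * dir_deriv v p x) (at 0)"
      by (rule Lim_transform_eventually) (auto simp: pos eventually_at_filter)
    then show ?thesis using lim tendsto_unique by (metis at_neq_bot)
  qed
  ultimately show ?thesis unfolding homogeneous_def by metis
qed

section \<open>Laplacian and harmonic decomposition\<close>

lemma dir_deriv_sum:
  assumes "finite I" "\<And>i. i \<in> I \<Longrightarrow> real_polynomial_function (f i)"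
  shows "dir_deriv v (\<lambda>x. \<Sum>i\<in>I. f i x) = (\<lambda>x. \<Sum>i\<in>I. dir_deriv v (f i) x)"
  by (intro ext dir_deriv_eqI has_derivative_sum has_derivative_dir_deriv assms)

lemma dir_deriv_expand:
  assumes "real_polynomial_function p" "x = (\<Sum>b\<in>B. (x \<bullet> b) *\<^sub>R b)"
  shows "dir_deriv x p y = (\<Sum>b\<in>B. (x \<bullet> b) * dir_deriv b p y)"
proof -
  have "dir_deriv x p y = dir_deriv (\<Sum>b\<in>B. (x \<bullet> b) *\<^sub>R b) p y"
    by (subst (1) assms(2)) (rule refl)
  also have "\<dots> = (\<Sum>b\<in>B. (x \<bullet> b) * dir_deriv b p y)"
    by (simp add: linear_sum[OF linear_dir_deriv[OF assms(1)]]
        linear_scale[OF linear_dir_deriv[OF assms(1)]])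
  finally show ?thesis .
qed

lemma real_polynomial_function_inner_left: "real_polynomial_function (\<lambda>x::'a::real_inner. x \<bullet> v)"
  by (intro real_polynomial_function.intros(1) bounded_linear_inner_left)

lemma dir_deriv_inner_left: "dir_deriv v (\<lambda>x::'a::real_inner. x \<bullet> w) = (\<lambda>x. v \<bullet> w)"
  by (intro dir_deriv_linear bounded_linear_inner_left)

text \<open>
  Euler's identity applied to \<open>p\<close> and then to its directional derivatives, which have degree \<open>d - 1\<close>.
\<close>

lemma euler_homogeneous_twice:
  assumes p: "real_polynomial_function p" and h: "homogeneous d p"
    and x: "x = (\<Sum>b\<in>B. (x \<bullet> b) *\<^sub>R b)"
  shows "(\<Sum>a\<in>B. \<Sum>b\<in>B. (x \<bullet> a) * (x \<bullet> b) * dir_deriv a (dir_deriv b p) x) = d * (real d - 1) * p x"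
proof -
  have p': "real_polynomial_function (dir_deriv b p)" for b
    using p by (rule real_polynomial_function_dir_deriv)
  have "(\<Sum>a\<in>B. \<Sum>b\<in>B. (x \<bullet> a) * (x \<bullet> b) * dir_deriv a (dir_deriv b p) x)
      = (\<Sum>b\<in>B. (x \<bullet> b) * dir_deriv x (dir_deriv b p) x)"
    by (subst sum.swap) (simp add: dir_deriv_expand[OF p' x] sum_distrib_left algebra_simps)
  also have "\<dots> = (\<Sum>b\<in>B. (x \<bullet> b) * (real (d - 1) * dir_deriv b p x))"
    by (simp add: euler_homogeneous[OF p' homogeneous_dir_deriv[OF p h]])
  also have "\<dots> = real (d - 1) * dir_deriv x p x"
    by (simp add: dir_deriv_expand[OF p x] sum_distrib_left algebra_simps)
  also have "\<dots> = d * (real d - 1) * p x"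
    by (cases d) (simp_all add: euler_homogeneous[OF p h])
  finally show ?thesis .
qed

lemma laplacian_eq_dir_deriv:
  assumes "real_polynomial_function p"
  shows "laplacian p x = (\<Sum>b\<in>Basis. dir_deriv b (dir_deriv b p) x)"
  by (simp add: laplacian_def deriv_twice_along_line[OF assms])

lemma real_polynomial_function_laplacian [intro]:
  assumes "real_polynomial_function p"
  shows "real_polynomial_function (laplacian p)"
proof -
  have "laplacian p = (\<lambda>x. \<Sum>b\<in>Basis. dir_deriv b (dir_deriv b p) x)"
    using laplacian_eq_dir_deriv[OF assms] by (rule ext)
  then show ?thesis
    using assms by (auto intro!: real_polynomial_function_sum)
qed

lemma homogeneous_laplacian:
  assumes "real_polynomial_function p" "homogeneous d p"
  shows "homogeneous (d - 2) (laplacian p)"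
proof -
  have "homogeneous (d - 1 - 1) (dir_deriv b (dir_deriv b p))" for b
    by (intro homogeneous_dir_deriv real_polynomial_function_dir_deriv assms)
  then show ?thesis
    by (simp add: homogeneous_def laplacian_eq_dir_deriv[OF assms(1)] sum_distrib_left
        numeral_2_eq_2)
qed

lemma dir_deriv_twice_eq_0_if_degree_less_2:
  assumes "real_polynomial_function p" "homogeneous d p" "d < 2"
  shows "dir_deriv a (dir_deriv b p) x = 0"
proof -
  have "homogeneous 0 (dir_deriv b p)"
    using homogeneous_dir_deriv[OF assms(1,2), of b] assms(3) by simp
  then have "dir_deriv b p = (\<lambda>x. dir_deriv b p 0)"
    by (intro ext homogeneous_0_const)
  then show ?thesis by (metis dir_deriv_const)
qed

lemma laplacian_eq_0_if_degree_less_2: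
  assumes "real_polynomial_function p" "homogeneous d p" "d < 2"
  shows "laplacian p x = 0"
  by (simp add: laplacian_eq_dir_deriv[OF assms(1)] dir_deriv_twice_eq_0_if_degree_less_2[OF assms])

lemma laplacian_add:
  assumes "real_polynomial_function p" "real_polynomial_function q"
  shows "laplacian (\<lambda>x. p x + q x) x = laplacian p x + laplacian q x"
  using assms
  by (simp add: laplacian_eq_dir_deriv real_polynomial_function.intros dir_deriv_add
      real_polynomial_function_dir_deriv sum.distrib)

lemma laplacian_diff:
  assumes "real_polynomial_function p" "real_polynomial_function q"
  shows "laplacian (\<lambda>x. p x - q x) x = laplacian p x - laplacian q x"
  using assms
  by (simp add: laplacian_eq_dir_deriv real_polynomial_function_diff dir_deriv_diff
      real_polynomial_function_dir_deriv sum_subtractf)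

lemma laplacian_cmult:
  assumes "real_polynomial_function p"
  shows "laplacian (\<lambda>x. c * p x) x = c * laplacian p x"
  using assms
  by (simp add: laplacian_eq_dir_deriv real_polynomial_function.intros dir_deriv_cmult
      real_polynomial_function_dir_deriv sum_distrib_left)

lemma real_polynomial_function_norm_sq: "real_polynomial_function (\<lambda>x::'a::euclidean_space. x \<bullet> x)"
proof -
  have "(\<lambda>x::'a. x \<bullet> x) = (\<lambda>x. \<Sum>b\<in>Basis. (x \<bullet> b) * (x \<bullet> b))"
    by (rule ext) (rule euclidean_inner)
  then show ?thesis
    by (simp add: real_polynomial_function_sum real_polynomial_function.intros(4)
        real_polynomial_function_inner_left)
qed

lemma dir_deriv_norm_sq: "dir_deriv v (\<lambda>x::'a::real_inner. x \<bullet> x) = (\<lambda>x. 2 * (x \<bullet> v))"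
proof
  fix x :: 'a
  have "((\<lambda>x. x \<bullet> x) has_derivative (\<lambda>v. x \<bullet> v + v \<bullet> x)) (at x)"
    by (intro has_derivative_inner has_derivative_ident)
  then show "dir_deriv v (\<lambda>x. x \<bullet> x) x = 2 * (x \<bullet> v)"
    by (simp add: dir_deriv_eqI inner_commute)
qed

text \<open>
  The cross term of the product rule is \<open>4 * dir_deriv x p x\<close>, which Euler's identity evaluates.
\<close>

lemma laplacian_norm_sq_mult:
  fixes p :: "real^'n \<Rightarrow> real"
  assumes p: "real_polynomial_function p" and h: "homogeneous d p"
  shows "laplacian (\<lambda>x. (x \<bullet> x) * p x) x
    = (x \<bullet> x) * laplacian p x + (2 * CARD('n) + 4 * d) * p x"
proof -
  note ps = p real_polynomial_function_norm_sq real_polynomial_function_dir_deriv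
  have D1: "dir_deriv b (\<lambda>x. (x \<bullet> x) * p x) = (\<lambda>x. (x \<bullet> x) * dir_deriv b p x + 2 * (x \<bullet> b) * p x)"
    for b by (simp add: dir_deriv_mult[OF real_polynomial_function_norm_sq p] dir_deriv_norm_sq)
  have D2: "dir_deriv b (\<lambda>x. (x \<bullet> x) * dir_deriv b p x + 2 * (x \<bullet> b) * p x) x
    = (x \<bullet> x) * dir_deriv b (dir_deriv b p) x + 4 * ((x \<bullet> b) * dir_deriv b p x) + 2 * p x"
    if "b \<in> Basis" for b
  proof -
    have "(\<lambda>x. 2 * (x \<bullet> b) * p x) = (\<lambda>x. 2 * ((x \<bullet> b) * p x))" by (simp add: mult.assoc)
    then show ?thesis
      using that
      by (simp add: ps dir_deriv_add dir_deriv_mult dir_deriv_cmult dir_deriv_norm_sq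
          dir_deriv_inner_left real_polynomial_function_inner_left real_polynomial_function.intros(2,4)
          algebra_simps)
  qed
  have x: "x = (\<Sum>b\<in>Basis. (x \<bullet> b) *\<^sub>R b)" by (simp add: euclidean_representation)
  have "laplacian (\<lambda>x. (x \<bullet> x) * p x) x = (\<Sum>b\<in>Basis. (x \<bullet> x) * dir_deriv b (dir_deriv b p) x
      + 4 * ((x \<bullet> b) * dir_deriv b p x) + 2 * p x)"
    by (subst laplacian_eq_dir_deriv) (simp_all add: ps real_polynomial_function.intros(4) D1 D2)
  also have "\<dots> = (x \<bullet> x) * laplacian p x + 4 * dir_deriv x p x + 2 * CARD('n) * p x"
    by (simp add: sum.distrib sum_distrib_left laplacian_eq_dir_deriv[OF p] dir_deriv_expand[OF p x])
  finally show ?thesis by (simp add: euler_homogeneous[OF p h] algebra_simps)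
qed

lemma homogeneous_norm_sq: "homogeneous 2 (\<lambda>x::'a::real_inner. x \<bullet> x)"
  by (simp add: homogeneous_def power2_eq_square)

text \<open>
  The operator \<open>s \<mapsto> \<bar>x\<bar>\<^sup>2 \<Delta> s + c s\<close> is onto the homogeneous polynomials of a fixed degree.  With the
  ansatz \<open>s = (q - \<bar>x\<bar>\<^sup>2 w) / c\<close> the equation for \<open>s\<close> becomes \<open>\<Delta> s = w\<close>, that is, the equation of the
  same type with right-hand side \<open>\<Delta> q\<close> and a larger constant for \<open>w\<close>, whose degree is two less.
\<close>

lemma norm_sq_laplacian_surj:
  fixes q :: "real^'n \<Rightarrow> real"
  assumes "real_polynomial_function q" "homogeneous d q" "0 < c"
  shows "\<exists>s. real_polynomial_function s \<and> homogeneous d s \<and> (\<forall>x. (x \<bullet> x) * laplacian s x + c * s x = q x)"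
  using assms
proof (induction d arbitrary: q c rule: less_induct)
  case (less d)
  note q = less.prems(1,2)
  show ?case
  proof (cases "d < 2")
    case True
    then show ?thesis
      using less.prems laplacian_eq_0_if_degree_less_2[OF q]
      by (intro exI[of _ "\<lambda>x. (1 / c) * q x"])
        (simp add: laplacian_cmult homogeneous_cmult real_polynomial_function.intros del: times_divide_eq_left)
  next
    case False
    define c' where "c' = c + (2 * CARD('n) + 4 * (d - 2))"
    have "0 < c'" using less.prems(3) by (simp add: c'_def add_pos_nonneg)
    then obtain w where w: "real_polynomial_function w" "homogeneous (d - 2) w"
      and w': "\<And>x. (x \<bullet> x) * laplacian w x + c' * w x = laplacian q x"
      using less.IH[of "d - 2" "laplacian q" c'] False q
      by (auto simp: real_polynomial_function_laplacian homogeneous_laplacian)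
    define s where "s x = (1 / c) * (q x - (x \<bullet> x) * w x)" for x
    have pw: "real_polynomial_function (\<lambda>x. (x \<bullet> x) * w x)"
      by (intro real_polynomial_function.intros(4) real_polynomial_function_norm_sq w)
    have "real_polynomial_function s"
      unfolding s_def
      by (intro real_polynomial_function.intros(4,2) real_polynomial_function_diff q pw)
    moreover have "homogeneous d s"
      using homogeneous_mult[OF homogeneous_norm_sq w(2)] q(2) le_add_diff_inverse[of 2 d] False
      unfolding s_def by (intro homogeneous_cmult homogeneous_diff) (auto simp del: add_2_eq_Suc)
    moreover have "(x \<bullet> x) * laplacian s x + c * s x = q x" for x
    proof -
      have "laplacian s x = (1 / c) * (laplacian q x - laplacian (\<lambda>x. (x \<bullet> x) * w x) x)"
        unfolding s_def
        by (simp only: laplacian_cmult[OF real_polynomial_function_diff[OF q(1) pw]]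
            laplacian_diff[OF q(1) pw])
      also have "laplacian (\<lambda>x. (x \<bullet> x) * w x) x = (x \<bullet> x) * laplacian w x + (c' - c) * w x"
        by (simp add: laplacian_norm_sq_mult[OF w] c'_def)
      also have "laplacian q x - \<dots> = c * w x"
        using w'[of x] by (simp add: algebra_simps)
      finally have "laplacian s x = w x" using less.prems(3) by simp
      then show ?thesis
        using less.prems(3) by (simp add: s_def[of x])
    qed
    ultimately show ?thesis by blast
  qed
qed

lemma harmonic_polynomial_iff:
  "harmonic_polynomial d p \<longleftrightarrow>
    real_polynomial_function p \<and> homogeneous d p \<and> (\<forall>x. laplacian p x = 0)"
  by (simp add: harmonic_polynomial_def homogeneous_def)

text \<open>
  By \<open>laplacian_norm_sq_mult\<close> the equation \<open>\<Delta> (\<bar>x\<bar>\<^sup>2 s) = \<Delta> p\<close> has the form solved by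
  \<open>norm_sq_laplacian_surj\<close>; then \<open>p - \<bar>x\<bar>\<^sup>2 s\<close> is harmonic.
\<close>

lemma harmonic_decomposition_step:
  fixes p :: "real^'n \<Rightarrow> real"
  assumes p: "real_polynomial_function p" "homogeneous (d + 2) p"
  obtains h s where "harmonic_polynomial (d + 2) h" "real_polynomial_function s" "homogeneous d s"
    "\<And>x. p x = h x + (x \<bullet> x) * s x"
proof -
  have "0 < real (2 * CARD('n) + 4 * d)"
    unfolding of_nat_0_less_iff using zero_less_card_finite[where 'a='n] by linarith
  then obtain s where s: "real_polynomial_function s" "homogeneous d s"
    and s': "\<And>x. (x \<bullet> x) * laplacian s x + real (2 * CARD('n) + 4 * d) * s x = laplacian p x"
    using norm_sq_laplacian_surj[of "laplacian p" d "real (2 * CARD('n) + 4 * d)"] p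
      homogeneous_laplacian[OF p] by (auto simp: real_polynomial_function_laplacian)
  have ps: "real_polynomial_function (\<lambda>x. (x \<bullet> x) * s x)"
    by (intro real_polynomial_function.intros(4) real_polynomial_function_norm_sq s)
  have "harmonic_polynomial (d + 2) (\<lambda>x. p x - (x \<bullet> x) * s x)"
    unfolding harmonic_polynomial_iff
  proof (intro conjI allI)
    show "homogeneous (d + 2) (\<lambda>x. p x - (x \<bullet> x) * s x)"
      using homogeneous_mult[OF homogeneous_norm_sq s(2)] p
      by (intro homogeneous_diff) (simp_all add: add.commute)
    show "laplacian (\<lambda>x. p x - (x \<bullet> x) * s x) x = 0" for x
      using s'[of x] by (simp add: laplacian_diff[OF p(1) ps] laplacian_norm_sq_mult[OF s])
  qed (intro real_polynomial_function_diff p ps)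
  then show thesis using that s by simp
qed

text \<open>
  The finite sums of homogeneous polynomials contain the linear forms and the constants and are closed
  under sums and products, so they are all polynomials.
\<close>

lemma homogeneous_polynomial_induct:
  fixes P :: "('a::real_normed_vector \<Rightarrow> real) \<Rightarrow> bool"
  assumes p: "real_polynomial_function p"
    and hom: "\<And>d p. real_polynomial_function p \<Longrightarrow> homogeneous d p \<Longrightarrow> P p"
    and add: "\<And>p q. real_polynomial_function p \<Longrightarrow> real_polynomial_function q \<Longrightarrow> P p \<Longrightarrow> P q \<Longrightarrow> P (\<lambda>x. p x + q x)"
  shows "P p"
proof -
  define hp where "hp N g \<longleftrightarrow> (\<forall>i<N. real_polynomial_function (g i) \<and> (\<exists>d. homogeneous d (g i)))"
    for N :: nat and g :: "nat \<Rightarrow> 'a \<Rightarrow> real"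
  define Q where "Q p \<longleftrightarrow> (\<exists>N g. hp N g \<and> p = (\<lambda>x. \<Sum>i<N. g i x))" for p
  have Q0: "Q (\<lambda>x. 0)" unfolding Q_def hp_def by (intro exI[of _ 0]) auto
  have Q1: "Q (\<lambda>x. q x + p x)" if "Q q" "real_polynomial_function p" "homogeneous d p" for q p d
  proof -
    from that obtain N g where g: "hp N g" "q = (\<lambda>x. \<Sum>i<N. g i x)" unfolding Q_def by auto
    then have "hp (Suc N) (g(N := p))" using that by (auto simp: hp_def less_Suc_eq)
    moreover have "(\<lambda>x. q x + p x) = (\<lambda>x. \<Sum>i<Suc N. (g(N := p)) i x)" by (simp add: g(2))
    ultimately show ?thesis unfolding Q_def by blast
  qed
  have Qhom: "Q p" if "real_polynomial_function p" "homogeneous d p" for p d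
    using Q1[OF Q0 that] by simp
  have Qadd': "Q (\<lambda>x. q x + (\<Sum>i<N. g i x))" if "Q q" "hp N g" for q N g
    using that(2)
  proof (induction N)
    case 0 then show ?case using that by simp
  next
    case (Suc N)
    then show ?case using Q1[of "\<lambda>x. q x + (\<Sum>i<N. g i x)" "g N"]
      by (auto simp: hp_def add.assoc)
  qed
  have Qadd: "Q (\<lambda>x. q x + p x)" if "Q q" "Q p" for p q
    using Qadd'[OF that(1)] that(2) unfolding Q_def by auto
  have Qmulth: "Q (\<lambda>x. q x * p x)" if "Q q" "real_polynomial_function p" "homogeneous d p" for q p d
  proof -
    from that obtain N g where g: "hp N g" "q = (\<lambda>x. \<Sum>i<N. g i x)" unfolding Q_def by auto
    have "hp N (\<lambda>i x. g i x * p x)"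
      using g(1) that(2,3) homogeneous_mult unfolding hp_def
      by (blast intro: real_polynomial_function.intros(4))
    moreover have "(\<lambda>x. q x * p x) = (\<lambda>x. \<Sum>i<N. g i x * p x)"
      by (simp add: g(2) sum_distrib_right)
    ultimately show ?thesis unfolding Q_def by blast
  qed
  have Qmult: "Q (\<lambda>x. q x * p x)" if "Q q" "Q p" for p q
  proof -
    from that obtain N g where g: "hp N g" "p = (\<lambda>x. \<Sum>i<N. g i x)" unfolding Q_def by auto
    have "Q (\<lambda>x. q x * (\<Sum>i<N. g i x))" using g(1)
    proof (induction N)
      case 0 then show ?case using Q0 by simp
    next
      case (Suc N)
      then obtain d where "real_polynomial_function (g N)" "homogeneous d (g N)"
        by (auto simp: hp_def)
      with Suc show ?case
        using Qadd[OF _ Qmulth[OF that(1)], of "\<lambda>x. q x * (\<Sum>i<N. g i x)" "g N" d]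
        by (auto simp: hp_def algebra_simps)
    qed
    then show ?thesis by (simp add: g(2))
  qed
  have "Q p" using p
  proof induction
    case (linear f)
    then show ?case
      by (intro Qhom[of _ 1] real_polynomial_function.intros(1))
        (auto simp: homogeneous_def linear_scale[OF bounded_linear.linear])
  next
    case (const c)
    then show ?case by (intro Qhom[of _ 0] real_polynomial_function.intros(2)) (auto simp: homogeneous_def)
  qed (use Qadd Qmult in auto)
  then obtain N g where g: "hp N g" "p = (\<lambda>x. \<Sum>i<N. g i x)" unfolding Q_def by auto
  have "P (\<lambda>x. \<Sum>i<N. g i x) \<and> real_polynomial_function (\<lambda>x. \<Sum>i<N. g i x)" using g(1)
  proof (induction N)
    case 0
    show ?case using hom[of "\<lambda>x. 0" 0] by (auto simp: homogeneous_def)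
  next
    case (Suc N)
    then show ?case using add[of "\<lambda>x. \<Sum>i<N. g i x" "g N"] hom
      by (auto simp: hp_def)
  qed
  then show ?thesis by (simp add: g(2))
qed

text \<open>
  On the unit sphere the factor \<open>\<bar>x\<bar>\<^sup>2\<close> of \<open>harmonic_decomposition_step\<close> disappears, so a homogeneous
  polynomial agrees there with a harmonic one plus a homogeneous one of lower degree.
\<close>

lemma polynomial_on_sphere_induct:
  fixes P :: "(real^'n \<Rightarrow> real) \<Rightarrow> bool"
  assumes p: "real_polynomial_function p"
    and harm: "\<And>d h. harmonic_polynomial d h \<Longrightarrow> P h"
    and add: "\<And>p q. real_polynomial_function p \<Longrightarrow> real_polynomial_function q \<Longrightarrow> P p \<Longrightarrow> P q \<Longrightarrow> P (\<lambda>x. p x + q x)"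
    and cong: "\<And>p q. real_polynomial_function p \<Longrightarrow> real_polynomial_function q \<Longrightarrow> P p \<Longrightarrow> (\<And>x. norm x = 1 \<Longrightarrow> p x = q x) \<Longrightarrow> P q"
  shows "P p"
  using p
proof (rule homogeneous_polynomial_induct)
  fix d and p :: "real^'n \<Rightarrow> real"
  assume "real_polynomial_function p" "homogeneous d p"
  then show "P p"
  proof (induction d arbitrary: p rule: less_induct)
    case (less d)
    show ?case
    proof (cases "d < 2")
      case True
      then show ?thesis
        using less.prems harm[of d p] laplacian_eq_0_if_degree_less_2[OF less.prems]
        by (simp add: harmonic_polynomial_iff)
    next
      case False
      then obtain e where e: "d = e + 2" using le_Suc_ex by (metis add.commute not_less)
      obtain h s where hs: "harmonic_polynomial d h" "real_polynomial_function s" "homogeneous e s"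
        "\<And>x. p x = h x + (x \<bullet> x) * s x"
        using harmonic_decomposition_step less.prems e by metis
      have h: "real_polynomial_function h" using hs(1) by (simp add: harmonic_polynomial_iff)
      have "P (\<lambda>x. h x + s x)" using less.IH[of e s] e hs by (intro add h harm[OF hs(1)]) auto
      then show ?thesis
        by (rule cong[rotated 2]) (auto simp: hs(4) norm_eq_1 intro!: real_polynomial_function.intros(3,4) real_polynomial_function_norm_sq
              h hs(2) less.prems(1))
    qed
  qed
qed (rule add)

section \<open>Rotation-invariant measures on spheres\<close>

text \<open>
  Rotation by the angle \<open>t\<close> in the plane of the orthonormal vectors \<open>a\<close> and \<open>b\<close>, the identity on their
  orthogonal complement.
\<close>

definition plane_rotation :: "'a::real_inner \<Rightarrow> 'a \<Rightarrow> real \<Rightarrow> 'a \<Rightarrow> 'a" where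
  "plane_rotation a b t x = x + ((cos t - 1) * (x \<bullet> a) - sin t * (x \<bullet> b)) *\<^sub>R a
     + (sin t * (x \<bullet> a) + (cos t - 1) * (x \<bullet> b)) *\<^sub>R b"

lemma orthogonal_transformation_plane_rotation:
  assumes "norm a = 1" "norm b = 1" "a \<bullet> b = 0"
  shows "orthogonal_transformation (plane_rotation a b t)"
  unfolding orthogonal_transformation_def
proof (intro conjI allI)
  show "linear (plane_rotation a b t)"
    by (rule linearI) (auto simp: plane_rotation_def algebra_simps)
  fix x y
  have ab: "a \<bullet> a = 1" "b \<bullet> b = 1" "b \<bullet> a = 0" "a \<bullet> b = 0"
    using assms by (auto simp: norm_eq_1 inner_commute)
  have cs: "cos t * cos t = 1 - sin t * sin t"
    using sin_cos_squared_add3[of t] by linarith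
  define A B C D where "A = x \<bullet> a" "B = x \<bullet> b" "C = y \<bullet> a" "D = y \<bullet> b"
  have comm: "a \<bullet> y = C" "b \<bullet> y = D" by (simp_all add: A_B_C_D_def inner_commute)
  have "plane_rotation a b t x \<bullet> plane_rotation a b t y = x \<bullet> y
      + ((cos t - 1) * C - sin t * D) * A + (sin t * C + (cos t - 1) * D) * B
      + ((cos t - 1) * A - sin t * B) * C + (sin t * A + (cos t - 1) * B) * D
      + ((cos t - 1) * A - sin t * B) * ((cos t - 1) * C - sin t * D)
      + (sin t * A + (cos t - 1) * B) * (sin t * C + (cos t - 1) * D)"
    unfolding plane_rotation_def inner_add_left inner_add_right inner_scaleR_left
      inner_scaleR_right ab comm A_B_C_D_def[symmetric] by (simp add: algebra_simps)
  also have "\<dots> = x \<bullet> y"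
    using cs by algebra
  finally show "plane_rotation a b t x \<bullet> plane_rotation a b t y = x \<bullet> y" .
qed

text \<open>
  \<open>B\<close> is an orthonormal basis of the subspace that carries the sphere.  This covers the full sphere
  (\<open>B = Basis\<close>) and the great subspheres (\<open>B\<close> a basis of a hyperplane) at once.
  The transformations are restricted to those fixing the orthogonal complement of \<open>B\<close>, because on a
  great subsphere they must fix the pole.
\<close>

locale rotation_invariant_sphere = prob_space M
  for M :: "'a::euclidean_space measure" +
  fixes B :: "'a set"
  assumes orthogonal_B: "pairwise orthogonal B" and unit_B: "b \<in> B \<Longrightarrow> norm b = 1"
    and space_M: "space M = sphere 0 1 \<inter> span B"
    and sets_M: "sets M = sets (restrict_space borel (space M))"
    and invariant: "orthogonal_transformation T \<Longrightarrow> (\<And>x. (\<forall>b\<in>B. x \<bullet> b = 0) \<Longrightarrow> T x = x)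
       \<Longrightarrow> distr M M T = M"
begin

lemma finite_B: "finite B"
  using pairwise_orthogonal_independent[OF orthogonal_B] unit_B
  by (force intro: independent_imp_finite)

lemma inner_B: "a \<in> B \<Longrightarrow> b \<in> B \<Longrightarrow> a \<bullet> b = (if a = b then 1 else 0)"
  using orthogonal_B unit_B by (auto simp: pairwise_def orthogonal_def norm_eq_1)

lemma expand_B: "x \<in> space M \<Longrightarrow> x = (\<Sum>b\<in>B. (x \<bullet> b) *\<^sub>R b)"
  using orthonormal_basis_expand[OF orthogonal_B unit_B _ finite_B] space_M by auto

lemma norm_space: "x \<in> space M \<Longrightarrow> norm x = 1"
  using space_M by auto

lemma parseval_B:
  assumes "x \<in> space M"
  shows "(\<Sum>b\<in>B. (x \<bullet> b)\<^sup>2) = 1"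
proof -
  have "x \<bullet> x = x \<bullet> (\<Sum>b\<in>B. (x \<bullet> b) *\<^sub>R b)" using expand_B[OF assms] by simp
  also have "\<dots> = (\<Sum>b\<in>B. (x \<bullet> b)\<^sup>2)" by (simp add: inner_sum_right power2_eq_square)
  finally show ?thesis using norm_space[OF assms] by (simp add: norm_eq_1)
qed

lemma borel_measurable_M:
  assumes "continuous_on (sphere 0 1) f"
  shows "f \<in> borel_measurable M"
proof -
  have "continuous_on (space M) f" using assms continuous_on_subset space_M by blast
  then have "f \<in> borel_measurable (restrict_space borel (space M))"
    by (rule borel_measurable_continuous_on_restrict)
  then show ?thesis using measurable_cong_sets[OF sets_M refl] by blast
qed

lemma integrable_M:
  fixes f :: "'a \<Rightarrow> real"
  assumes "continuous_on (sphere 0 1) f"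
  shows "integrable M f"
proof -
  have "bounded (f ` sphere 0 1)"
    using assms compact_imp_bounded compact_continuous_image compact_sphere by blast
  then obtain K where "\<forall>x\<in>sphere 0 1. norm (f x) \<le> K" unfolding bounded_iff by blast
  then show ?thesis
    using borel_measurable_M[OF assms] norm_space
    by (intro integrable_const_bound[where B = K]) auto
qed

text \<open>
  The integral of \<open>f\<close> over the rotated sphere does not depend on the angle, and the integrand is the
  derivative of \<open>f\<close> along the rotation at angle 0.  Since that derivative is bounded on the sphere,
  dominated convergence allows differentiation under the integral.
\<close>

lemma integral_angular_derivative:
  assumes a: "a \<in> B" and b: "b \<in> B" and f: "real_polynomial_function f"
  shows "(LINT x|M. (x \<bullet> a) * dir_deriv b f x - (x \<bullet> b) * dir_deriv a f x) = 0"
proof (cases "a = b")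
  case True then show ?thesis by simp
next
  case False
  note ab = inner_B[OF a a] inner_B[OF b b] inner_B[OF a b] inner_B[OF b a]
  let ?R = "plane_rotation a b"
  define A where "A x = (x \<bullet> a) * dir_deriv b f x - (x \<bullet> b) * dir_deriv a f x" for x
  have A: "real_polynomial_function A"
    unfolding A_def
    by (intro real_polynomial_function_diff real_polynomial_function.intros(4)
        real_polynomial_function_inner_left real_polynomial_function_dir_deriv f)
  have orth: "orthogonal_transformation (?R t)" for t
    using a b False ab by (intro orthogonal_transformation_plane_rotation unit_B) auto
  have space: "?R t x \<in> space M" if "x \<in> space M" for t x
  proof -
    have "?R t x \<in> span B"
      unfolding plane_rotation_def using that
      by (intro span_add span_scale span_base[OF a] span_base[OF b]) (auto simp: space_M)
    then show ?thesis
      using that orthogonal_transformation_norm[OF orth, of t x] by (auto simp: space_M)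
  qed
  have cont_R: "continuous_on UNIV (?R t)" for t
    unfolding plane_rotation_def by (intro continuous_intros)
  have meas: "?R t \<in> measurable M M" for t
  proof -
    have "?R t \<in> measurable (restrict_space borel (space M)) (restrict_space borel (space M))"
      using space by (intro measurable_restrict_space3 borel_measurable_continuous_onI cont_R) auto
    then show ?thesis using measurable_cong_sets[OF sets_M sets_M] by blast
  qed
  have inv: "(LINT x|M. f (?R t x)) = (LINT x|M. f x)" for t
  proof -
    have "distr M M (?R t) = M"
      using a b by (intro invariant orth) (auto simp: plane_rotation_def)
    then have "(LINT x|M. f x) = (LINT x|distr M M (?R t). f x)" by simp
    also have "\<dots> = (LINT x|M. f (?R t x))"
      by (intro integral_distr meas borel_measurable_M continuous_on_real_polynomial_function f)
    finally show ?thesis ..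
  qed
  \<comment> \<open>Along an orbit of the rotations, \<open>f\<close> has derivative \<open>A\<close>.\<close>
  have deriv: "((\<lambda>t. f (?R t x)) has_real_derivative A (?R t x)) (at t)" for t x
  proof -
    define y where "y = ?R t x"
    have ya: "y \<bullet> a = cos t * (x \<bullet> a) - sin t * (x \<bullet> b)" "y \<bullet> b = sin t * (x \<bullet> a) + cos t * (x \<bullet> b)"
      using False ab by (simp_all add: y_def plane_rotation_def inner_add_left algebra_simps)
    have "((\<lambda>t. ?R t x) has_derivative (\<lambda>h. h *\<^sub>R ((y \<bullet> a) *\<^sub>R b - (y \<bullet> b) *\<^sub>R a))) (at t)"
      unfolding plane_rotation_def ya
      by (auto intro!: derivative_eq_intros simp: algebra_simps)
    then have "((\<lambda>t. f (?R t x)) has_derivative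
        (\<lambda>h. dir_deriv (h *\<^sub>R ((y \<bullet> a) *\<^sub>R b - (y \<bullet> b) *\<^sub>R a)) f y)) (at t)"
      unfolding y_def by (rule has_derivative_compose[OF _ has_derivative_dir_deriv[OF f]])
    moreover have "dir_deriv (h *\<^sub>R ((y \<bullet> a) *\<^sub>R b - (y \<bullet> b) *\<^sub>R a)) f y = A y * h" for h
      unfolding linear_scale[OF linear_dir_deriv[OF f]] linear_diff[OF linear_dir_deriv[OF f]]
      by (simp add: A_def)
    ultimately show ?thesis by (simp add: has_field_derivative_def y_def)
  qed
  have R0: "?R 0 x = x" for x by (simp add: plane_rotation_def)
  \<comment> \<open>By the mean value theorem this bound for \<open>A\<close> also dominates the difference quotients.\<close>
  obtain K where K: "\<And>x. x \<in> space M \<Longrightarrow> \<bar>A x\<bar> \<le> K"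
  proof -
    have "bounded (A ` sphere 0 1)"
      using continuous_on_real_polynomial_function[OF A] compact_imp_bounded compact_continuous_image
        compact_sphere by blast
    then obtain K where "\<forall>x\<in>sphere 0 1. norm (A x) \<le> K" unfolding bounded_iff by blast
    then show ?thesis using norm_space by (intro that[of K]) auto
  qed
  define q where "q n x = (f (?R (inverse (Suc n)) x) - f x) / inverse (Suc n)" for n x
  have q_int: "(LINT x|M. q n x) = 0" for n
  proof -
    have "continuous_on (sphere 0 1) (\<lambda>x. f (?R t x))" for t
      by (rule continuous_on_compose2[OF continuous_on_real_polynomial_function[OF f, of UNIV]
            continuous_on_subset[OF cont_R]]) auto
    then show ?thesis unfolding q_def
      by (simp add: Bochner_Integration.integral_diff integrable_M continuous_on_real_polynomial_function[OF f] inv)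
  qed
  have "(\<lambda>n. LINT x|M. q n x) \<longlonglongrightarrow> (LINT x|M. A x)"
  proof (rule integral_dominated_convergence[where w = "\<lambda>x. K"])
    show "A \<in> borel_measurable M" by (intro borel_measurable_M continuous_on_real_polynomial_function A)
    show "q n \<in> borel_measurable M" for n
      unfolding q_def
      by (intro borel_measurable_M continuous_intros continuous_on_real_polynomial_function[OF f]
          continuous_on_compose2[OF continuous_on_real_polynomial_function[OF f, of UNIV]
            continuous_on_subset[OF cont_R]]) auto
    show "AE x in M. (\<lambda>n. q n x) \<longlonglongrightarrow> A x"
    proof (rule AE_I2)
      fix x
      have "((\<lambda>t. (f (?R t x) - f (?R 0 x)) / (t - 0)) \<longlongrightarrow> A (?R 0 x)) (at 0)"
        using deriv[of x 0] by (simp add: has_field_derivative_iff)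
      then have "((\<lambda>t. (f (?R t x) - f x) / t) \<longlongrightarrow> A x) (at 0)" by (simp add: R0)
      moreover have "filterlim (\<lambda>n. inverse (real (Suc n))) (at 0) sequentially"
        using LIMSEQ_inverse_real_of_nat by (auto simp: filterlim_at)
      ultimately show "(\<lambda>n. q n x) \<longlonglongrightarrow> A x"
        unfolding q_def by (rule filterlim_compose)
    qed
    show "AE x in M. norm (q n x) \<le> K" for n
    proof (rule AE_I2)
      fix x assume x: "x \<in> space M"
      let ?h = "inverse (real (Suc n))"
      obtain z where "f (?R ?h x) - f (?R 0 x) = (?h - 0) * A (?R z x)"
        using MVT2[of 0 ?h "\<lambda>t. f (?R t x)" "\<lambda>t. A (?R t x)"] deriv by auto
      then have "q n x = A (?R z x)" by (simp add: q_def R0)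
      then show "norm (q n x) \<le> K" using K[OF space[OF x]] by simp
    qed
  qed simp
  then show ?thesis
    unfolding q_int A_def by (simp add: LIMSEQ_const_iff)
qed

text \<open>
  Apply \<open>integral_angular_derivative\<close> to \<open>(x \<bullet> a) * p x * dir_deriv b q x\<close> in the plane of \<open>a\<close> and \<open>b\<close>
  and sum over all pairs.  On the unit sphere \<open>\<Sum>a\<in>B. (x \<bullet> a)\<^sup>2 = 1\<close>, so one part of
  the sum is the Laplacian and gradient term; the other part consists of radial derivatives, evaluated
  by Euler's identities.
\<close>

lemma integral_green:
  assumes p: "real_polynomial_function p" "homogeneous d p"
    and q: "real_polynomial_function q" "homogeneous e q"
  shows "(LINT x|M. p x * (\<Sum>b\<in>B. dir_deriv b (dir_deriv b q) x)
      + (\<Sum>b\<in>B. dir_deriv b p x * dir_deriv b q x))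
    = real e * (real d + real e + real (card B) - 2) * (LINT x|M. p x * q x)"
proof -
  note rpf = real_polynomial_function_dir_deriv real_polynomial_function_inner_left
    real_polynomial_function.intros(2,3,4) p(1) q(1) real_polynomial_function_diff
  define f where "f a b x = (x \<bullet> a) * (p x * dir_deriv b q x)" for a b x
  have f: "real_polynomial_function (f a b)" for a b unfolding f_def by (intro rpf)
  define L where "L x = (\<Sum>b\<in>B. dir_deriv b (dir_deriv b q) x)" for x
  define G where "G x = (\<Sum>b\<in>B. dir_deriv b p x * dir_deriv b q x)" for x
  have df: "dir_deriv c (f a b) x = (x \<bullet> a) * (p x * dir_deriv c (dir_deriv b q) x
      + dir_deriv c p x * dir_deriv b q x) + (c \<bullet> a) * (p x * dir_deriv b q x)" for a b c x
    unfolding f_def by (simp add: dir_deriv_mult dir_deriv_inner_left rpf)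
  have pt: "(\<Sum>a\<in>B. \<Sum>b\<in>B. (x \<bullet> a) * dir_deriv b (f a b) x - (x \<bullet> b) * dir_deriv a (f a b) x)
    = p x * L x + G x - real e * (real d + real e + real (card B) - 2) * (p x * q x)"
    if x: "x \<in> space M" for x
  proof -
    have Dp: "(\<Sum>b\<in>B. (x \<bullet> b) * dir_deriv b p x) = d * p x"
      using dir_deriv_expand[OF p(1) expand_B[OF x]] euler_homogeneous[OF p] by metis
    have Dq: "(\<Sum>b\<in>B. (x \<bullet> b) * dir_deriv b q x) = e * q x"
      using dir_deriv_expand[OF q(1) expand_B[OF x]] euler_homogeneous[OF q] by metis
    have "(\<Sum>a\<in>B. \<Sum>b\<in>B. (x \<bullet> a) * dir_deriv b (f a b) x - (x \<bullet> b) * dir_deriv a (f a b) x)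
      = (\<Sum>a\<in>B. \<Sum>b\<in>B. p x * ((x \<bullet> a)\<^sup>2 * dir_deriv b (dir_deriv b q) x)
          + (x \<bullet> a)\<^sup>2 * (dir_deriv b p x * dir_deriv b q x)
          + (if b = a then p x * ((x \<bullet> b) * dir_deriv b q x) else 0)
          - p x * ((x \<bullet> a) * (x \<bullet> b) * dir_deriv a (dir_deriv b q) x)
          - ((x \<bullet> a) * dir_deriv a p x) * ((x \<bullet> b) * dir_deriv b q x)
          - p x * ((x \<bullet> b) * dir_deriv b q x))"
      by (intro sum.cong refl) (auto simp: df inner_B algebra_simps power2_eq_square)
    also have "\<dots> = p x * ((\<Sum>a\<in>B. (x \<bullet> a)\<^sup>2) * L x) + (\<Sum>a\<in>B. (x \<bullet> a)\<^sup>2) * G x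
        + p x * (\<Sum>b\<in>B. (x \<bullet> b) * dir_deriv b q x)
        - p x * (\<Sum>a\<in>B. \<Sum>b\<in>B. (x \<bullet> a) * (x \<bullet> b) * dir_deriv a (dir_deriv b q) x)
        - (\<Sum>a\<in>B. (x \<bullet> a) * dir_deriv a p x) * (\<Sum>b\<in>B. (x \<bullet> b) * dir_deriv b q x)
        - card B * (p x * (\<Sum>b\<in>B. (x \<bullet> b) * dir_deriv b q x))"
      unfolding L_def G_def sum.distrib sum_subtractf sum_product
      by (simp add: sum_distrib_left sum.delta finite_B)
    also have "\<dots> = p x * L x + G x - real e * (real d + real e + real (card B) - 2) * (p x * q x)"
      unfolding parseval_B[OF x] Dp Dq euler_homogeneous_twice[OF q expand_B[OF x]]
      by (simp add: algebra_simps)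
    finally show ?thesis .
  qed
  have int: "integrable M g" if "real_polynomial_function g" for g
    by (intro integrable_M continuous_on_real_polynomial_function that)
  have "(LINT x|M. p x * L x + G x - real e * (real d + real e + real (card B) - 2) * (p x * q x))
    = (LINT x|M. (\<Sum>a\<in>B. \<Sum>b\<in>B. (x \<bullet> a) * dir_deriv b (f a b) x - (x \<bullet> b) * dir_deriv a (f a b) x))"
    by (intro Bochner_Integration.integral_cong refl pt[symmetric])
  also have "\<dots> = (\<Sum>a\<in>B. \<Sum>b\<in>B. (LINT x|M. (x \<bullet> a) * dir_deriv b (f a b) x - (x \<bullet> b) * dir_deriv a (f a b) x))"
    by (intro Bochner_Integration.integral_sum[THEN trans] sum.cong refl Bochner_Integration.integral_sum
       Bochner_Integration.integrable_sum int rpf f)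
  also have "\<dots> = 0"
    by (simp add: integral_angular_derivative f)
  finally have "(LINT x|M. p x * L x + G x - real e * (real d + real e + real (card B) - 2) * (p x * q x)) = 0" .
  moreover have "integrable M (\<lambda>x. p x * L x + G x)"
    unfolding L_def G_def by (intro int rpf real_polynomial_function_sum finite_B)
  moreover have "integrable M (\<lambda>x. p x * q x)" by (intro int rpf)
  ultimately show ?thesis unfolding L_def G_def by simp
qed

end

section \<open>Orthogonality and Funk averages of harmonic polynomials\<close>

lemma rotation_invariant_sphere_measure:
  "rotation_invariant_sphere (sphere_measure :: (real^'n) measure) Basis"
proof -
  interpret prob_space "sphere_measure :: (real^'n) measure" by (rule prob_space_sphere_measure)
  show ?thesis
  proof
    show "pairwise orthogonal (Basis :: (real^'n) set)"
      by (auto simp: pairwise_def orthogonal_def inner_Basis)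
  qed (simp_all add: sets_sphere_measure distr_sphere_measure_orthogonal)
qed

lemma orthogonal_complement_basis:
  fixes u :: "'a::euclidean_space"
  assumes u: "norm u = 1"
  obtains B where "pairwise orthogonal (insert u B)" "\<And>b. b \<in> insert u B \<Longrightarrow> norm b = 1"
    "u \<notin> B" "finite B" "span B = {x. u \<bullet> x = 0}" "span (insert u B) = UNIV" "card B = DIM('a) - 1"
proof -
  have uu: "u \<bullet> u = 1" and "u \<noteq> 0" using u by (auto simp: norm_eq_1)
  obtain B where B: "B \<subseteq> {x. u \<bullet> x = 0}" "pairwise orthogonal B" "\<And>x. x \<in> B \<Longrightarrow> norm x = 1"
      "independent B" "card B = dim {x. u \<bullet> x = 0}" "span B = {x. u \<bullet> x = 0}"
    using orthonormal_basis_subspace[OF subspace_hyperplane[of u]] by metis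
  have "x \<in> span (insert u B)" for x
  proof -
    have "x - (u \<bullet> x) *\<^sub>R u \<in> span B" by (simp add: B(6) inner_diff_right uu)
    then show ?thesis using span_breakdown_eq by blast
  qed
  then show thesis
    using B u uu dim_hyperplane[OF \<open>u \<noteq> 0\<close>]
    by (intro that[of B]) (auto simp: pairwise_insert orthogonal_def inner_commute
        intro: independent_imp_finite)
qed

lemma rotation_invariant_subsphere_measure:
  fixes u :: "real^'n"
  assumes n: "2 \<le> CARD('n)" and u: "norm u = 1"
    and B: "pairwise orthogonal B" "\<And>b. b \<in> B \<Longrightarrow> norm b = 1" "span B = {x. u \<bullet> x = 0}"
  shows "rotation_invariant_sphere (subsphere_measure u) B"
proof -
  interpret prob_space "subsphere_measure u" by (rule prob_space_subsphere_measure[OF n u])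
  have space: "space (subsphere_measure u) = great_subsphere u"
    by (simp add: subsphere_measure_def space_restrict_space)
  show ?thesis
  proof
    show "space (subsphere_measure u) = sphere 0 1 \<inter> span B"
      by (auto simp: space great_subsphere_def B)
    show "sets (subsphere_measure u) = sets (restrict_space borel (space (subsphere_measure u)))"
      unfolding space by (simp add: subsphere_measure_def sets_restrict_space)
    fix T :: "real^'n \<Rightarrow> real^'n"
    assume T: "orthogonal_transformation T" "\<And>x. \<forall>b\<in>B. x \<bullet> b = 0 \<Longrightarrow> T x = x"
    have "u \<bullet> b = 0" if "b \<in> B" for b using span_base[OF that] B(3) by auto
    then show "distr (subsphere_measure u) (subsphere_measure u) T = subsphere_measure u"
      using distr_subsphere_measure_orthogonal[OF T(1), of u] T(2)[of u] by simp
  qed (use B in auto)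
qed

text \<open>
  The trace of the second derivative does not depend on the orthonormal basis.
\<close>

lemma laplacian_orthonormal_basis:
  fixes p :: "real^'n \<Rightarrow> real"
  assumes p: "real_polynomial_function p"
    and B: "pairwise orthogonal B" "\<And>b. b \<in> B \<Longrightarrow> norm b = 1" "finite B" "span B = UNIV"
  shows "laplacian p x = (\<Sum>b\<in>B. dir_deriv b (dir_deriv b p) x)"
proof -
  note p' = real_polynomial_function_dir_deriv[OF p]
  have e: "e = (\<Sum>b\<in>B. (e \<bullet> b) *\<^sub>R b)" for e
    using orthonormal_basis_expand[OF B(1,2) _ B(3)] B(4) by simp
  have inner: "(\<Sum>e\<in>Basis. (e \<bullet> b) * (e \<bullet> c)) = (if c = b then 1 else 0)" if "b \<in> B" "c \<in> B" for b c
    using that B(1,2) euclidean_inner[of b c]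
    by (auto simp: pairwise_def orthogonal_def norm_eq_1 inner_commute)
  have "laplacian p x = (\<Sum>e\<in>Basis. \<Sum>b\<in>B. \<Sum>c\<in>B. ((e \<bullet> b) * (e \<bullet> c)) * dir_deriv c (dir_deriv b p) x)"
    unfolding laplacian_eq_dir_deriv[OF p]
  proof (rule sum.cong[OF refl])
    fix e :: "real^'n"
    have "dir_deriv e (dir_deriv e p) x = (\<Sum>b\<in>B. (e \<bullet> b) * dir_deriv b (dir_deriv e p) x)"
      by (rule dir_deriv_expand[OF p' e])
    also have "\<dots> = (\<Sum>b\<in>B. (e \<bullet> b) * dir_deriv e (dir_deriv b p) x)"
      using dir_deriv_commute[OF p] by metis
    also have "\<dots> = (\<Sum>b\<in>B. \<Sum>c\<in>B. ((e \<bullet> b) * (e \<bullet> c)) * dir_deriv c (dir_deriv b p) x)"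
      by (subst dir_deriv_expand[OF p' e[of e]]) (simp add: sum_distrib_left mult.assoc)
    finally show "dir_deriv e (dir_deriv e p) x
      = (\<Sum>b\<in>B. \<Sum>c\<in>B. ((e \<bullet> b) * (e \<bullet> c)) * dir_deriv c (dir_deriv b p) x)" .
  qed
  also have "\<dots> = (\<Sum>b\<in>B. \<Sum>e\<in>Basis. \<Sum>c\<in>B. ((e \<bullet> b) * (e \<bullet> c)) * dir_deriv c (dir_deriv b p) x)"
    by (rule sum.swap)
  also have "\<dots> = (\<Sum>b\<in>B. \<Sum>c\<in>B. \<Sum>e\<in>Basis. ((e \<bullet> b) * (e \<bullet> c)) * dir_deriv c (dir_deriv b p) x)"
    by (intro sum.cong refl sum.swap)
  also have "\<dots> = (\<Sum>b\<in>B. dir_deriv b (dir_deriv b p) x)"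
    by (simp add: sum_distrib_right[symmetric] inner if_distrib[of "\<lambda>z. z * _"] B(3) cong: if_cong)
  finally show ?thesis .
qed

lemma harmonic_polynomial_dir_deriv:
  assumes "harmonic_polynomial d p"
  shows "harmonic_polynomial (d - 1) (dir_deriv v p)"
proof -
  have p: "real_polynomial_function p" "homogeneous d p" "laplacian p = (\<lambda>x. 0)"
    using assms by (auto simp: harmonic_polynomial_iff)
  have "laplacian (dir_deriv v p) x = dir_deriv v (laplacian p) x" for x
  proof -
    have "laplacian (dir_deriv v p) x = (\<Sum>b\<in>Basis. dir_deriv b (dir_deriv b (dir_deriv v p)) x)"
      by (rule laplacian_eq_dir_deriv[OF real_polynomial_function_dir_deriv[OF p(1)]])
    also have "\<dots> = (\<Sum>b\<in>Basis. dir_deriv v (dir_deriv b (dir_deriv b p)) x)"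
      by (simp add: dir_deriv_commute[of _ _ v] p(1) real_polynomial_function_dir_deriv)
    also have "\<dots> = dir_deriv v (\<lambda>x. \<Sum>b\<in>Basis. dir_deriv b (dir_deriv b p) x) x"
      by (subst dir_deriv_sum) (auto intro: p(1))
    also have "(\<lambda>x. \<Sum>b\<in>Basis. dir_deriv b (dir_deriv b p) x) = laplacian p"
      by (intro ext laplacian_eq_dir_deriv[OF p(1), symmetric])
    finally show ?thesis .
  qed
  then show ?thesis
    unfolding harmonic_polynomial_iff
    using homogeneous_dir_deriv[OF p(1,2)] p by auto
qed

text \<open>
  For harmonic \<open>p\<close> and \<open>q\<close>, \<open>integral_green\<close> evaluates the integral of \<open>\<nabla> p \<cdot> \<nabla> q\<close> in two ways, with
  factors \<open>e (d + e + n - 2)\<close> and \<open>d (d + e + n - 2)\<close>.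
\<close>

lemma harmonic_polynomials_orthogonal:
  fixes p q :: "real^'n \<Rightarrow> real"
  assumes n: "2 \<le> CARD('n)" and "d \<noteq> e" and p: "harmonic_polynomial d p" and q: "harmonic_polynomial e q"
  shows "(LINT x|sphere_measure. p x * q x) = 0"
proof -
  interpret rotation_invariant_sphere "sphere_measure :: (real^'n) measure" Basis
    by (rule rotation_invariant_sphere_measure)
  have p': "real_polynomial_function p" "homogeneous d p" and q': "real_polynomial_function q" "homogeneous e q"
    using p q by (auto simp: harmonic_polynomial_iff)
  have 0: "(\<Sum>b\<in>Basis. dir_deriv b (dir_deriv b p) x) = 0" "(\<Sum>b\<in>Basis. dir_deriv b (dir_deriv b q) x) = 0" for x
    using p q by (simp_all add: harmonic_polynomial_iff laplacian_eq_dir_deriv[symmetric])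
  define I where "I = (LINT x|sphere_measure. p x * q x)"
  have "real e * (real d + real e + real CARD('n) - 2) * I
      = (LINT x|sphere_measure. (\<Sum>b\<in>Basis. dir_deriv b p x * dir_deriv b q x))"
    using integral_green[OF p' q'] by (simp add: 0 I_def)
  also have "\<dots> = real d * (real d + real e + real CARD('n) - 2) * I"
    using integral_green[OF q' p'] by (simp add: 0 I_def mult.commute[of "q _"] mult.commute[of "dir_deriv _ q _"] algebra_simps)
  finally have "(real e - real d) * ((real d + real e + real CARD('n) - 2) * I) = 0"
    by (simp add: algebra_simps)
  moreover have "real d + real e + real CARD('n) - 2 > 0"
    using n \<open>d \<noteq> e\<close> by linarith
  ultimately show ?thesis using \<open>d \<noteq> e\<close> by (simp add: I_def)
qed

text \<open>
  Closed form for even \<open>d\<close>: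
  \<open>(-1) ^ (d div 2) * (1 * 3 * \<dots> * (d - 1)) / ((n - 1) * (n + 1) * \<dots> * (n + d - 3))\<close>.
\<close>

fun funk_multiplier :: "real \<Rightarrow> nat \<Rightarrow> real" where
  "funk_multiplier n 0 = 1"
| "funk_multiplier n (Suc 0) = 0"
| "funk_multiplier n (Suc (Suc m)) = - (real m + 1) / (real m + n - 1) * funk_multiplier n m"

text \<open>
  Let \<open>q\<close> be harmonic of degree \<open>m + 2\<close>.  In an orthonormal basis containing \<open>u\<close>, the Laplacian
  of \<open>q\<close> along the hyperplane orthogonal to \<open>u\<close> is minus the second derivative \<open>q2\<close> of \<open>q\<close> in direction \<open>u\<close>.
  So \<open>integral_green\<close> on the subsphere, with the constant 1 as the other factor, expresses the average
  of \<open>q\<close> by that of \<open>q2\<close>.  The latter is harmonic of degree \<open>m\<close>, and Euler's identity at \<open>u\<close> computes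
  \<open>q2 u\<close> from \<open>q u\<close>.
\<close>

lemma subsphere_average_harmonic:
  fixes u :: "real^'n"
  assumes n: "3 \<le> CARD('n)" and u: "norm u = 1" and q: "harmonic_polynomial d q"
  shows "subsphere_average q u = funk_multiplier (real CARD('n)) d * q u"
proof -
  obtain B where B: "pairwise orthogonal (insert u B)" "\<And>b. b \<in> insert u B \<Longrightarrow> norm b = 1"
    "u \<notin> B" "finite B" "span B = {x. u \<bullet> x = 0}" "span (insert u B) = UNIV"
    and card: "card B = CARD('n) - 1"
    using orthogonal_complement_basis[OF u] by (metis DIM_cart DIM_real mult_1_right)
  have B': "pairwise orthogonal B" "\<And>b. b \<in> B \<Longrightarrow> norm b = 1"
    using B(1,2) by (auto simp: pairwise_insert)
  interpret rotation_invariant_sphere "subsphere_measure u" B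
    by (rule rotation_invariant_subsphere_measure) (use n u B' B(5) in auto)
  have green: "(LINT x|subsphere_measure u. (\<Sum>b\<in>B. dir_deriv b (dir_deriv b q) x))
      = real e * (real e + real CARD('n) - 3) * subsphere_average q u"
    if "real_polynomial_function q" "homogeneous e q" for e q
    using integral_green[OF real_polynomial_function.intros(2)[of 1] _ that, of 0] n
    by (simp add: homogeneous_def subsphere_average_def card of_nat_diff algebra_simps)
  show ?thesis using q
  proof (induction d arbitrary: q rule: induct_nat_012)
    case 0
    then have "q x = q u" for x using homogeneous_0_const by (auto simp: harmonic_polynomial_iff)
    then have "expectation q = expectation (\<lambda>x. q u)"
      by (intro Bochner_Integration.integral_cong refl)
    then show ?case by (simp add: subsphere_average_def prob_space)
  next
    case 1
    then have q: "real_polynomial_function q" "homogeneous 1 q" by (auto simp: harmonic_polynomial_iff)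
    have "dir_deriv b (dir_deriv b q) x = 0" for b x
      using dir_deriv_twice_eq_0_if_degree_less_2[OF q] by simp
    then have "(real CARD('n) - 2) * subsphere_average q u = 0"
      using green[OF q] by simp
    then show ?case using n by simp
  next
    case (ge2 m)
    have q: "real_polynomial_function q" "homogeneous (Suc (Suc m)) q" "\<And>x. laplacian q x = 0"
      using ge2.prems by (auto simp: harmonic_polynomial_iff)
    define q1 where "q1 = dir_deriv u q"
    have q1: "real_polynomial_function q1" "homogeneous (Suc m) q1"
      using q homogeneous_dir_deriv[OF q(1,2), of u] by (auto simp: q1_def)
    define q2 where "q2 = dir_deriv u q1"
    have "harmonic_polynomial (Suc (Suc m) - 1 - 1) q2"
      unfolding q2_def q1_def by (intro harmonic_polynomial_dir_deriv ge2.prems)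
    then have IH: "subsphere_average q2 u = funk_multiplier (real CARD('n)) m * q2 u"
      using ge2.IH(1) by simp
    have q2u: "q2 u = (real m + 1) * ((real m + 2) * q u)"
      using euler_homogeneous[OF q1] euler_homogeneous[OF q(1,2)] by (simp add: q2_def q1_def add.commute)
    have "(\<Sum>b\<in>B. dir_deriv b (dir_deriv b q) x) = - q2 x" for x
      using laplacian_orthonormal_basis[OF q(1) B(1,2) _ B(6), of x] q(3)[of x] B(3,4)
      by (simp add: q2_def q1_def)
    then have "(real m + 2) * (real m + real CARD('n) - 1) * subsphere_average q u = - subsphere_average q2 u"
      using green[OF q(1,2)] by (simp add: subsphere_average_def algebra_simps)
    also have "\<dots> = (real m + 2) * (- (real m + 1) * funk_multiplier (real CARD('n)) m * q u)"
      by (simp add: IH q2u algebra_simps)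
    finally have "(real m + real CARD('n) - 1) * subsphere_average q u
        = - (real m + 1) * funk_multiplier (real CARD('n)) m * q u"
      by (simp add: mult.assoc)
    then show ?case using n by (simp add: field_simps)
  qed
qed

lemma abs_funk_multiplier_Suc_Suc:
  assumes "2 \<le> n"
  shows "\<bar>funk_multiplier n (Suc (Suc m))\<bar> \<le> \<bar>funk_multiplier n m\<bar>"
proof -
  have "\<bar>funk_multiplier n (Suc (Suc m))\<bar> = ((real m + 1) / (real m + n - 1)) * \<bar>funk_multiplier n m\<bar>"
    using assms by (simp add: abs_mult)
  also have "\<dots> \<le> 1 * \<bar>funk_multiplier n m\<bar>"
    using assms by (intro mult_right_mono) (auto simp: divide_le_eq)
  finally show ?thesis by simp
qed

lemma abs_funk_multiplier_le_1:
  assumes "2 \<le> n"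
  shows "\<bar>funk_multiplier n d\<bar> \<le> 1"
proof (induction d rule: induct_nat_012)
  case (ge2 m)
  then show ?case using abs_funk_multiplier_Suc_Suc[OF assms, of m] by linarith
qed auto

lemma funk_multiplier_4:
  assumes "2 \<le> n"
  shows "funk_multiplier n 4 = 3 / ((n - 1) * (n + 1))"
  using assms by (simp add: numeral_eq_Suc field_simps)

lemma abs_funk_multiplier_ge4:
  assumes "2 \<le> n" "4 \<le> d"
  shows "\<bar>funk_multiplier n d\<bar> \<le> 3 / ((n - 1) * (n + 1))"
proof -
  have "\<bar>funk_multiplier n (4 + k)\<bar> \<le> 3 / ((n - 1) * (n + 1))" for k
  proof (induction k rule: induct_nat_012)
    case 0
    then show ?case using funk_multiplier_4[OF assms(1)] assms(1) by simp
  next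
    case 1
    then show ?case using assms(1) by (simp add: numeral_eq_Suc)
  next
    case (ge2 k)
    then show ?case using abs_funk_multiplier_Suc_Suc[OF assms(1), of "4 + k"] by simp
  qed
  from this[of "d - 4"] assms(2) show ?thesis by simp
qed

section \<open>Completeness of the Hilbert space and density of continuous functions\<close>

lemma abs_L2_sphere_eqI:
  assumes "square_integrable f" "square_integrable g" "AE x in sphere_measure. f x = g x"
  shows "abs_L2_sphere f = abs_L2_sphere g"
  by (rule Quotient_rel_abs[OF Quotient_L2_sphere]) (simp add: L2_eq_def assms)

lemma L2_eq_self: "square_integrable f \<Longrightarrow> L2_eq f f"
  by (simp add: L2_eq_def)

lemma L2_sphere_cases:
  obtains f where "square_integrable f" "\<psi> = abs_L2_sphere f"
  using L2_sphere.abs_induct[of "\<lambda>\<psi>. \<exists>f. square_integrable f \<and> \<psi> = abs_L2_sphere f" \<psi>]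
  by (auto simp: L2_eq_def)

lemma zero_eq_abs_L2_sphere: "0 = abs_L2_sphere (\<lambda>x. 0)"
  by (simp add: zero_L2_sphere_def)

lemma abs_L2_sphere_add:
  assumes "square_integrable f" "square_integrable g"
  shows "abs_L2_sphere (\<lambda>x. f x + g x) = abs_L2_sphere f + abs_L2_sphere g"
  using plus_L2_sphere.abs_eq[OF L2_eq_self[OF assms(1)] L2_eq_self[OF assms(2)]] by simp

lemma abs_L2_sphere_scale:
  assumes "square_integrable f"
  shows "abs_L2_sphere (\<lambda>x. c * f x) = c *\<^sub>R abs_L2_sphere f"
  using scaleR_L2_sphere.abs_eq[OF L2_eq_self[OF assms]] by simp

lemma square_integrable_diff:
  assumes "square_integrable f" "square_integrable g"
  shows "square_integrable (\<lambda>x. f x - g x)"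
  using square_integrable_add[OF assms(1) square_integrable_scale[OF assms(2), of "-1"]] by simp

lemma abs_L2_sphere_diff:
  assumes "square_integrable f" "square_integrable g"
  shows "abs_L2_sphere (\<lambda>x. f x - g x) = abs_L2_sphere f - abs_L2_sphere g"
  using abs_L2_sphere_add[OF assms(1) square_integrable_scale[OF assms(2), of "-1"]]
    abs_L2_sphere_scale[OF assms(2), of "-1"] by simp

lemma inner_abs_L2_sphere:
  assumes "square_integrable f" "square_integrable g"
  shows "abs_L2_sphere f \<bullet> abs_L2_sphere g = (LINT x|sphere_measure. f x * g x)"
  using inner_L2_sphere.abs_eq[OF L2_eq_self[OF assms(1)] L2_eq_self[OF assms(2)]] .

lemma norm_abs_L2_sphere:
  assumes "square_integrable f"
  shows "(norm (abs_L2_sphere f))\<^sup>2 = (LINT x|sphere_measure. (f x)\<^sup>2)"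
proof -
  have "(norm (abs_L2_sphere f))\<^sup>2 = abs_L2_sphere f \<bullet> abs_L2_sphere f"
    by (rule power2_norm_eq_inner)
  also have "\<dots> = (LINT x|sphere_measure. (f x)\<^sup>2)"
    unfolding inner_abs_L2_sphere[OF assms assms] by (simp add: power2_eq_square)
  finally show ?thesis .
qed

lemma square_integrable_sum:
  assumes "\<And>i. i \<in> I \<Longrightarrow> square_integrable (f i)"
  shows "square_integrable (\<lambda>x. \<Sum>i\<in>I. f i x)"
  using assms
  by (induction I rule: infinite_finite_induct) (auto simp: square_integrable_zero square_integrable_add)

lemma abs_L2_sphere_sum:
  assumes "\<And>i. i \<in> I \<Longrightarrow> square_integrable (f i)"
  shows "abs_L2_sphere (\<lambda>x. \<Sum>i\<in>I. f i x) = (\<Sum>i\<in>I. abs_L2_sphere (f i))"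
  using assms
  by (induction I rule: infinite_finite_induct)
    (auto simp: zero_eq_abs_L2_sphere[symmetric] abs_L2_sphere_add square_integrable_sum)

lemma square_integrable_bound:
  assumes g: "square_integrable g" and f: "f \<in> borel_measurable sphere_measure"
    and le: "\<And>x. x \<in> sphere 0 1 \<Longrightarrow> \<bar>f x\<bar> \<le> \<bar>g x\<bar>"
  shows "square_integrable f"
  unfolding square_integrable_def
proof (intro conjI f)
  show "integrable sphere_measure (\<lambda>x. (f x)\<^sup>2)"
  proof (rule Bochner_Integration.integrable_bound)
    show "integrable sphere_measure (\<lambda>x. (g x)\<^sup>2)" using g by (simp add: square_integrable_def)
    show "AE x in sphere_measure. norm ((f x)\<^sup>2) \<le> norm ((g x)\<^sup>2)"
      using le by (intro AE_I2) (auto simp: abs_le_square_iff)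
  qed (use f in measurable)
qed

lemma square_integrable_const: "square_integrable (\<lambda>x::real^'n. c)"
proof -
  interpret prob_space "sphere_measure :: (real^'n) measure" by (rule prob_space_sphere_measure)
  show ?thesis by (simp add: square_integrable_def)
qed

lemma square_integrable_bounded:
  assumes "f \<in> borel_measurable sphere_measure" "\<And>x. x \<in> sphere 0 1 \<Longrightarrow> \<bar>f x\<bar> \<le> c"
  shows "square_integrable f"
  by (rule square_integrable_bound[OF square_integrable_const[of c] assms(1)
        order_trans[OF assms(2) abs_ge_self]])

lemma norm_abs_L2_sphere_le:
  assumes "f \<in> borel_measurable sphere_measure" "\<And>x::real^'n. x \<in> sphere 0 1 \<Longrightarrow> \<bar>f x\<bar> \<le> c"
  shows "norm (abs_L2_sphere f) \<le> c"
proof -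
  interpret prob_space "sphere_measure :: (real^'n) measure" by (rule prob_space_sphere_measure)
  obtain x0 :: "real^'n" where "x0 \<in> space sphere_measure" using not_empty by blast
  then have "x0 \<in> sphere 0 1" by simp
  then have c: "0 \<le> c" using assms(2)[of x0] by linarith
  have f: "square_integrable f" by (rule square_integrable_bounded[OF assms])
  have "(norm (abs_L2_sphere f))\<^sup>2 \<le> integral\<^sup>L (sphere_measure :: (real^'n) measure) (\<lambda>x. c\<^sup>2)"
    unfolding norm_abs_L2_sphere[OF f]
  proof (rule integral_mono)
    show "integrable sphere_measure (\<lambda>x. (f x)\<^sup>2)" using f by (simp add: square_integrable_def)
    show "(f x)\<^sup>2 \<le> c\<^sup>2" if "x \<in> space sphere_measure" for x
      using assms(2)[of x] that c by (intro abs_le_square_iff[THEN iffD1]) auto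
  qed simp
  then have "(norm (abs_L2_sphere f))\<^sup>2 \<le> c\<^sup>2" using prob_space by simp
  then show ?thesis by (rule power2_le_imp_le[OF _ c])
qed

lemma borel_measurable_sphere_continuous:
  assumes "continuous_on (sphere 0 1) f"
  shows "f \<in> borel_measurable sphere_measure"
proof -
  have "f \<in> borel_measurable (restrict_space borel (sphere 0 1))"
    using assms by (rule borel_measurable_continuous_on_restrict)
  then show ?thesis using measurable_cong_sets[OF sets_sphere_measure refl] by blast
qed

lemma square_integrable_continuous:
  fixes f :: "real^'n \<Rightarrow> real"
  assumes "continuous_on (sphere 0 1) f"
  shows "square_integrable f"
proof -
  have "bounded (f ` sphere 0 1)"
    using assms compact_imp_bounded compact_continuous_image compact_sphere by blast
  then obtain K where "\<forall>x\<in>sphere 0 1. norm (f x) \<le> K" unfolding bounded_iff by blast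
  then show ?thesis
    using borel_measurable_sphere_continuous[OF assms] by (intro square_integrable_bounded[of _ K]) auto
qed

text \<open>
  The integrand \<open>(f k - h)\<^sup>2\<close> is dominated by \<open>4 * g\<^sup>2\<close>.
\<close>

lemma L2_dominated_convergence:
  fixes f :: "nat \<Rightarrow> real^'n \<Rightarrow> real" and g h :: "real^'n \<Rightarrow> real"
  assumes g: "square_integrable g"
    and meas: "\<And>k. f k \<in> borel_measurable sphere_measure" "h \<in> borel_measurable sphere_measure"
    and bound: "\<And>k x. x \<in> sphere 0 1 \<Longrightarrow> \<bar>f k x\<bar> \<le> \<bar>g x\<bar>"
    and lim: "\<And>x. x \<in> sphere 0 1 \<Longrightarrow> (\<lambda>k. f k x) \<longlonglongrightarrow> h x"
  shows "(\<lambda>k. abs_L2_sphere (f k)) \<longlonglongrightarrow> abs_L2_sphere h"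
proof -
  have hb: "\<bar>h x\<bar> \<le> \<bar>g x\<bar>" if "x \<in> sphere 0 1" for x
    using tendsto_rabs[OF lim[OF that]] bound[OF that] by (intro LIMSEQ_le_const2) auto
  have sf: "square_integrable (f k)" for k by (rule square_integrable_bound[OF g meas(1) bound])
  have sh: "square_integrable h" by (rule square_integrable_bound[OF g meas(2) hb])
  have "(\<lambda>k. LINT x|sphere_measure. (f k x - h x)\<^sup>2) \<longlonglongrightarrow> integral\<^sup>L (sphere_measure :: (real^'n) measure) (\<lambda>x. 0)"
  proof (rule integral_dominated_convergence[where w = "\<lambda>x. 4 * (g x)\<^sup>2"])
    show "integrable sphere_measure (\<lambda>x. 4 * (g x)\<^sup>2)" using g by (simp add: square_integrable_def)
    show "AE x in sphere_measure. (\<lambda>k. (f k x - h x)\<^sup>2) \<longlonglongrightarrow> 0"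
    proof (rule AE_I2)
      fix x :: "real^'n" assume "x \<in> space sphere_measure"
      then have "(\<lambda>k. (f k x - h x)\<^sup>2) \<longlonglongrightarrow> (h x - h x)\<^sup>2" by (intro tendsto_intros lim) simp
      then show "(\<lambda>k. (f k x - h x)\<^sup>2) \<longlonglongrightarrow> 0" by simp
    qed
    show "AE x in sphere_measure. norm ((f k x - h x)\<^sup>2) \<le> 4 * (g x)\<^sup>2" for k
    proof (rule AE_I2)
      fix x :: "real^'n" assume x: "x \<in> space sphere_measure"
      then have "\<bar>f k x - h x\<bar> \<le> \<bar>2 * g x\<bar>" using bound[of x k] hb[of x] by auto
      then have "(f k x - h x)\<^sup>2 \<le> (2 * g x)\<^sup>2" by (simp only: abs_le_square_iff)
      then show "norm ((f k x - h x)\<^sup>2) \<le> 4 * (g x)\<^sup>2" by (simp add: power_mult_distrib)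
    qed
  qed (use meas in measurable)
  then have "(\<lambda>k. (norm (abs_L2_sphere (f k) - abs_L2_sphere h))\<^sup>2) \<longlonglongrightarrow> 0"
    by (simp add: abs_L2_sphere_diff[symmetric] norm_abs_L2_sphere square_integrable_diff sf sh)
  then have "(\<lambda>k. sqrt ((norm (abs_L2_sphere (f k) - abs_L2_sphere h))\<^sup>2)) \<longlonglongrightarrow> sqrt 0"
    by (rule tendsto_real_sqrt)
  then have "(\<lambda>k. norm (abs_L2_sphere (f k) - abs_L2_sphere h)) \<longlonglongrightarrow> 0" by simp
  then show ?thesis by (rule LIM_zero_cancel[OF tendsto_norm_zero_cancel])
qed

text \<open>
  Density of the continuous functions, stated for an arbitrary closed subspace \<open>W\<close>.  It contains the
  indicators of closed sets, as these are limits of continuous functions of the distance to the set;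
  hence those of Borel sets, since the closed sets form an intersection-stable generator and the sets
  with indicator in \<open>W\<close> form a Dynkin system; hence all simple functions and their dominated limits.
\<close>

lemma in_closed_subspace_if_contains_continuous:
  fixes W :: "'n::finite L2_sphere set"
  assumes W: "closed W" "subspace W"
    and cont: "\<And>f. continuous_on (sphere 0 1) f \<Longrightarrow> abs_L2_sphere f \<in> W"
  shows "\<psi> \<in> W"
proof -
  interpret prob_space "sphere_measure :: (real^'n) measure" by (rule prob_space_sphere_measure)
  have sets_sphere: "A \<in> sets borel" if "A \<in> sets sphere_measure" for A :: "(real^'n) set"
    using that by (auto simp: sets_sphere_measure sets_restrict_space)
  have ind_meas [measurable]: "(indicator A :: real^'n \<Rightarrow> real) \<in> borel_measurable sphere_measure"
    if "A \<in> sets borel" for A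
  proof -
    have "(indicator A :: real^'n \<Rightarrow> real) \<in> borel_measurable (restrict_space borel (sphere 0 1))"
      using that by (intro measurable_restrict_space1 borel_measurable_indicator)
    then show ?thesis using measurable_cong_sets[OF sets_sphere_measure refl] by blast
  qed
  have ind_si: "square_integrable (indicator A :: real^'n \<Rightarrow> real)" if "A \<in> sets borel" for A
    using that by (intro square_integrable_bounded[of _ 1]) (auto simp: indicator_def)
  have limW: "\<phi> \<in> W" if "\<And>k. F k \<in> W" "F \<longlonglongrightarrow> \<phi>" for F :: "nat \<Rightarrow> 'n L2_sphere" and \<phi>
    using closed_sequentially[OF W(1)] that by blast
  have "(indicator {} :: real^'n \<Rightarrow> real) = (\<lambda>x. 0)" by (rule ext) simp
  then have empty: "abs_L2_sphere (indicator {} :: real^'n \<Rightarrow> real) \<in> W"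
    using subspace_0[OF W(2)] by (simp add: zero_eq_abs_L2_sphere[symmetric])
  have stable: "Int_stable (Collect closed :: (real^'n) set set)" by (auto simp: Int_stable_def)
  have sub: "Collect closed \<subseteq> Pow (UNIV :: (real^'n) set)" by simp
  have dynkin: "abs_L2_sphere (indicator A) \<in> W" if "A \<in> sigma_sets UNIV (Collect closed)"
    for A :: "(real^'n) set"
    using stable sub that
  proof (induction A rule: sigma_sets_induct_disjoint)
    fix A :: "(real^'n) set" assume "A \<in> Collect closed"
    then have A: "closed A" by simp
    show "abs_L2_sphere (indicator A) \<in> W"
    proof (cases "A = {}")
      case True
      then show ?thesis using empty by simp
    next
      case False
      define f where "f k x = max 0 (1 - real k * infdist x A)" for k x
      have f: "continuous_on (sphere 0 1) (f k)" for k
        unfolding f_def by (intro continuous_intros)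
      have "(\<lambda>k. abs_L2_sphere (f k)) \<longlonglongrightarrow> abs_L2_sphere (indicator A)"
      proof (rule L2_dominated_convergence[OF square_integrable_const[of 1]])
        show "(\<lambda>k. f k x) \<longlonglongrightarrow> indicator A x" for x
        proof (cases "x \<in> A")
          case True then show ?thesis by (simp add: f_def)
        next
          case notin: False
          then have d: "0 < infdist x A"
            using in_closed_iff_infdist_zero[OF A False, of x] infdist_nonneg[of x A] by linarith
          obtain N where N: "1 < real N * infdist x A" using reals_Archimedean3[OF d] by blast
          have "f k x = 0" if "N \<le> k" for k
          proof -
            have "real N * infdist x A \<le> real k * infdist x A" using that d by (intro mult_right_mono) auto
            then show ?thesis using N by (simp add: f_def)
          qed
          then have "eventually (\<lambda>k. f k x = 0) sequentially" by (auto simp: eventually_sequentially)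
          then show ?thesis using notin by (simp add: tendsto_eventually)
        qed
        show "\<bar>f k x\<bar> \<le> \<bar>1\<bar>" for k x
          using infdist_nonneg[of x A] by (simp add: f_def)
      qed (use A f borel_measurable_sphere_continuous ind_meas borel_closed in auto)
      then show ?thesis by (rule limW[OF cont[OF f]])
    qed
  next
    show "abs_L2_sphere (indicator {}) \<in> W" by (rule empty)
  next
    fix A :: "(real^'n) set" assume A: "A \<in> sigma_sets UNIV (Collect closed)"
      and IH: "abs_L2_sphere (indicator A) \<in> W"
    have "A \<in> sets borel" using A by (simp add: borel_eq_closed)
    then have "abs_L2_sphere (indicator (UNIV - A)) = abs_L2_sphere (\<lambda>x. 1) - abs_L2_sphere (indicator A)"
      by (subst abs_L2_sphere_diff[symmetric]) (auto simp: square_integrable_const ind_si indicator_def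
         intro!: arg_cong[of _ _ abs_L2_sphere])
    then show "abs_L2_sphere (indicator (UNIV - A)) \<in> W"
      using subspace_diff[OF W(2) cont IH, of "\<lambda>x. 1"] by simp
  next
    fix A :: "nat \<Rightarrow> (real^'n) set"
    assume disj: "disjoint_family A" and A: "range A \<subseteq> sigma_sets UNIV (Collect closed)"
      and IH: "\<And>i. abs_L2_sphere (indicator (A i)) \<in> W"
    have Ab: "A i \<in> sets borel" for i using A by (auto simp: borel_eq_closed)
    have fin: "abs_L2_sphere (indicator (\<Union>i<k. A i)) \<in> W" for k :: nat
    proof -
      have "(indicator (\<Union>i<k. A i) :: real^'n \<Rightarrow> real) = (\<lambda>x. \<Sum>i<k. indicator (A i) x)"
        using disj by (intro ext indicator_UN_disjoint) (auto simp: disjoint_family_on_def)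
      then show ?thesis
        using subspace_sum[OF W(2), of "{..<k}" "\<lambda>i. abs_L2_sphere (indicator (A i))"] IH
        by (simp add: abs_L2_sphere_sum ind_si Ab)
    qed
    have "(\<lambda>k. abs_L2_sphere (indicator (\<Union>i<k. A i))) \<longlonglongrightarrow> abs_L2_sphere (indicator (\<Union>i. A i))"
    proof (rule L2_dominated_convergence[OF square_integrable_const[of 1]])
      show "\<bar>indicator (\<Union>i<k. A i) x\<bar> \<le> \<bar>1::real\<bar>" for k and x :: "real^'n"
        by (simp add: indicator_def)
      show "(indicator (\<Union>i<k. A i) :: real^'n \<Rightarrow> real) \<in> borel_measurable sphere_measure" for k :: nat
        using Ab by (intro ind_meas) auto
      show "(indicator (\<Union>i. A i) :: real^'n \<Rightarrow> real) \<in> borel_measurable sphere_measure"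
        using Ab by (intro ind_meas) auto
    qed (rule LIMSEQ_indicator_UN)
    then show "abs_L2_sphere (indicator (\<Union>i. A i)) \<in> W" by (rule limW[OF fin])
  qed
  have indW: "abs_L2_sphere (indicator A) \<in> W" if "A \<in> sets borel" for A :: "(real^'n) set"
  proof (rule dynkin)
    have "sets (borel :: (real^'n) measure) = sigma_sets UNIV (Collect closed)"
      unfolding borel_eq_closed by (rule sets_measure_of[OF sub])
    then show "A \<in> sigma_sets UNIV (Collect closed)" using that by blast
  qed
  have simpleW: "abs_L2_sphere s \<in> W" if s: "simple_function sphere_measure s" for s :: "real^'n \<Rightarrow> real"
  proof -
    let ?A = "\<lambda>y. s -` {y} \<inter> sphere 0 1"
    have A: "?A y \<in> sets borel" for y
      using sets_sphere[OF simple_functionD(2)[OF s, of "{y}"]] by (simp only: space_sphere_measure)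
    have "abs_L2_sphere s = abs_L2_sphere (\<lambda>x. \<Sum>y\<in>s ` sphere 0 1. y * indicator (?A y) x)"
    proof (rule abs_L2_sphere_eqI)
      have "finite (s ` sphere 0 1)" using simple_functionD(1)[OF s] by simp
      then have "bounded (s ` sphere 0 1)" by (rule finite_imp_bounded)
      then obtain K where "\<forall>x\<in>sphere 0 1. norm (s x) \<le> K" unfolding bounded_iff by blast
      then show "square_integrable s"
        using borel_measurable_simple_function[OF s] by (intro square_integrable_bounded[of _ K]) auto
      show "square_integrable (\<lambda>x. \<Sum>y\<in>s ` sphere 0 1. y * indicator (?A y) x)"
        by (intro square_integrable_sum square_integrable_scale ind_si A)
      show "AE x in sphere_measure. s x = (\<Sum>y\<in>s ` sphere 0 1. y * indicator (?A y) x)"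
        by (intro AE_I2 trans[OF simple_function_indicator_representation_banach[OF s]])
          (simp_all add: mult.commute)
    qed
    also have "\<dots> = (\<Sum>y\<in>s ` sphere 0 1. y *\<^sub>R abs_L2_sphere (indicator (?A y)))"
      by (simp add: abs_L2_sphere_sum square_integrable_scale ind_si A abs_L2_sphere_scale)
    also have "\<dots> \<in> W" by (intro subspace_sum subspace_scale W(2) indW A)
    finally show ?thesis .
  qed
  obtain f where f: "square_integrable f" "\<psi> = abs_L2_sphere f" by (rule L2_sphere_cases)
  then have fm: "f \<in> borel_measurable sphere_measure" by (simp add: square_integrable_def)
  obtain s where s: "\<forall>i. simple_function sphere_measure (s i)"
    "\<forall>x\<in>space sphere_measure. (\<lambda>i. s i x) \<longlonglongrightarrow> f x"
    "\<forall>i. \<forall>x\<in>space sphere_measure. dist (s i x) 0 \<le> 2 * dist (f x) 0"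
    using borel_measurable_implies_sequence_metric[OF fm, of 0] by blast
  have "(\<lambda>i. abs_L2_sphere (s i)) \<longlonglongrightarrow> \<psi>"
    unfolding f(2)
  proof (rule L2_dominated_convergence[OF square_integrable_scale[OF f(1), of 2]])
    show "s i \<in> borel_measurable sphere_measure" for i
      using s(1) by (intro borel_measurable_simple_function) simp
    show "\<bar>s i x\<bar> \<le> \<bar>2 * f x\<bar>" if "x \<in> sphere 0 1" for i x
      using s(3)[rule_format, of x i] that by (simp add: abs_mult)
    show "(\<lambda>i. s i x) \<longlonglongrightarrow> f x" if "x \<in> sphere 0 1" for x
      using s(2)[rule_format, of x] that by simp
  qed (rule fm)
  then show ?thesis by (rule limW[OF simpleW[OF s(1)[rule_format]]])
qed

text \<open>
  Riesz--Fischer.  Along a subsequence with steps at most \<open>(1/2) ^ k\<close> the increments are summable in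
  \<open>L\<^sup>1\<close>, so the representatives converge almost everywhere; Fatou's lemma then shows that the
  pointwise limit is also the limit in norm.
\<close>

instance L2_sphere :: (finite) complete_space
proof
  fix X :: "nat \<Rightarrow> 'a L2_sphere" assume X: "Cauchy X"
  interpret prob_space "sphere_measure :: (real^'a) measure" by (rule prob_space_sphere_measure)
  have "\<exists>f. square_integrable f \<and> X n = abs_L2_sphere f" for n by (metis L2_sphere_cases)
  then obtain f where f: "\<And>n. square_integrable (f n)" "\<And>n. X n = abs_L2_sphere (f n)" by metis
  have "\<exists>N. \<forall>m\<ge>N. \<forall>n\<ge>N. norm (X m - X n) < (1/2) ^ k" for k :: nat
    using CauchyD[OF X, of "(1/2) ^ k"] by auto
  then obtain N where N: "\<And>k m n. N k \<le> m \<Longrightarrow> N k \<le> n \<Longrightarrow> norm (X m - X n) < (1/2) ^ k"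
    by metis
  \<comment> \<open>The summand \<open>k\<close> makes \<open>r\<close> strictly increasing, the sum keeps it at least \<open>N i\<close> for \<open>i \<le> k\<close>.\<close>
  define r where "r k = k + (\<Sum>i\<le>k. N i)" for k
  have r: "strict_mono r" by (intro strict_monoI_Suc) (simp add: r_def)
  have Nr: "N k \<le> r j" if "k \<le> j" for k j
    using member_le_sum[of k "{..j}" N] that by (simp add: r_def)
  define g where "g k = f (r k)" for k
  have g: "square_integrable (g k)" for k by (simp add: g_def f)
  have gm [measurable]: "g k \<in> borel_measurable sphere_measure" for k
    using g by (simp add: square_integrable_def)
  have norm_g: "norm (abs_L2_sphere (\<lambda>x. g j x - g k x)) \<le> (1/2) ^ k" if "k \<le> j" for j k
    using N[OF Nr[OF that] Nr[OF order_refl]] f by (simp add: g_def abs_L2_sphere_diff)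
  have L1: "(\<integral>\<^sup>+x. ennreal \<bar>g (Suc k) x - g k x\<bar> \<partial>sphere_measure) \<le> ennreal ((1/2) ^ k)" for k
  proof -
    let ?h = "\<lambda>x. \<bar>g (Suc k) x - g k x\<bar>"
    have d: "square_integrable (\<lambda>x. g (Suc k) x - g k x)" by (intro square_integrable_diff g)
    then have h: "square_integrable ?h" by (auto simp: square_integrable_def)
    have one: "square_integrable (\<lambda>x::real^'a. 1)" by (rule square_integrable_const)
    have int: "integrable sphere_measure ?h"
      using square_integrable_mult[OF h one] by simp
    have "(LINT x|sphere_measure. ?h x) = abs_L2_sphere ?h \<bullet> abs_L2_sphere (\<lambda>x. 1)"
      by (simp add: inner_abs_L2_sphere[OF h one])
    also have "\<dots> \<le> norm (abs_L2_sphere ?h) * norm (abs_L2_sphere (\<lambda>x::real^'a. 1))"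
      by (rule norm_cauchy_schwarz)
    also have "(norm (abs_L2_sphere (\<lambda>x::real^'a. 1)))\<^sup>2 = 1"
      using prob_space by (simp add: norm_abs_L2_sphere[OF one])
    then have "norm (abs_L2_sphere (\<lambda>x::real^'a. 1)) = 1"
      by (simp add: power2_eq_1_iff) (smt (verit) norm_ge_zero)
    also have "(norm (abs_L2_sphere ?h))\<^sup>2 = (norm (abs_L2_sphere (\<lambda>x. g (Suc k) x - g k x)))\<^sup>2"
      by (simp add: norm_abs_L2_sphere[OF h] norm_abs_L2_sphere[OF d])
    then have "norm (abs_L2_sphere ?h) = norm (abs_L2_sphere (\<lambda>x. g (Suc k) x - g k x))"
      by (simp add: power2_eq_iff_nonneg)
    finally have "(LINT x|sphere_measure. ?h x) \<le> (1/2) ^ k"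
      using norm_g[of k "Suc k"] by simp
    then show ?thesis using int by (simp add: nn_integral_eq_integral)
  qed
  have "(\<integral>\<^sup>+x. (\<Sum>k. ennreal \<bar>g (Suc k) x - g k x\<bar>) \<partial>sphere_measure)
      = (\<Sum>k. \<integral>\<^sup>+x. ennreal \<bar>g (Suc k) x - g k x\<bar> \<partial>sphere_measure)"
    by (rule nn_integral_suminf) measurable
  also have "\<dots> \<le> (\<Sum>k. ennreal ((1/2) ^ k))" by (intro suminf_le L1 summableI)
  also have "\<dots> < \<infinity>"
    by (subst suminf_ennreal2) (auto intro!: summable_geometric)
  finally have "AE x in sphere_measure. (\<Sum>k. ennreal \<bar>g (Suc k) x - g k x\<bar>) \<noteq> \<infinity>"
    by (intro nn_integral_PInf_AE) auto
  then have conv: "AE x in sphere_measure. (\<lambda>k. g k x) \<longlonglongrightarrow> lim (\<lambda>k. g k x)"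
  proof eventually_elim
    case (elim x)
    then have "summable (\<lambda>k. \<bar>g (Suc k) x - g k x\<bar>)"
      by (intro summable_suminf_not_top) auto
    then have "summable (\<lambda>k. g (Suc k) x - g k x)" by (rule summable_rabs_cancel)
    then have "convergent (\<lambda>n. g 0 x + (\<Sum>k<n. g (Suc k) x - g k x))"
      by (intro convergent_add convergent_const) (simp add: summable_iff_convergent)
    moreover have "(\<lambda>n. g 0 x + (\<Sum>k<n. g (Suc k) x - g k x)) = (\<lambda>n. g n x)"
      by (simp add: sum_lessThan_telescope[of "\<lambda>k. g k x"])
    ultimately show ?case by (simp add: convergent_LIMSEQ_iff)
  qed
  define h where "h x = lim (\<lambda>k. g k x)" for x
  have hm [measurable]: "h \<in> borel_measurable sphere_measure" unfolding h_def by measurable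
  have fatou: "(\<integral>\<^sup>+x. ennreal ((h x - g k x)\<^sup>2) \<partial>sphere_measure) \<le> ennreal (((1/2) ^ k)\<^sup>2)" for k
  proof -
    have "(\<integral>\<^sup>+x. ennreal ((h x - g k x)\<^sup>2) \<partial>sphere_measure)
        = (\<integral>\<^sup>+x. liminf (\<lambda>j. ennreal ((g j x - g k x)\<^sup>2)) \<partial>sphere_measure)"
    proof (rule nn_integral_cong_AE)
      show "AE x in sphere_measure. ennreal ((h x - g k x)\<^sup>2) = liminf (\<lambda>j. ennreal ((g j x - g k x)\<^sup>2))"
        using conv
      proof eventually_elim
        case (elim x)
        then have "(\<lambda>j. ennreal ((g j x - g k x)\<^sup>2)) \<longlonglongrightarrow> ennreal ((h x - g k x)\<^sup>2)"
          unfolding h_def by (intro tendsto_intros)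
        then show ?case using lim_imp_Liminf by (metis sequentially_bot)
      qed
    qed
    also have "\<dots> \<le> liminf (\<lambda>j. \<integral>\<^sup>+x. ennreal ((g j x - g k x)\<^sup>2) \<partial>sphere_measure)"
      by (rule nn_integral_liminf) measurable
    also have "\<dots> \<le> ennreal (((1/2) ^ k)\<^sup>2)"
    proof (rule Liminf_le)
      show "\<forall>\<^sub>F j in sequentially. (\<integral>\<^sup>+x. ennreal ((g j x - g k x)\<^sup>2) \<partial>sphere_measure) \<le> ennreal (((1/2) ^ k)\<^sup>2)"
      proof (rule eventually_sequentiallyI[of k])
        fix j assume kj: "k \<le> j"
        have d: "square_integrable (\<lambda>x. g j x - g k x)" by (intro square_integrable_diff g)
        then have "(\<integral>\<^sup>+x. ennreal ((g j x - g k x)\<^sup>2) \<partial>sphere_measure)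
            = ennreal ((norm (abs_L2_sphere (\<lambda>x. g j x - g k x)))\<^sup>2)"
          by (simp add: norm_abs_L2_sphere nn_integral_eq_integral square_integrable_def)
        also have "\<dots> \<le> ennreal (((1/2) ^ k)\<^sup>2)"
          by (intro ennreal_leI power_mono norm_g kj) simp
        finally show "(\<integral>\<^sup>+x. ennreal ((g j x - g k x)\<^sup>2) \<partial>sphere_measure) \<le> ennreal (((1/2) ^ k)\<^sup>2)" .
      qed
    qed simp
    finally show ?thesis .
  qed
  have hg: "square_integrable (\<lambda>x. h x - g k x)" for k
    unfolding square_integrable_def
    using fatou[of k] by (auto intro!: integrableI_bounded order.strict_trans1[OF fatou[of k]])
  have h: "square_integrable h" using square_integrable_add[OF hg[of 0] g[of 0]] by simp
  have "norm (abs_L2_sphere h - X (r k)) \<le> (1/2) ^ k" for k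
  proof -
    have "ennreal ((norm (abs_L2_sphere (\<lambda>x. h x - g k x)))\<^sup>2) \<le> ennreal (((1/2) ^ k)\<^sup>2)"
      using fatou[of k] hg[of k]
      by (simp add: norm_abs_L2_sphere nn_integral_eq_integral square_integrable_def)
    then have "(norm (abs_L2_sphere (\<lambda>x. h x - g k x)))\<^sup>2 \<le> ((1/2) ^ k)\<^sup>2" by simp
    then have "norm (abs_L2_sphere (\<lambda>x. h x - g k x)) \<le> (1/2) ^ k"
      by (rule power2_le_imp_le) simp
    then show ?thesis using f h g by (simp add: abs_L2_sphere_diff g_def)
  qed
  then have close: "norm (X (r k) - abs_L2_sphere h) \<le> (1/2) ^ k" for k
    by (simp add: norm_minus_commute)
  have "(\<lambda>k. (1/2::real) ^ k) \<longlonglongrightarrow> 0" by (rule LIMSEQ_realpow_zero) auto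
  then have "(\<lambda>k. X (r k) - abs_L2_sphere h) \<longlonglongrightarrow> 0"
    by (rule Lim_null_comparison[OF always_eventually[OF allI[OF close]]])
  then have "(X \<circ> r) \<longlonglongrightarrow> abs_L2_sphere h"
    unfolding o_def by (rule LIM_zero_cancel)
  from Cauchy_converges_subseq[OF X r this] show "convergent X"
    unfolding convergent_def by (rule exI)
qed

section \<open>Multiplier operators for orthogonal families of subspaces\<close>

lemma limit_in_closure:
  fixes x :: "'a::metric_space"
  assumes "\<And>n::nat. X n \<in> S" "X \<longlonglongrightarrow> x"
  shows "x \<in> closure S"
  unfolding closure_sequential by (intro exI[of _ X] conjI allI assms)

lemma subspace_closure:
  fixes S :: "'a::real_normed_vector set"
  assumes "subspace S"
  shows "subspace (closure S)"
proof (rule subspaceI)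
  show "0 \<in> closure S" by (rule subsetD[OF closure_subset subspace_0[OF assms]])
next
  fix x y assume "x \<in> closure S" "y \<in> closure S"
  then obtain X Y where X: "\<And>n. X n \<in> S" "X \<longlonglongrightarrow> x" and Y: "\<And>n. Y n \<in> S" "Y \<longlonglongrightarrow> y"
    unfolding closure_sequential by auto
  show "x + y \<in> closure S"
    by (rule limit_in_closure[OF _ tendsto_add[OF X(2) Y(2)]])
      (rule subspace_add[OF assms X(1) Y(1)])
next
  fix c x assume "x \<in> closure S"
  then obtain X where X: "\<And>n. X n \<in> S" "X \<longlonglongrightarrow> x"
    unfolding closure_sequential by auto
  show "c *\<^sub>R x \<in> closure S"
    by (rule limit_in_closure[OF _ tendsto_scaleR[OF tendsto_const X(2)]])
      (rule subspace_scale[OF assms X(1)])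
qed

text \<open>
  A densely defined operator is given here by its graph \<open>G\<close>.  The norm bound passes to the closure of
  \<open>G\<close>, which makes the closure single-valued, and completeness of the target makes it defined
  everywhere.
\<close>

lemma bounded_linear_extension:
  fixes G :: "('a::real_normed_vector \<times> 'b::{real_normed_vector,complete_space}) set"
  assumes sub: "subspace G" and bound: "\<And>x y. (x, y) \<in> G \<Longrightarrow> norm y \<le> C * norm x"
    and dense: "closure (fst ` G) = UNIV"
  obtains T where "bounded_linear T" "\<And>x. norm (T x) \<le> C * norm x" "\<And>x y. (x, y) \<in> G \<Longrightarrow> T x = y"
proof -
  let ?K = "closure G"
  have K: "subspace ?K" using sub by (rule subspace_closure)
  have bK: "norm y \<le> C * norm x" if "(x, y) \<in> ?K" for x y
  proof -
    have "closed {z :: 'a \<times> 'b. norm (snd z) \<le> C * norm (fst z)}"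
      by (intro closed_Collect_le continuous_intros)
    then have "?K \<subseteq> {z. norm (snd z) \<le> C * norm (fst z)}"
      using bound by (intro closure_minimal) auto
    then show ?thesis using that by auto
  qed
  have uniq: "y = y'" if "(x, y) \<in> ?K" "(x, y') \<in> ?K" for x y y'
    using bK[of 0 "y - y'"] subspace_diff[OF K that] by simp
  have ex: "\<exists>y. (x, y) \<in> ?K" for x
  proof -
    have "x \<in> closure (fst ` G)" using dense by simp
    then obtain X where X: "\<And>n. X n \<in> fst ` G" "X \<longlonglongrightarrow> x"
      unfolding closure_sequential by auto
    then have "\<forall>n. \<exists>y. (X n, y) \<in> G" by force
    then obtain Y where Y: "\<And>n. (X n, Y n) \<in> G" by metis
    have "Cauchy Y"
    proof (rule metric_CauchyI)
      fix e :: real assume e: "0 < e"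
      have "Cauchy X" using X(2) LIMSEQ_imp_Cauchy by blast
      then obtain M where M: "\<And>m n. M \<le> m \<Longrightarrow> M \<le> n \<Longrightarrow> dist (X m) (X n) < e / (\<bar>C\<bar> + 1)"
        using metric_CauchyD[of X "e / (\<bar>C\<bar> + 1)"] e by (auto simp: add_nonneg_pos)
      show "\<exists>M. \<forall>m\<ge>M. \<forall>n\<ge>M. dist (Y m) (Y n) < e"
      proof (intro exI[of _ M] allI impI)
        fix m n assume mn: "M \<le> m" "M \<le> n"
        have "norm (Y m - Y n) \<le> C * norm (X m - X n)"
          using subspace_diff[OF sub Y[of m] Y[of n]] bound by auto
        also have "\<dots> \<le> (\<bar>C\<bar> + 1) * norm (X m - X n)"
          by (intro mult_right_mono) auto
        also have "\<dots> < e"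
          using M[OF mn] e by (simp add: dist_norm field_simps)
        finally show "dist (Y m) (Y n) < e" by (simp add: dist_norm)
      qed
    qed
    then obtain y where "Y \<longlonglongrightarrow> y" using Cauchy_convergent convergent_def by blast
    then have "(\<lambda>n. (X n, Y n)) \<longlonglongrightarrow> (x, y)" by (intro tendsto_Pair X)
    with Y show ?thesis
      by (intro exI[of _ y] limit_in_closure[of "\<lambda>n. (X n, Y n)"])
  qed
  define T where "T x = (SOME y. (x, y) \<in> ?K)" for x
  have T: "(x, T x) \<in> ?K" for x unfolding T_def using ex by (rule someI_ex)
  have bT: "norm (T x) \<le> C * norm x" for x using bK T by blast
  have "bounded_linear T"
  proof
    show "T (x + y) = T x + T y" for x y
      using uniq[OF T] subspace_add[OF K T[of x] T[of y]] by simp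
    show "T (r *\<^sub>R x) = r *\<^sub>R T x" for r x
      using uniq[OF T] subspace_scale[OF K T[of x], of r] by simp
    show "\<exists>K. \<forall>x. norm (T x) \<le> norm x * K"
      using bT by (auto simp: mult.commute intro!: exI[of _ C])
  qed
  moreover have "T x = y" if "(x, y) \<in> G" for x y
    by (rule uniq[OF T subsetD[OF closure_subset that]])
  ultimately show ?thesis using bT by (intro that)
qed

locale orthogonal_subspaces =
  fixes H :: "nat \<Rightarrow> 'a::{real_inner,complete_space} set"
  assumes subspace_H: "subspace (H d)"
    and orth_H: "d \<noteq> e \<Longrightarrow> x \<in> H d \<Longrightarrow> y \<in> H e \<Longrightarrow> inner x y = 0"
    and dense_H: "closure (span (\<Union>d. H d)) = UNIV"
begin

lemma in_closed_subspace:
  assumes "closed W" "subspace W" "\<And>d. H d \<subseteq> W"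
  shows "x \<in> W"
proof -
  have "span (\<Union>d. H d) \<subseteq> W" using assms(2,3) by (intro span_minimal) auto
  then have "closure (span (\<Union>d. H d)) \<subseteq> W" using assms(1) by (intro closure_minimal)
  then show ?thesis using dense_H by auto
qed

lemma bounded_linear_eqI:
  assumes "bounded_linear S" "bounded_linear T" "\<And>d h. h \<in> H d \<Longrightarrow> S h = T h"
  shows "S x = T x"
proof -
  interpret D: bounded_linear "\<lambda>x. S x - T x" using assms(1,2) by (rule bounded_linear_sub)
  have "closed {x. S x - T x = 0}"
    by (intro closed_Collect_eq D.continuous_on continuous_intros)
  moreover have "subspace {x. S x - T x = 0}"
    using linear_subspace_kernel[OF D.linear] .
  ultimately have "x \<in> {x. S x - T x = 0}"
    using assms(3) by (intro in_closed_subspace) auto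
  then show ?thesis by simp
qed

text \<open>
  \<open>G\<close> is the graph of the operator on the finite sums of elements of the \<open>H d\<close>; by Pythagoras, its
  norm is at most \<open>C\<close>.
\<close>

lemma multiplier_exists:
  assumes m: "\<And>d. \<bar>m d\<bar> \<le> C"
  shows "\<exists>T. bounded_linear T \<and> (\<forall>x. norm (T x) \<le> C * norm x) \<and> (\<forall>d. \<forall>h\<in>H d. T h = m d *\<^sub>R h)"
proof -
  define G where "G = {(\<Sum>d\<le>N. h d, \<Sum>d\<le>N. m d *\<^sub>R h d) | N h. \<forall>d::nat. h d \<in> H d}"
  have H0: "0 \<in> H d" for d using subspace_H subspace_0 by blast
  have norm_sum: "(norm (\<Sum>d\<le>N. c d *\<^sub>R h d))\<^sup>2 = (\<Sum>d\<le>N. (c d)\<^sup>2 * (norm (h d))\<^sup>2)"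
    if "\<forall>d. h d \<in> H d" for N c and h :: "nat \<Rightarrow> 'a"
  proof -
    have "(norm (\<Sum>d\<le>N. c d *\<^sub>R h d))\<^sup>2 = (\<Sum>d\<le>N. (norm (c d *\<^sub>R h d))\<^sup>2)"
      using that by (intro norm_sum_Pythagorean)
       (auto simp: pairwise_def orthogonal_def orth_H)
    then show ?thesis by (simp add: power_mult_distrib)
  qed
  have bound: "norm y \<le> C * norm x" if "(x, y) \<in> G" for x y
  proof -
    from that obtain N h where h: "\<forall>d. h d \<in> H d" and x: "x = (\<Sum>d\<le>N. h d)"
      and y: "y = (\<Sum>d\<le>N. m d *\<^sub>R h d)" unfolding G_def by auto
    have C: "0 \<le> C" using m[of 0] by linarith
    have "(norm y)\<^sup>2 \<le> (\<Sum>d\<le>N. C\<^sup>2 * (norm (h d))\<^sup>2)"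
      unfolding y norm_sum[OF h] using m C
      by (intro sum_mono mult_right_mono abs_le_square_iff[THEN iffD1]) auto
    also have "\<dots> = (C * norm x)\<^sup>2"
      using norm_sum[OF h, of "\<lambda>_. 1" N] by (simp add: x power_mult_distrib sum_distrib_left)
    finally show ?thesis by (rule power2_le_imp_le) (simp add: C)
  qed
  have ext: "(\<Sum>d\<le>N. c d *\<^sub>R h d) = (\<Sum>d\<le>M. c d *\<^sub>R (if d \<le> N then h d else 0))"
    if "N \<le> M" for N M :: nat and c and h :: "nat \<Rightarrow> 'a"
    using that by (intro sum.mono_neutral_cong_left) auto
  have ext1: "(\<Sum>d\<le>N. h d) = (\<Sum>d\<le>M. if d \<le> N then h d else 0)"
    if "N \<le> M" for N M :: nat and h :: "nat \<Rightarrow> 'a"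
    using ext[OF that, of "\<lambda>_. 1"] by simp
  have sub: "subspace G"
  proof (rule subspaceI)
    show "0 \<in> G" unfolding G_def
      by (auto simp: zero_prod_def H0 intro!: exI[of _ 0] exI[of _ "\<lambda>_. 0"])
  next
    fix z w assume "z \<in> G" "w \<in> G"
    then obtain N h N' h' where h: "\<forall>d. h d \<in> H d" and z: "z = (\<Sum>d\<le>N. h d, \<Sum>d\<le>N. m d *\<^sub>R h d)"
      and h': "\<forall>d. h' d \<in> H d" and w: "w = (\<Sum>d\<le>N'. h' d, \<Sum>d\<le>N'. m d *\<^sub>R h' d)"
      unfolding G_def by auto
    define M where "M = max N N'"
    define k where "k d = (if d \<le> N then h d else 0) + (if d \<le> N' then h' d else 0)" for d
    have NM: "N \<le> M" "N' \<le> M" by (auto simp: M_def)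
    have "z + w = (\<Sum>d\<le>M. k d, \<Sum>d\<le>M. m d *\<^sub>R k d)"
      by (simp only: z w k_def ext[OF NM(1)] ext[OF NM(2)] ext1[OF NM(1)] ext1[OF NM(2)]
         add_Pair sum.distrib scaleR_right_distrib)
    moreover have "\<forall>d. k d \<in> H d"
      using h h' H0 by (auto simp: k_def subspace_add[OF subspace_H])
    ultimately show "z + w \<in> G" unfolding G_def by blast
  next
    fix c z assume "z \<in> G"
    then obtain N h where h: "\<forall>d. h d \<in> H d" and z: "z = (\<Sum>d\<le>N. h d, \<Sum>d\<le>N. m d *\<^sub>R h d)"
      unfolding G_def by auto
    have "c *\<^sub>R z = (\<Sum>d\<le>N. c *\<^sub>R h d, \<Sum>d\<le>N. m d *\<^sub>R (c *\<^sub>R h d))"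
      by (simp add: z scaleR_sum_right mult.commute)
    moreover have "\<forall>d. c *\<^sub>R h d \<in> H d" using h by (auto simp: subspace_scale[OF subspace_H])
    ultimately show "c *\<^sub>R z \<in> G"
      unfolding G_def by (auto intro!: exI[of _ N] exI[of _ "\<lambda>d. c *\<^sub>R h d"])
  qed
  have HG: "(h, m d *\<^sub>R h) \<in> G" if "h \<in> H d" for h d
  proof -
    define k where "k e = (if e = d then h else 0)" for e
    have "(\<Sum>e\<le>d. k e) = h" "(\<Sum>e\<le>d. m e *\<^sub>R k e) = m d *\<^sub>R h"
      by (simp_all add: k_def if_distrib[of "scaleR _"] cong: if_cong)
    then show ?thesis using that H0
      unfolding G_def by (auto simp: k_def intro!: exI[of _ d] exI[of _ k])
  qed
  have "H d \<subseteq> fst ` G" for d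
  proof
    fix h assume "h \<in> H d"
    then have "(h, m d *\<^sub>R h) \<in> G" by (rule HG)
    then show "h \<in> fst ` G" by (metis fst_conv imageI)
  qed
  moreover have "subspace (fst ` G)"
    by (rule linear_subspace_image[OF linear_fst sub])
  ultimately have "span (\<Union>d. H d) \<subseteq> fst ` G"
    by (intro span_minimal) auto
  then have dense: "closure (fst ` G) = UNIV"
    using closure_mono dense_H by blast
  show ?thesis
  proof (rule bounded_linear_extension[OF sub bound dense])
    fix T
    assume T: "bounded_linear T" "\<And>x. norm (T x) \<le> C * norm x" "\<And>x y. (x, y) \<in> G \<Longrightarrow> T x = y"
    show ?thesis using T(1,2) T(3)[OF HG] by (intro exI[of _ T]) simp
  qed
qed

text \<open>
  Both claims hold on each \<open>H d\<close>, and they are linear and closed conditions on \<open>x\<close> and \<open>w\<close>.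
\<close>

lemma orthogonal_projection_multiplier:
  assumes P: "bounded_linear P" and m: "\<And>d h. h \<in> H d \<Longrightarrow> P h = (if d \<in> D then h else 0)"
  shows "P x \<in> closure (span (\<Union>d\<in>D. H d))"
    and "w \<in> closure (span (\<Union>d\<in>D. H d)) \<Longrightarrow> inner (x - P x) w = 0"
proof -
  let ?W = "closure (span (\<Union>d\<in>D. H d))"
  interpret P: bounded_linear P by fact
  have W: "subspace ?W" by (intro subspace_closure subspace_span)
  have "closed (P -` ?W)"
    by (rule closed_vimage[OF closed_closure linear_continuous_on[OF P]])
  moreover have "subspace (P -` ?W)"
    using linear_subspace_vimage[OF P.linear W] .
  moreover have "H d \<subseteq> P -` ?W" for d
  proof
    fix h assume h: "h \<in> H d"
    show "h \<in> P -` ?W"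
    proof (cases "d \<in> D")
      case True
      then have "h \<in> span (\<Union>d\<in>D. H d)" using h by (intro span_base) auto
      then show ?thesis using m[OF h] True closure_subset by auto
    next
      case False
      then show ?thesis using m[OF h] subspace_0[OF W] by simp
    qed
  qed
  ultimately have "x \<in> P -` ?W" by (rule in_closed_subspace)
  then show "P x \<in> ?W" by simp
  have sub_right: "subspace {w. inner z w = 0}" for z :: 'a
    by (rule subspace_hyperplane)
  have base: "inner (x - P x) w = 0" if w: "w \<in> H e" "e \<in> D" for w e
  proof -
    have "subspace {x. inner (x - P x) w = 0}"
      by (auto intro!: subspaceI simp: P.zero P.add P.scaleR inner_add_left inner_diff_left)
    moreover have "closed {x. inner (x - P x) w = 0}"
      by (intro closed_Collect_eq P.continuous_on continuous_intros)
    moreover have "H d \<subseteq> {x. inner (x - P x) w = 0}" for d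
      using m[of _ d] w orth_H[of d e] by (cases "d = e") auto
    ultimately have "x \<in> {x. inner (x - P x) w = 0}" by (intro in_closed_subspace)
    then show ?thesis by simp
  qed
  have "?W \<subseteq> {w. inner (x - P x) w = 0}"
    using base by (intro closure_minimal span_minimal sub_right closed_hyperplane) auto
  then show "w \<in> ?W \<Longrightarrow> inner (x - P x) w = 0" by blast
qed

end

section \<open>Spectral resolution of the Funk transform and the projection\<close>

lemma square_integrable_polynomial:
  "real_polynomial_function p \<Longrightarrow> square_integrable p"
  by (intro square_integrable_continuous continuous_on_real_polynomial_function)

lemma harmonic_polynomial_add:
  "harmonic_polynomial d p \<Longrightarrow> harmonic_polynomial d q \<Longrightarrow> harmonic_polynomial d (\<lambda>x. p x + q x)"
  by (simp add: harmonic_polynomial_iff real_polynomial_function.intros(3) homogeneous_add laplacian_add)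

lemma harmonic_polynomial_cmult:
  "harmonic_polynomial d p \<Longrightarrow> harmonic_polynomial d (\<lambda>x. c * p x)"
  by (simp add: harmonic_polynomial_iff real_polynomial_function.intros(2,4) homogeneous_cmult laplacian_cmult)

lemma subspace_spherical_harmonics: "subspace (spherical_harmonics d :: 'n::finite L2_sphere set)"
proof (rule subspaceI)
  have "harmonic_polynomial d (\<lambda>x::real^'n. 0)"
    by (simp add: harmonic_polynomial_iff real_polynomial_function.intros(2) homogeneous_def
        laplacian_eq_dir_deriv)
  then show "0 \<in> (spherical_harmonics d :: 'n L2_sphere set)"
    unfolding spherical_harmonics_def zero_eq_abs_L2_sphere by blast
next
  fix \<phi> \<psi> :: "'n L2_sphere"
  assume "\<phi> \<in> spherical_harmonics d" "\<psi> \<in> spherical_harmonics d"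
  then obtain p q where pq: "harmonic_polynomial d p" "harmonic_polynomial d q"
    "\<phi> = abs_L2_sphere p" "\<psi> = abs_L2_sphere q" unfolding spherical_harmonics_def by blast
  then have "\<phi> + \<psi> = abs_L2_sphere (\<lambda>x. p x + q x)"
    by (simp add: abs_L2_sphere_add square_integrable_polynomial harmonic_polynomial_iff)
  then show "\<phi> + \<psi> \<in> spherical_harmonics d"
    unfolding spherical_harmonics_def using harmonic_polynomial_add[OF pq(1,2)] by blast
next
  fix c and \<phi> :: "'n L2_sphere"
  assume "\<phi> \<in> spherical_harmonics d"
  then obtain p where p: "harmonic_polynomial d p" "\<phi> = abs_L2_sphere p"
    unfolding spherical_harmonics_def by blast
  then have "c *\<^sub>R \<phi> = abs_L2_sphere (\<lambda>x. c * p x)"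
    by (simp add: abs_L2_sphere_scale square_integrable_polynomial harmonic_polynomial_iff)
  then show "c *\<^sub>R \<phi> \<in> spherical_harmonics d"
    unfolding spherical_harmonics_def using harmonic_polynomial_cmult[OF p(1)] by blast
qed

lemma abs_L2_sphere_cong:
  assumes "square_integrable f" "square_integrable g" "\<And>x. norm x = 1 \<Longrightarrow> f x = g x"
  shows "abs_L2_sphere f = abs_L2_sphere g"
  using assms by (intro abs_L2_sphere_eqI AE_I2) auto

lemma polynomial_in_span_spherical_harmonics:
  assumes "real_polynomial_function p"
  shows "abs_L2_sphere p \<in> span (\<Union>d. spherical_harmonics d)"
  using assms
proof (rule polynomial_on_sphere_induct)
  fix d and h :: "real^'a \<Rightarrow> real" assume "harmonic_polynomial d h"
  then show "abs_L2_sphere h \<in> span (\<Union>d. spherical_harmonics d)"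
    by (intro span_base) (auto simp: spherical_harmonics_def)
next
  fix p q :: "real^'a \<Rightarrow> real"
  assume "real_polynomial_function p" "real_polynomial_function q"
    "abs_L2_sphere p \<in> span (\<Union>d. spherical_harmonics d)" "abs_L2_sphere q \<in> span (\<Union>d. spherical_harmonics d)"
  then show "abs_L2_sphere (\<lambda>x. p x + q x) \<in> span (\<Union>d. spherical_harmonics d)"
    by (simp add: abs_L2_sphere_add square_integrable_polynomial span_add)
next
  fix p q :: "real^'a \<Rightarrow> real"
  assume "real_polynomial_function p" "real_polynomial_function q"
    "abs_L2_sphere p \<in> span (\<Union>d. spherical_harmonics d)" "\<And>x. norm x = 1 \<Longrightarrow> p x = q x"
  then show "abs_L2_sphere q \<in> span (\<Union>d. spherical_harmonics d)"
    using abs_L2_sphere_cong[of p q] by (simp add: square_integrable_polynomial)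
qed

lemma polynomial_approximation_on_sphere:
  fixes f :: "real^'n \<Rightarrow> real"
  assumes "continuous_on (sphere 0 1) f"
  shows "\<exists>g. \<forall>k. real_polynomial_function (g k)
    \<and> (\<forall>x. norm x = 1 \<longrightarrow> \<bar>f x - g k x\<bar> \<le> inverse (real (Suc k)))"
proof -
  have "\<exists>g. real_polynomial_function g \<and> (\<forall>x\<in>sphere 0 1. \<bar>f x - g x\<bar> < inverse (real (Suc k)))" for k
    using Stone_Weierstrass_real_polynomial_function[OF compact_sphere assms, of "inverse (real (Suc k))"]
    by (metis inverse_positive_iff_positive of_nat_0_less_iff zero_less_Suc)
  then obtain g where "\<forall>k. real_polynomial_function (g k)
      \<and> (\<forall>x\<in>sphere 0 1. \<bar>f x - g k x\<bar> < inverse (real (Suc k)))"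
    by metis
  then show ?thesis by (intro exI[of _ g]) (auto simp: less_imp_le)
qed

lemma L2_limit_of_uniform_limit:
  fixes f :: "real^'n \<Rightarrow> real"
  assumes f: "continuous_on (sphere 0 1) f" and g: "\<And>k. continuous_on (sphere 0 1) (g k)"
    and le: "\<And>k x. norm x = 1 \<Longrightarrow> \<bar>f x - g k x\<bar> \<le> inverse (real (Suc k))"
  shows "(\<lambda>k. abs_L2_sphere (g k)) \<longlonglongrightarrow> abs_L2_sphere f"
proof -
  have "norm (abs_L2_sphere (g k) - abs_L2_sphere f) \<le> inverse (real (Suc k))" for k
  proof -
    have "norm (abs_L2_sphere (\<lambda>x. g k x - f x)) \<le> inverse (real (Suc k))"
      using le by (intro norm_abs_L2_sphere_le borel_measurable_sphere_continuous continuous_on_diff f g)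
        (simp add: abs_minus_commute)
    then show ?thesis by (simp add: abs_L2_sphere_diff square_integrable_continuous f g)
  qed
  then have "(\<lambda>k. abs_L2_sphere (g k) - abs_L2_sphere f) \<longlonglongrightarrow> 0"
    by (intro Lim_null_comparison[OF always_eventually LIMSEQ_inverse_real_of_nat]) simp
  then show ?thesis by (rule LIM_zero_cancel)
qed

lemma orthogonal_subspaces_spherical_harmonics:
  assumes n: "2 \<le> CARD('n::finite)"
  shows "orthogonal_subspaces (spherical_harmonics :: nat \<Rightarrow> 'n L2_sphere set)"
proof
  show "subspace (spherical_harmonics d :: 'n L2_sphere set)" for d
    by (rule subspace_spherical_harmonics)
next
  fix d e and \<phi> \<psi> :: "'n L2_sphere"
  assume de: "d \<noteq> e" and "\<phi> \<in> spherical_harmonics d" "\<psi> \<in> spherical_harmonics e"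
  then obtain p q where pq: "harmonic_polynomial d p" "harmonic_polynomial e q"
    "\<phi> = abs_L2_sphere p" "\<psi> = abs_L2_sphere q" unfolding spherical_harmonics_def by blast
  then show "\<phi> \<bullet> \<psi> = 0"
    using harmonic_polynomials_orthogonal[OF n de pq(1,2)]
    by (simp add: inner_abs_L2_sphere square_integrable_polynomial harmonic_polynomial_iff)
next
  let ?V = "span (\<Union>d. spherical_harmonics d) :: 'n L2_sphere set"
  have "\<psi> \<in> closure ?V" for \<psi>
  proof (rule in_closed_subspace_if_contains_continuous[OF closed_closure subspace_closure[OF subspace_span]])
    fix f :: "real^'n \<Rightarrow> real" assume f: "continuous_on (sphere 0 1) f"
    obtain g where "\<forall>k. real_polynomial_function (g k)
        \<and> (\<forall>x. norm x = 1 \<longrightarrow> \<bar>f x - g k x\<bar> \<le> inverse (real (Suc k)))"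
      using polynomial_approximation_on_sphere[OF f] ..
    then have g: "real_polynomial_function (g k)"
      "norm x = 1 \<Longrightarrow> \<bar>f x - g k x\<bar> \<le> inverse (real (Suc k))" for k x by auto
    have "(\<lambda>k. abs_L2_sphere (g k)) \<longlonglongrightarrow> abs_L2_sphere f"
      by (rule L2_limit_of_uniform_limit[OF f continuous_on_real_polynomial_function[OF g(1)] g(2)])
    then show "abs_L2_sphere f \<in> closure ?V"
      by (rule limit_in_closure[rotated]) (rule polynomial_in_span_spherical_harmonics[OF g(1)])
  qed
  then show "closure ?V = UNIV" by blast
qed

lemma integrable_subsphere_measure:
  fixes u :: "real^'n"
  assumes "2 \<le> CARD('n)" "norm u = 1" "continuous_on (sphere 0 1) f"
  shows "integrable (subsphere_measure u) (f :: _ \<Rightarrow> real)"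
proof -
  obtain B where B: "pairwise orthogonal (insert u B)" "\<And>b. b \<in> insert u B \<Longrightarrow> norm b = 1"
    "span B = {x. u \<bullet> x = 0}"
    using orthogonal_complement_basis[OF assms(2)] by metis
  interpret rotation_invariant_sphere "subsphere_measure u" B
    by (rule rotation_invariant_subsphere_measure) (use assms B in \<open>auto simp: pairwise_insert\<close>)
  show ?thesis using assms(3) by (rule integrable_M)
qed

lemma space_subsphere_measure: "space (subsphere_measure u) = great_subsphere u"
  by (simp add: subsphere_measure_def space_restrict_space)

lemma subsphere_average_add:
  fixes u :: "real^'n"
  assumes "2 \<le> CARD('n)" "norm u = 1" "continuous_on (sphere 0 1) f" "continuous_on (sphere 0 1) g"
  shows "subsphere_average (\<lambda>x. f x + g x) u = subsphere_average f u + subsphere_average g u"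
  unfolding subsphere_average_def
  using assms by (intro Bochner_Integration.integral_add integrable_subsphere_measure)

lemma subsphere_average_cong:
  assumes "\<And>x. norm x = 1 \<Longrightarrow> f x = g x"
  shows "subsphere_average f u = subsphere_average g u"
  unfolding subsphere_average_def
  using assms by (intro Bochner_Integration.integral_cong refl)
    (auto simp: space_subsphere_measure great_subsphere_def)

lemma abs_subsphere_average_diff_le:
  fixes u :: "real^'n"
  assumes n: "2 \<le> CARD('n)" and u: "norm u = 1"
    and f: "continuous_on (sphere 0 1) f" and g: "continuous_on (sphere 0 1) g"
    and le: "\<And>x. norm x = 1 \<Longrightarrow> \<bar>f x - g x\<bar> \<le> c"
  shows "\<bar>subsphere_average f u - subsphere_average g u\<bar> \<le> c"
proof -
  interpret prob_space "subsphere_measure u" by (rule prob_space_subsphere_measure[OF n u])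
  have fg: "integrable (subsphere_measure u) (\<lambda>x. f x - g x)"
    by (intro integrable_subsphere_measure n u continuous_on_diff f g)
  have "subsphere_average f u - subsphere_average g u = (LINT x|subsphere_measure u. f x - g x)"
    unfolding subsphere_average_def
    by (intro Bochner_Integration.integral_diff[symmetric] integrable_subsphere_measure n u f g)
  also have "\<bar>\<dots>\<bar> \<le> (LINT x|subsphere_measure u. \<bar>f x - g x\<bar>)"
    by (rule integral_abs_bound)
  also have "\<dots> \<le> (LINT x|subsphere_measure u. c)"
    using le fg by (intro integral_mono)
      (auto simp: space_subsphere_measure great_subsphere_def)
  finally show ?thesis by (simp add: prob_space)
qed

text \<open>
  The identity holds on harmonic polynomials because the averages are given by the same multiplier,
  and it is additive; thus it holds on all polynomials.  Both sides respect uniform limits.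
\<close>

lemma multiplier_is_subsphere_average:
  fixes T :: "'n::finite L2_sphere \<Rightarrow> 'n L2_sphere" and f :: "real^'n \<Rightarrow> real"
  assumes n: "3 \<le> CARD('n)" and T: "bounded_linear T"
    and m: "\<And>d h. h \<in> spherical_harmonics d \<Longrightarrow> T h = funk_multiplier (real CARD('n)) d *\<^sub>R h"
    and f: "continuous_on (sphere 0 1) f"
  shows "T (abs_L2_sphere f) = abs_L2_sphere (subsphere_average f)"
proof -
  interpret T: bounded_linear T by fact
  have n2: "2 \<le> CARD('n)" using n by simp
  have poly: "T (abs_L2_sphere p) = abs_L2_sphere (subsphere_average p)
      \<and> continuous_on (sphere 0 1) (subsphere_average p)"
    if "real_polynomial_function p" for p :: "real^'n \<Rightarrow> real"
    using that
  proof (rule polynomial_on_sphere_induct)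
    fix d and h :: "real^'n \<Rightarrow> real" assume h: "harmonic_polynomial d h"
    then have hp: "real_polynomial_function h" by (simp add: harmonic_polynomial_iff)
    have avg: "subsphere_average h x = funk_multiplier (real CARD('n)) d * h x" if "norm x = 1" for x
      by (rule subsphere_average_harmonic[OF n that h])
    have cont: "continuous_on (sphere 0 1) (subsphere_average h)"
      by (rule continuous_on_eq[of _ "\<lambda>x. funk_multiplier (real CARD('n)) d * h x"])
        (auto simp: avg intro!: continuous_intros continuous_on_real_polynomial_function hp)
    have "abs_L2_sphere h \<in> spherical_harmonics d" using h by (auto simp: spherical_harmonics_def)
    then have "T (abs_L2_sphere h) = abs_L2_sphere (\<lambda>x. funk_multiplier (real CARD('n)) d * h x)"
      by (simp add: m abs_L2_sphere_scale square_integrable_polynomial hp)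
    also have "\<dots> = abs_L2_sphere (subsphere_average h)"
      by (intro abs_L2_sphere_cong square_integrable_scale square_integrable_polynomial hp
          square_integrable_continuous cont) (simp add: avg)
    finally show "T (abs_L2_sphere h) = abs_L2_sphere (subsphere_average h)
      \<and> continuous_on (sphere 0 1) (subsphere_average h)" using cont by blast
  next
    fix p q :: "real^'n \<Rightarrow> real"
    assume pq: "real_polynomial_function p" "real_polynomial_function q"
      and IH: "T (abs_L2_sphere p) = abs_L2_sphere (subsphere_average p)
          \<and> continuous_on (sphere 0 1) (subsphere_average p)"
        "T (abs_L2_sphere q) = abs_L2_sphere (subsphere_average q)
          \<and> continuous_on (sphere 0 1) (subsphere_average q)"
    have avg: "subsphere_average (\<lambda>x. p x + q x) u = subsphere_average p u + subsphere_average q u"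
      if "norm u = 1" for u
      using that by (intro subsphere_average_add n2 continuous_on_real_polynomial_function pq)
    have cont: "continuous_on (sphere 0 1) (subsphere_average (\<lambda>x. p x + q x))"
      by (rule continuous_on_eq[OF continuous_on_add[OF IH(1)[THEN conjunct2] IH(2)[THEN conjunct2]]])
        (simp add: avg)
    have "T (abs_L2_sphere (\<lambda>x. p x + q x)) = abs_L2_sphere (\<lambda>u. subsphere_average p u + subsphere_average q u)"
      using IH by (simp add: abs_L2_sphere_add T.add square_integrable_polynomial pq square_integrable_continuous)
    also have "\<dots> = abs_L2_sphere (subsphere_average (\<lambda>x. p x + q x))"
      using IH by (intro abs_L2_sphere_cong square_integrable_add square_integrable_continuous cont)
        (auto simp: avg)
    finally show "T (abs_L2_sphere (\<lambda>x. p x + q x)) = abs_L2_sphere (subsphere_average (\<lambda>x. p x + q x))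
      \<and> continuous_on (sphere 0 1) (subsphere_average (\<lambda>x. p x + q x))" using cont by blast
  next
    fix p q :: "real^'n \<Rightarrow> real"
    assume pq: "real_polynomial_function p" "real_polynomial_function q"
      and IH: "T (abs_L2_sphere p) = abs_L2_sphere (subsphere_average p)
          \<and> continuous_on (sphere 0 1) (subsphere_average p)"
      and eq: "\<And>x. norm x = 1 \<Longrightarrow> p x = q x"
    have "subsphere_average p = subsphere_average q"
      by (intro ext subsphere_average_cong eq)
    moreover have "abs_L2_sphere p = abs_L2_sphere q"
      by (intro abs_L2_sphere_cong square_integrable_polynomial pq eq)
    ultimately show "T (abs_L2_sphere q) = abs_L2_sphere (subsphere_average q)
      \<and> continuous_on (sphere 0 1) (subsphere_average q)" using IH by simp
  qed
  obtain g where "\<forall>k. real_polynomial_function (g k)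
      \<and> (\<forall>x. norm x = 1 \<longrightarrow> \<bar>f x - g k x\<bar> \<le> inverse (real (Suc k)))"
    using polynomial_approximation_on_sphere[OF f] ..
  then have g: "real_polynomial_function (g k)"
    "norm x = 1 \<Longrightarrow> \<bar>f x - g k x\<bar> \<le> inverse (real (Suc k))" for k x by auto
  note gc = continuous_on_real_polynomial_function[OF g(1)]
  have avg: "\<bar>subsphere_average f u - subsphere_average (g k) u\<bar> \<le> inverse (real (Suc k))"
    if "norm u = 1" for u k
    using g(2) by (intro abs_subsphere_average_diff_le n2 that f gc)
  have "uniform_limit (sphere 0 1) (\<lambda>k. subsphere_average (g k)) (subsphere_average f) sequentially"
  proof (rule uniform_limitI)
    fix e :: real assume "0 < e"
    then have "eventually (\<lambda>k. inverse (real (Suc k)) < e) sequentially"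
      using order_tendstoD(2)[OF LIMSEQ_inverse_real_of_nat] by blast
    then show "\<forall>\<^sub>F k in sequentially. \<forall>u\<in>sphere 0 1. dist (subsphere_average (g k) u) (subsphere_average f u) < e"
      by eventually_elim (use avg in \<open>fastforce simp: dist_real_def abs_minus_commute intro: le_less_trans\<close>)
  qed
  then have cont: "continuous_on (sphere 0 1) (subsphere_average f)"
    using poly[OF g(1)] by (intro uniform_limit_theorem[OF always_eventually]) auto
  have "(\<lambda>k. T (abs_L2_sphere (g k))) \<longlonglongrightarrow> T (abs_L2_sphere f)"
    by (intro T.tendsto L2_limit_of_uniform_limit f gc g(2))
  moreover have "(\<lambda>k. abs_L2_sphere (subsphere_average (g k))) \<longlonglongrightarrow> abs_L2_sphere (subsphere_average f)"
    using poly[OF g(1)] by (intro L2_limit_of_uniform_limit cont avg) auto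
  moreover have "T (abs_L2_sphere (g k)) = abs_L2_sphere (subsphere_average (g k))" for k
    using poly[OF g(1)] by blast
  ultimately show ?thesis using LIMSEQ_unique by simp
qed

text \<open>
  The multiplier operator has the property that defines \<open>funk\<close>.  Any bounded operator with this
  property agrees with it on spherical harmonics and hence everywhere.
\<close>

lemma funk_spectral:
  assumes n: "3 \<le> CARD('n::finite)"
  shows "bounded_linear (funk :: 'n L2_sphere \<Rightarrow> 'n L2_sphere)"
    and "(h :: 'n L2_sphere) \<in> spherical_harmonics d \<Longrightarrow> funk h = funk_multiplier (real CARD('n)) d *\<^sub>R h"
proof -
  have n2: "2 \<le> CARD('n)" using n by simp
  interpret orthogonal_subspaces "spherical_harmonics :: nat \<Rightarrow> 'n L2_sphere set"
    by (rule orthogonal_subspaces_spherical_harmonics[OF n2])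
  have "\<bar>funk_multiplier (real CARD('n)) d\<bar> \<le> 1" for d
    using n2 by (intro abs_funk_multiplier_le_1) simp
  then obtain T :: "'n L2_sphere \<Rightarrow> 'n L2_sphere" where T: "bounded_linear T"
    and "\<forall>d. \<forall>h\<in>spherical_harmonics d. T h = funk_multiplier (real CARD('n)) d *\<^sub>R h"
    using multiplier_exists[of "funk_multiplier (real CARD('n))" 1] by blast
  then have Th: "T h = funk_multiplier (real CARD('n)) d *\<^sub>R h" if "h \<in> spherical_harmonics d" for d h
    using that by blast
  have Tavg: "T (abs_L2_sphere f) = abs_L2_sphere (subsphere_average f)"
    if "continuous_on (sphere 0 1) f" for f
    by (rule multiplier_is_subsphere_average[OF n T Th that])
  have "funk = T"
    unfolding funk_def
  proof (rule the_equality)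
    fix R :: "'n L2_sphere \<Rightarrow> 'n L2_sphere"
    assume R: "bounded_linear R \<and> (\<forall>f. continuous_on (sphere 0 1) f \<longrightarrow>
        R (abs_L2_sphere f) = abs_L2_sphere (subsphere_average f))"
    have RT: "R h = T h" if h: "h \<in> spherical_harmonics d" for d h
    proof -
      obtain p where p: "harmonic_polynomial d p" "h = abs_L2_sphere p"
        using h unfolding spherical_harmonics_def by blast
      then have "continuous_on (sphere 0 1) p"
        by (intro continuous_on_real_polynomial_function) (simp add: harmonic_polynomial_iff)
      then show ?thesis using R Tavg p by simp
    qed
    show "R = T"
      by (rule ext, rule bounded_linear_eqI[OF R[THEN conjunct1] T RT])
  qed (use T Tavg in simp)
  then show "bounded_linear (funk :: 'n L2_sphere \<Rightarrow> 'n L2_sphere)"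
    and "(h :: 'n L2_sphere) \<in> spherical_harmonics d \<Longrightarrow> funk h = funk_multiplier (real CARD('n)) d *\<^sub>R h"
    using T Th by simp_all
qed

lemma orthogonal_projection_eqI:
  assumes W: "subspace W" and y: "y \<in> W" "\<And>w. w \<in> W \<Longrightarrow> (x - y) \<bullet> w = 0"
  shows "orthogonal_projection W x = y"
  unfolding orthogonal_projection_def
proof (rule the_equality)
  fix z assume z: "z \<in> W \<and> (\<forall>w\<in>W. orthogonal (x - z) w)"
  then have "z - y \<in> W" using subspace_diff[OF W] y(1) by blast
  then have "(x - y) \<bullet> (z - y) = 0" "(x - z) \<bullet> (z - y) = 0"
    using y(2) z by (auto simp: orthogonal_def)
  then have "(z - y) \<bullet> (z - y) = 0" by (simp add: inner_diff_left)
  then show "z = y" by simp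
qed (use y in \<open>auto simp: orthogonal_def\<close>)

lemma proj_ge4_spectral:
  assumes n: "2 \<le> CARD('n::finite)"
  shows "bounded_linear (proj_ge4 :: 'n L2_sphere \<Rightarrow> 'n L2_sphere)"
    and "(h :: 'n L2_sphere) \<in> spherical_harmonics d \<Longrightarrow> proj_ge4 h = (if 4 \<le> d then h else 0)"
proof -
  interpret orthogonal_subspaces "spherical_harmonics :: nat \<Rightarrow> 'n L2_sphere set"
    by (rule orthogonal_subspaces_spherical_harmonics[OF n])
  have "\<bar>if 4 \<le> d then 1 else 0\<bar> \<le> (1::real)" for d :: nat by simp
  then obtain P :: "'n L2_sphere \<Rightarrow> 'n L2_sphere" where P: "bounded_linear P"
    and "\<forall>d. \<forall>h\<in>spherical_harmonics d. P h = (if 4 \<le> d then 1 else 0) *\<^sub>R h"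
    using multiplier_exists[of "\<lambda>d. if 4 \<le> d then 1 else 0" 1] by blast
  then have m: "P h = (if d \<in> {4..} then h else 0)" if "h \<in> spherical_harmonics d" for d h
    using that by simp
  have "proj_ge4 = P"
    unfolding proj_ge4_def
    by (intro ext orthogonal_projection_eqI subspace_closure subspace_span
        orthogonal_projection_multiplier[OF P m])
  then show "bounded_linear (proj_ge4 :: 'n L2_sphere \<Rightarrow> 'n L2_sphere)"
    and "(h :: 'n L2_sphere) \<in> spherical_harmonics d \<Longrightarrow> proj_ge4 h = (if 4 \<le> d then h else 0)"
    using P m by simp_all
qed

section \<open>A nonzero spherical harmonic of degree four\<close>

text \<open>
  The sphere carries the cone measure, so for homogeneous \<open>p\<close> vanishing almost everywhere on the sphere
  means vanishing almost everywhere on the ball.  The set of points of the ball with \<open>p \<noteq> 0\<close> is open,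
  hence empty if it is negligible.
\<close>

lemma homogeneous_polynomial_eq_0_if_L2_eq_0:
  fixes p :: "real^'n \<Rightarrow> real"
  assumes p: "real_polynomial_function p" "homogeneous d p" and 0: "abs_L2_sphere p = 0"
  shows "p x = 0"
proof (rule ccontr)
  assume nz: "p x \<noteq> 0"
  have cont: "continuous_on S p" for S by (rule continuous_on_real_polynomial_function[OF p(1)])
  have pm [measurable]: "p \<in> borel_measurable borel" by (intro borel_measurable_continuous_onI cont)
  have sp: "square_integrable p" by (rule square_integrable_polynomial[OF p(1)])
  have "(LINT x|sphere_measure. p x * p x) = 0"
    using 0 inner_abs_L2_sphere[OF sp sp] by simp
  then have "AE x in sphere_measure. p x * p x = 0"
    using integral_nonneg_eq_0_iff_AE[OF square_integrable_mult[OF sp sp]] by simp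
  then have "AE x in sphere_measure. p x = 0" by simp
  let ?U = "uniform_measure lborel (ball 0 1) :: (real^'n) measure"
  have "AE x in distr ?U borel sgn. x \<in> sphere 0 1 \<longrightarrow> p x = 0"
    using \<open>AE x in sphere_measure. p x = 0\<close> unfolding sphere_measure_def
    by (subst (asm) AE_restrict_space_iff) auto
  then have "AE x in ?U. sgn x \<in> sphere 0 1 \<longrightarrow> p (sgn x) = 0"
    by (subst (asm) AE_distr_iff) auto
  moreover have "emeasure lborel (ball (0::real^'n) 1) \<noteq> 0" "emeasure lborel (ball (0::real^'n) 1) < \<infinity>"
    using content_ball_pos[of 1 "0::real^'n"] emeasure_bounded_finite[of "ball (0::real^'n) 1"]
    by (auto simp: measure_def)
  ultimately have "AE x in lborel. x \<in> ball 0 1 \<longrightarrow> sgn x \<in> sphere 0 1 \<longrightarrow> p (sgn x) = 0"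
    by (subst (asm) AE_uniform_measure) auto
  moreover have "p x = 0" if "x \<in> ball 0 1" "x \<noteq> 0" "sgn x \<in> sphere 0 1 \<longrightarrow> p (sgn x) = 0" for x
  proof -
    have "p (sgn x) = 0" using that by (auto simp: norm_sgn)
    moreover have "x = norm x *\<^sub>R sgn x" using that by (simp add: sgn_div_norm)
    ultimately show ?thesis using homogeneousD[OF p(2), of "norm x" "sgn x"] by simp
  qed
  moreover have "AE x in lborel. x \<noteq> (0::real^'n)" by (rule AE_lborel_singleton)
  ultimately have AE: "AE x in lborel. \<not> (x \<in> ball 0 1 \<and> p x \<noteq> 0)"
    by (auto elim!: eventually_elim2)
  define S where "S = {x \<in> ball 0 1. p x \<noteq> 0}"
  have "S = ball 0 1 \<inter> p -` (- {0})" by (auto simp: S_def)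
  moreover have "open \<dots>"
    by (intro open_Int open_ball open_vimage cont) auto
  ultimately have S: "open S" by simp
  have "inverse (norm x + 1) *\<^sub>R x \<in> S"
  proof -
    have pos: "0 < norm x + 1" by (simp add: add_nonneg_pos)
    then have "norm x / (norm x + 1) < 1" by (simp add: pos_divide_less_eq)
    then have "norm (inverse (norm x + 1) *\<^sub>R x) < 1"
      using pos by (simp only: norm_scaleR abs_inverse abs_of_pos divide_inverse mult.commute)
    moreover have "p (inverse (norm x + 1) *\<^sub>R x) \<noteq> 0"
      unfolding homogeneousD[OF p(2)] using nz pos by (intro no_zero_divisors power_not_zero) auto
    ultimately show ?thesis by (simp only: S_def mem_Collect_eq mem_ball_0 simp_thms)
  qed
  then have "\<not> negligible S" using S open_not_negligible by blast
  moreover have "S \<in> null_sets lborel"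
    using AE S by (subst AE_iff_null_sets[of S lborel]) (auto simp: S_def)
  then have "negligible S"
    by (auto simp: negligible_iff_null_sets null_sets_completionI)
  ultimately show False by blast
qed

text \<open>
  For orthonormal \<open>a\<close> and \<open>b\<close> this is the real part of \<open>(x \<bullet> a + \<i> (x \<bullet> b)) ^ 4\<close>.
\<close>

lemma harmonic_quartic:
  fixes a b :: "real^'n"
  assumes "a \<bullet> a = 1" "b \<bullet> b = 1" "a \<bullet> b = 0"
  shows "harmonic_polynomial 4 (\<lambda>x. (x \<bullet> a) ^ 4 - 6 * ((x \<bullet> a)\<^sup>2 * (x \<bullet> b)\<^sup>2) + (x \<bullet> b) ^ 4)"
    (is "harmonic_polynomial 4 ?p")
proof -
  have p: "real_polynomial_function ?p"
    by (intro real_polynomial_function.intros(2,3,4) real_polynomial_function_diff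
        real_polynomial_function_power real_polynomial_function_inner_left)
  have D1: "dir_deriv c ?p = (\<lambda>x. (4 * (x \<bullet> a) ^ 3 - 12 * ((x \<bullet> a) * (x \<bullet> b)\<^sup>2)) * (c \<bullet> a)
      + (4 * (x \<bullet> b) ^ 3 - 12 * ((x \<bullet> a)\<^sup>2 * (x \<bullet> b))) * (c \<bullet> b))" for c
    by (intro ext dir_deriv_eqI[where v = c])
      (auto intro!: derivative_eq_intros simp: algebra_simps power2_eq_square power3_eq_cube)
  have D2: "dir_deriv c (dir_deriv c ?p) x = 12 * ((x \<bullet> a)\<^sup>2 - (x \<bullet> b)\<^sup>2) * ((c \<bullet> a) * (c \<bullet> a) - (c \<bullet> b) * (c \<bullet> b))
      - 48 * ((x \<bullet> a) * (x \<bullet> b)) * ((c \<bullet> a) * (c \<bullet> b))" for c x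
    unfolding D1
    by (rule trans[OF dir_deriv_eqI[where D = "\<lambda>v. 12 * ((x \<bullet> a)\<^sup>2 - (x \<bullet> b)\<^sup>2) * ((c \<bullet> a) * (v \<bullet> a) - (c \<bullet> b) * (v \<bullet> b))
          - 24 * ((x \<bullet> a) * (x \<bullet> b)) * ((c \<bullet> a) * (v \<bullet> b) + (c \<bullet> b) * (v \<bullet> a))"]])
      (auto intro!: derivative_eq_intros simp: algebra_simps power2_eq_square)
  have s: "(\<Sum>c\<in>Basis. (c \<bullet> v) * (c \<bullet> w)) = v \<bullet> w" for v w :: "real^'n"
    using euclidean_inner[of v w] by (simp add: inner_commute)
  have "laplacian ?p x = 0" for x
    unfolding laplacian_eq_dir_deriv[OF p] D2
    by (simp add: sum_subtractf sum_distrib_left[symmetric] s assms)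
  then show ?thesis
    unfolding harmonic_polynomial_iff using p by (simp add: homogeneous_def algebra_simps)
qed

lemma spherical_harmonics_4_nontrivial:
  assumes "2 \<le> CARD('n::finite)"
  obtains h where "h \<in> (spherical_harmonics 4 :: 'n L2_sphere set)" "h \<noteq> 0"
proof -
  obtain i j :: 'n where "i \<noteq> j"
    using assms by (metis UNIV_I card_2_iff' card_le_Suc0_iff_eq finite not_less_eq_eq numeral_2_eq_2)
  define a b :: "real^'n" where "a = axis i 1" and "b = axis j 1"
  have ab: "a \<bullet> a = 1" "b \<bullet> b = 1" "a \<bullet> b = 0" using \<open>i \<noteq> j\<close> by (auto simp: a_def b_def inner_axis_axis)
  define p where "p x = (x \<bullet> a) ^ 4 - 6 * ((x \<bullet> a)\<^sup>2 * (x \<bullet> b)\<^sup>2) + (x \<bullet> b) ^ 4" for x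
  have p: "harmonic_polynomial 4 p" unfolding p_def by (rule harmonic_quartic[OF ab])
  have "p a \<noteq> 0" by (simp add: p_def ab)
  then have "abs_L2_sphere p \<noteq> 0"
    using homogeneous_polynomial_eq_0_if_L2_eq_0 p by (auto simp: harmonic_polynomial_iff)
  then show thesis using p that by (auto simp: spherical_harmonics_def)
qed

section \<open>The gap constant and the sharp inequality\<close>

lemma gap_const_eq: "2 < n \<Longrightarrow> gap_const n = 1 / (1 - (3 / (n + 1))\<^sup>2)"
proof -
  assume n: "2 < n"
  have "(n - 2) * (n + 4) = (n + 1)\<^sup>2 - 9" by (simp add: power2_eq_square algebra_simps)
  moreover have "0 < (n - 2) * (n + 4)" using n by simp
  ultimately have "9 < (n + 1)\<^sup>2" "gap_const n = (n + 1)\<^sup>2 / ((n + 1)\<^sup>2 - 9)"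
    by (simp_all add: gap_const_def)
  moreover have "X / (X - 9) = 1 / (1 - 9 / X)" if "9 < X" for X :: real
    using that by (simp add: field_simps)
  ultimately show ?thesis by (simp add: power_divide)
qed

lemma strict_antimono_gap_const: "strict_antimono_on {2<..} gap_const"
proof (rule monotone_onI)
  fix x y :: real assume xy: "x \<in> {2<..}" "y \<in> {2<..}" "x < y"
  have eq: "gap_const z = 1 + 9 / ((z - 2) * (z + 4))" if "2 < z" for z
  proof -
    define d where "d = (z - 2) * (z + 4)"
    have "(z + 1)\<^sup>2 = d + 9" by (simp add: d_def power2_eq_square algebra_simps)
    moreover have "d \<noteq> 0" using that by (simp add: d_def)
    ultimately have "gap_const z = 1 + 9 / d"
      by (simp add: gap_const_def d_def[symmetric] add_divide_distrib)
    then show ?thesis by (simp only: d_def)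
  qed
  have "(x - 2) * (x + 4) < (y - 2) * (y + 4)"
    using xy by (intro mult_strict_mono) auto
  then show "gap_const x > gap_const y"
    using xy by (simp add: eq divide_strict_left_mono)
qed

lemma tendsto_gap_const_at_top: "(gap_const \<longlongrightarrow> 1) at_top"
  unfolding gap_const_def[abs_def] by real_asymp

lemma filterlim_gap_const_at_right_2: "filterlim gap_const at_top (at_right 2)"
  unfolding gap_const_def[abs_def] by real_asymp

theorem theorem1p3:
  assumes "3 \<le> CARD('n::finite)"
  shows "(\<forall>\<psi> :: 'n L2_sphere.
            norm (proj_ge4 \<psi>) \<le> gap_const (real CARD('n)) * norm (lin_op (lin_op \<psi>) - \<psi>))
       \<and> (\<forall>c :: real.
            (\<forall>\<psi> :: 'n L2_sphere. norm (proj_ge4 \<psi>) \<le> c * norm (lin_op (lin_op \<psi>) - \<psi>))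
            \<longrightarrow> gap_const (real CARD('n)) \<le> c)
       \<and> strict_antimono_on {2<..} gap_const
       \<and> (gap_const \<longlongrightarrow> 1) at_top
       \<and> filterlim gap_const at_top (at_right 2)"
proof -
  let ?n = "real CARD('n)"
  have n: "2 \<le> CARD('n)" "3 \<le> ?n" using assms by auto
  interpret orthogonal_subspaces "spherical_harmonics :: nat \<Rightarrow> 'n L2_sphere set"
    by (rule orthogonal_subspaces_spherical_harmonics[OF n(1)])
  define \<mu> where "\<mu> d = (?n - 1) * funk_multiplier ?n d" for d
  interpret F: bounded_linear "funk :: 'n L2_sphere \<Rightarrow> 'n L2_sphere"
    by (rule funk_spectral[OF assms])
  have L: "bounded_linear (lin_op :: 'n L2_sphere \<Rightarrow> 'n L2_sphere)"
    unfolding lin_op_def[abs_def] by (intro bounded_linear_intros F.bounded_linear_axioms)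
  interpret L: bounded_linear "lin_op :: 'n L2_sphere \<Rightarrow> 'n L2_sphere" by (rule L)
  have Lh: "lin_op (lin_op h) - h = ((\<mu> d)\<^sup>2 - 1) *\<^sub>R h" if "h \<in> spherical_harmonics d" for d and h :: "'n L2_sphere"
  proof -
    have "lin_op h = \<mu> d *\<^sub>R h"
      using funk_spectral(2)[OF assms that] by (simp add: lin_op_def \<mu>_def)
    then show ?thesis by (simp add: L.scaleR power2_eq_square scaleR_left_diff_distrib)
  qed
  have gap_pos: "0 < gap_const ?n" using n by (simp add: gap_const_def)
  then have inv_gap_pos: "0 < 1 / gap_const ?n" by simp
  have gap: "1 - (3 / (?n + 1))\<^sup>2 = 1 / gap_const ?n" using n by (simp add: gap_const_eq)
  have nz: "?n - 1 \<noteq> 0" using n by linarith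
  have cancel: "(?n - 1) * (3 / ((?n - 1) * (?n + 1))) = 3 / (?n + 1)"
    by (simp only: times_divide_eq_right mult_divide_mult_cancel_left[OF nz])
  have \<mu>_bound: "1 / gap_const ?n \<le> 1 - (\<mu> d)\<^sup>2" if "4 \<le> d" for d
  proof -
    have "\<bar>\<mu> d\<bar> = (?n - 1) * \<bar>funk_multiplier ?n d\<bar>"
      using n by (simp add: \<mu>_def abs_mult)
    also have "\<dots> \<le> (?n - 1) * (3 / ((?n - 1) * (?n + 1)))"
      using n that by (intro mult_left_mono abs_funk_multiplier_ge4) auto
    also have "\<dots> = 3 / (?n + 1)" by (rule cancel)
    also have "\<dots> = \<bar>3 / (?n + 1)\<bar>" by simp
    finally have "(\<mu> d)\<^sup>2 \<le> (3 / (?n + 1))\<^sup>2" by (rule abs_le_square_iff[THEN iffD1])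
    then show ?thesis using gap by linarith
  qed
  \<comment> \<open>On harmonics of degree \<open>d \<ge> 4\<close> the multiplier \<open>m\<close> inverts \<open>lin_op \<circ> lin_op - id\<close>.\<close>
  have bound: "norm (proj_ge4 \<psi>) \<le> gap_const ?n * norm (lin_op (lin_op \<psi>) - \<psi>)" for \<psi> :: "'n L2_sphere"
  proof -
    define m where "m d = (if 4 \<le> d then 1 / ((\<mu> d)\<^sup>2 - 1) else 0)" for d
    have m: "\<bar>m d\<bar> \<le> gap_const ?n" for d
    proof (cases "4 \<le> d")
      case True
      have pos: "0 < 1 - (\<mu> d)\<^sup>2" using inv_gap_pos \<mu>_bound[OF True] by linarith
      then have "\<bar>m d\<bar> = 1 / (1 - (\<mu> d)\<^sup>2)" using True by (simp add: m_def)
      also have "\<dots> \<le> 1 / (1 / gap_const ?n)"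
        using \<mu>_bound[OF True] inv_gap_pos by (intro divide_left_mono mult_pos_pos pos) simp_all
      finally show ?thesis by simp
    next
      case False
      then show ?thesis using gap_pos by (simp add: m_def)
    qed
    obtain S :: "'n L2_sphere \<Rightarrow> 'n L2_sphere" where S: "bounded_linear S"
      "\<forall>x. norm (S x) \<le> gap_const ?n * norm x"
      "\<forall>d. \<forall>h\<in>spherical_harmonics d. S h = m d *\<^sub>R h"
      using multiplier_exists[of m, OF m] by blast
    have Sh: "S h = m d *\<^sub>R h" if "h \<in> spherical_harmonics d" for d h using S(3) that by blast
    have "proj_ge4 \<psi> = S (lin_op (lin_op \<psi>) - \<psi>)"
    proof (rule bounded_linear_eqI[of proj_ge4 "\<lambda>\<psi>. S (lin_op (lin_op \<psi>) - \<psi>)"])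
      show "bounded_linear (proj_ge4 :: 'n L2_sphere \<Rightarrow> 'n L2_sphere)" by (rule proj_ge4_spectral[OF n(1)])
      show "bounded_linear (\<lambda>\<psi>. S (lin_op (lin_op \<psi>) - \<psi>))"
        by (intro bounded_linear_compose[OF S(1)] bounded_linear_sub bounded_linear_compose[OF L L]
            bounded_linear_ident)
      fix d and h :: "'n L2_sphere" assume h: "h \<in> spherical_harmonics d"
      have "S (lin_op (lin_op h) - h) = ((\<mu> d)\<^sup>2 - 1) *\<^sub>R m d *\<^sub>R h"
        by (simp only: Lh[OF h] Sh[OF h] linear_scale[OF bounded_linear.linear[OF S(1)]])
      moreover have "(\<mu> d)\<^sup>2 - 1 \<noteq> 0" if "4 \<le> d"
        using \<mu>_bound[OF that] inv_gap_pos by linarith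
      ultimately show "proj_ge4 h = S (lin_op (lin_op h) - h)"
        by (simp add: proj_ge4_spectral(2)[OF n(1) h] m_def)
    qed
    then show ?thesis using S(2) by simp
  qed
  have sharp: "gap_const ?n \<le> c"
    if c: "\<forall>\<psi> :: 'n L2_sphere. norm (proj_ge4 \<psi>) \<le> c * norm (lin_op (lin_op \<psi>) - \<psi>)" for c
  proof -
    obtain h :: "'n L2_sphere" where h: "h \<in> spherical_harmonics 4" "h \<noteq> 0"
      using spherical_harmonics_4_nontrivial[OF n(1)] by blast
    have "\<mu> 4 = 3 / (?n + 1)" using n cancel by (simp only: \<mu>_def funk_multiplier_4)
    then have "(\<mu> 4)\<^sup>2 - 1 = - (1 / gap_const ?n)" using gap by simp
    then have "lin_op (lin_op h) - h = - (1 / gap_const ?n) *\<^sub>R h" using Lh[OF h(1)] by simp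
    then have "norm (lin_op (lin_op h) - h) = norm h / gap_const ?n" using gap_pos by simp
    moreover have "norm h \<le> c * norm (lin_op (lin_op h) - h)"
      using c proj_ge4_spectral(2)[OF n(1) h(1)] by (metis order_refl)
    ultimately have "norm h \<le> (norm h * c) / gap_const ?n" by (simp add: mult.commute)
    then have "norm h * gap_const ?n \<le> norm h * c"
      using gap_pos by (simp only: pos_le_divide_eq)
    then show ?thesis using h(2) by simp
  qed
  show ?thesis
    by (intro conjI strict_antimono_gap_const tendsto_gap_const_at_top
        filterlim_gap_const_at_right_2) (use bound sharp in blast)+
qed

end
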